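(* Let $\varrho>0$ and let $\underline\omega(\cdot)$ be the constant rate totally asymmetric zero range process (TAZRP) started from its stationary distribution $\mu_\varrho^{\otimes\mathbb Z}$. Let $V^\varrho=\frac1{(1+\varrho)^2}$ and let $J^\varrho(t)=h_{[V^\varrho t]}(t)$ be the current across the characteristic. Then there exist constants $0<t_0,C<\infty$ such that for all $t\ge t_0$ $$C^{-1}t^{2/3}\;\le\;\mathbf{Var}^\varrho(J^\varrho(t))\;\le\; C\,t^{2/3}.$$
   Context: TAZRP: the Markov process on $\Omega=\{0,1,2,\dots\}^{\mathbb Z}$ in which, independently at different sites, the jump $(\omega_i,\omega_{i+1})\to(\omega_i-1,\omega_{i+1}+1)$ occurs with rate $\mathbb I_{(\omega_i>0)}$. $\mu_\varrho(k)=\left(\frac{\varrho}{1+\varrho}\right)^k\frac1{1+\varrho}$, $k=0,1,2,\dots$ (geometric with mean $\varrho$). $\mathbf{Var}^\varrho$ is the variance in the stationary process started from $\mu_\varrho^{\otimes\mathbb Z}$. Heights: $h_0(0)=0$, $h_{i-1}(0)-h_i(0)=\omega_i(0)$ for all $i\in\mathbb Z$, and $h_i$ increases by $1$ at each jump of a particle from $i$ to $i+1$; hence $h_{i-1}(t)-h_i(t)=\omega_i(t)$ for all $t\geq 0$, and $h_i(t)-h_i(0)$ is the net particle current across the bond $(i,i+1)$ up to time $t$. $[x]$ denotes the first integer from $x$ towards the origin: $[x]=\lfloor x\rfloor$ for $x\ge0$ and $[x]=\lceil x\rceil$ for $x<0$. *)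

theory Defs
  imports "HOL-Probability.Probability"
begin

text \<open>
  The constant rate totally asymmetric zero range process on the integer line, realized by
  its graphical construction.  Each site \<open>i\<close> carries an independent rate 1 Poisson clock,
  given by its i.i.d. exponential waiting times \<open>\<tau> i 0, \<tau> i 1, \<dots>\<close>; whenever the clock of
  \<open>i\<close> rings while site \<open>i\<close> is occupied, one particle jumps from \<open>i\<close> to \<open>i + 1\<close>.

  Almost surely, for every time horizon \<open>T\<close>, there are infinitely many sites on either side of
  the origin whose clocks do not ring before \<open>T\<close>, every clock rings finitely often before \<open>T\<close>,
  and no two clocks ever ring simultaneously.  Hence the evolution rule below determines
  \<open>\<omega>\<close> and \<open>h\<close> on the time set \<open>{0..}\<close> from the initial state and the clocks, up to null sets.
  Values of \<open>\<omega>\<close> and \<open>h\<close> at negative times are irrelevant.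
\<close>

definition ring :: "(int \<Rightarrow> nat \<Rightarrow> 'a \<Rightarrow> real) \<Rightarrow> int \<Rightarrow> nat \<Rightarrow> 'a \<Rightarrow> real" where
  "ring \<tau> i n x = (\<Sum>k\<le>n. \<tau> i k x)"

text \<open>
  The number of jumps from \<open>i\<close> to \<open>i + 1\<close> during \<open>{0<..t}\<close>.  Occupation is tested
  immediately before the ring.
\<close>

definition jumps ::
  "(int \<Rightarrow> nat \<Rightarrow> 'a \<Rightarrow> real) \<Rightarrow> (int \<Rightarrow> real \<Rightarrow> 'a \<Rightarrow> nat) \<Rightarrow> int \<Rightarrow> real \<Rightarrow> 'a \<Rightarrow> nat" where
  "jumps \<tau> \<omega> i t x =
     card {n. ring \<tau> i n x \<le> t \<and> (\<forall>\<^sub>F s in at_left (ring \<tau> i n x). 0 < \<omega> i s x)}"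

locale tazrp = prob_space M
  for M :: "'a measure"
    and \<tau> :: "int \<Rightarrow> nat \<Rightarrow> 'a \<Rightarrow> real"
    and \<omega> :: "int \<Rightarrow> real \<Rightarrow> 'a \<Rightarrow> nat"
    and h :: "int \<Rightarrow> real \<Rightarrow> 'a \<Rightarrow> int" +
  assumes occupation_measurable:
      "\<And>i t. 0 \<le> t \<Longrightarrow> random_variable (count_space UNIV) (\<omega> i t)"
    and height_measurable:
      "\<And>i t. 0 \<le> t \<Longrightarrow> random_variable (count_space UNIV) (h i t)"
    and waiting_times_exponential:
      "\<And>i n. distributed M lborel (\<tau> i n) (exponential_density 1)"
    and waiting_times_indep:
      "indep_vars (\<lambda>_. borel) (\<lambda>(i, n). \<tau> i n) UNIV"
    and initial_state_indep_clocks: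
      "indep_set
         (sets (vimage_algebra (space M) (\<lambda>x i. \<omega> i 0 x) (Pi\<^sub>M UNIV (\<lambda>_. count_space UNIV))))
         (sets (vimage_algebra (space M) (\<lambda>x (i, n). \<tau> i n x) (Pi\<^sub>M UNIV (\<lambda>_. borel))))"
    and occupation_evolution:
      "AE x in M. \<forall>i. \<forall>t\<ge>0.
         int (\<omega> i t x) = int (\<omega> i 0 x) + int (jumps \<tau> \<omega> (i - 1) t x) - int (jumps \<tau> \<omega> i t x)"
    and height_initial:
      "AE x in M. h 0 0 x = 0 \<and> (\<forall>i. h (i - 1) 0 x - h i 0 x = int (\<omega> i 0 x))"
    and height_evolution:
      "AE x in M. \<forall>i. \<forall>t\<ge>0. h i t x = h i 0 x + int (jumps \<tau> \<omega> i t x)"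

text \<open>The one-site marginal of the stationary distribution: geometric with mean \<open>\<rho>\<close>.\<close>

definition stationary_marginal :: "real \<Rightarrow> nat pmf" where
  "stationary_marginal \<rho> = geometric_pmf (1 / (1 + \<rho>))"

lemma pmf_stationary_marginal:
  assumes "0 < \<rho>"
  shows "pmf (stationary_marginal \<rho>) k = (\<rho> / (1 + \<rho>)) ^ k * (1 / (1 + \<rho>))"
proof -
  have "1 - 1 / (1 + \<rho>) = \<rho> / (1 + \<rho>)"
    using assms by (simp add: field_simps)
  then show ?thesis
    using assms by (simp add: stationary_marginal_def)
qed

locale stationary_tazrp = tazrp M \<tau> \<omega> h
  for \<rho> :: real
    and M :: "'a measure"
    and \<tau> :: "int \<Rightarrow> nat \<Rightarrow> 'a \<Rightarrow> real"
    and \<omega> :: "int \<Rightarrow> real \<Rightarrow> 'a \<Rightarrow> nat"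
    and h :: "int \<Rightarrow> real \<Rightarrow> 'a \<Rightarrow> int" +
  assumes initial_distribution:
    "distr M (Pi\<^sub>M UNIV (\<lambda>_. count_space UNIV)) (\<lambda>x i. \<omega> i 0 x) =
       Pi\<^sub>M UNIV (\<lambda>_. measure_pmf (stationary_marginal \<rho>))"

definition round_to_origin :: "real \<Rightarrow> int" where
  "round_to_origin x = (if 0 \<le> x then \<lfloor>x\<rfloor> else \<lceil>x\<rceil>)"

definition char_speed :: "real \<Rightarrow> real" where
  "char_speed \<rho> = 1 / (1 + \<rho>)\<^sup>2"

definition char_current :: "real \<Rightarrow> (int \<Rightarrow> real \<Rightarrow> 'a \<Rightarrow> int) \<Rightarrow> real \<Rightarrow> 'a \<Rightarrow> int" where
  "char_current \<rho> h t x = h (round_to_origin (char_speed \<rho> * t)) t x"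

end

theory Submission
  imports Defs
begin

text \<open>
  A ring of the clock of site \<open>i\<close> replaces the height \<open>h\<^sub>i\<close> by \<open>min (h\<^sub>i + 1) h\<^sub>i\<^sub>-\<^sub>1\<close>.  Hence the current
  commutes with minima of initial heights and is submodular in the initial occupation numbers.

  Start with geometric densities of parameter \<open>a\<close> to the left and \<open>b\<close> to the right of the origin
  and let \<open>J\<^sub>a\<^sub>b\<close> be the current at time \<open>t\<close> across site \<open>N\<close>.  An exponential change of measure turns
  the system into a stationary one and shows that, for \<open>\<theta> = ln (b / a)\<close>,
  \<open>E exp (\<theta> J\<^sub>a\<^sub>b) = exp ((b - a) t) ((1 - b) / (1 - a))\<^sup>N\<close>.  On the characteristic the logarithm of
  the right-hand side, centered by \<open>\<theta> E J\<^sub>a\<^sub>a\<close>, is of order \<open>t \<bar>\<theta>\<bar>\<^sup>3\<close>, and positive for \<open>\<theta> < 0\<close>.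

  Let \<open>X = (J\<^sub>a\<^sub>a - E J\<^sub>a\<^sub>a) / t\<^sup>1\<^sup>/\<^sup>3\<close>.  Since \<open>J\<^sub>a\<^sub>a\<close> is at least the minimum of two currents with known
  exponential moments, \<open>E exp (- s X)\<close> is bounded for every fixed \<open>s\<close>.

  Lower bound: by monotonicity in \<open>b\<close>, \<open>E exp (- X) \<ge> 1 + c\<close>, although \<open>E X = 0\<close>.

  Upper bound: expanding \<open>E exp (\<theta> J\<^sub>a\<^sub>b)\<close> to second order as \<open>\<theta>\<close> decreases to 0 bounds the variance
  by a multiple of \<open>(E J\<^sub>a\<^sub>a - E J\<^sub>a\<^sub>b) / \<theta>\<close>.  By submodularity this quotient is, up to constants, at
  most its value at \<open>\<theta> = t\<^sup>-\<^sup>1\<^sup>/\<^sup>3\<close>, where the loss \<open>E J\<^sub>a\<^sub>a - E J\<^sub>a\<^sub>b\<close> is of order \<open>t\<^sup>1\<^sup>/\<^sup>3\<close> by the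
  exponential moments.

  A site whose clock is silent up to time \<open>t\<close> screens off everything to its left.  So the infinite
  system is the limit of finite ones in which the sites far to the left are replaced by a reservoir.
\<close>

subsection \<open>Dynamics of the heights\<close>

text \<open>The exponential moment formula holds only at the single exponent \<theta> = ln (b / a),
  which is 0 for the stationary current itself. Information about J_aa must therefore come from
  comparison with other densities. As the comparison bounds J_aa from below by a minimum, it
  controls E exp (- s X) but gives no exponential bound for the upper tail. Hence all expansions of
  the exponential below use a square for positive arguments and an exponential of a negative
  multiple of X for negative ones.

  In terms of a = \<rho> / (1 + \<rho>), the probability that a site is occupied, the characteristic
  speed is (1 - a)^2. With b = a exp \<theta> and up to rounding, the centered logarithmic moment
  function per unit time has the derivative - (b - a)^2 / (1 - b) in \<theta>. Its double zero at b
  = a makes the function cubic, and t^(1/3) is the scale on which t \<theta>^3 is of order one.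

  Letting \<theta> tend to 0 in the upper bound requires the loss E J_aa - E J_ab to be linear in
  \<theta> down to 0. Submodularity supplies this: halving the probability of extra particles at
  each site reduces the loss to at most one half.\<close>

type_synonym letter = "nat \<times> bool"

text \<open>A letter \<open>(i, c)\<close> with \<open>0 < i\<close> is a ring of the clock of site \<open>i\<close>.  Site \<open>0\<close> is a
  reservoir, and at its rings a particle is released only if \<open>c\<close> holds.\<close>

definition step :: "letter \<Rightarrow> (nat \<Rightarrow> int) \<Rightarrow> nat \<Rightarrow> int" where
  "step l g = (if fst l = 0 then g(0 := g 0 + of_bool (snd l))
     else g(fst l := min (g (fst l) + 1) (g (fst l - 1))))"

definition run :: "letter list \<Rightarrow> (nat \<Rightarrow> int) \<Rightarrow> nat \<Rightarrow> int" where
  "run = fold step"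

lemma run_simps [simp]: "run [] g = g" "run (l # ls) g = run ls (step l g)"
  by (simp_all add: run_def)

text \<open>Heights with value 0 at index \<open>p\<close>, the position of the origin.\<close>

definition profile :: "nat \<Rightarrow> (nat \<Rightarrow> nat) \<Rightarrow> nat \<Rightarrow> int" where
  "profile p w i = int (\<Sum>j\<in>{i<..p}. w j) - int (\<Sum>j\<in>{p<..i}. w j)"

lemma profile_Suc: "profile p w (Suc i) = profile p w i - int (w (Suc i))"
proof (cases "i < p")
  case True
  then have "{i<..p} = insert (Suc i) {Suc i<..p}" by auto
  with True show ?thesis by (simp add: profile_def)
next
  case False
  then have "{p<..Suc i} = insert (Suc i) {p<..i}" by auto
  with False show ?thesis by (simp add: profile_def)
qed

lemma profile_0: "profile p w 0 = int (\<Sum>j=1..p. w j)"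
proof -
  have "{0<..p} = {1..p}" by auto
  then show ?thesis by (simp add: profile_def)
qed

text \<open>A ring acts through \<open>min (x + 1) y\<close>, which is monotone in both arguments;
  at the reservoir a mark that releases more can only raise index 0.\<close>

lemma run_mono:
  assumes "list_all2 (\<lambda>l l'. fst l = fst l' \<and> (snd l \<longrightarrow> snd l')) ls ls'" "g \<le> g'"
  shows "run ls g \<le> run ls' g'"
  using assms
proof (induction ls ls' arbitrary: g g' rule: list_all2_induct)
  case (Cons l ls l' ls')
  obtain a c c' where l: "l = (a, c)" "l' = (a, c')" "c \<longrightarrow> c'"
    using Cons(1) by (metis prod.collapse)
  have "step l g j \<le> step l' g' j" for j
    using l(3) le_funD[OF Cons(4), of j] le_funD[OF Cons(4), of "j - 1"]
    unfolding l step_def by (auto simp: min_def)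
  then have "step l g \<le> step l' g'" by (rule le_funI)
  then show ?case using Cons.IH by simp
qed simp

text \<open>The update \<open>min (x + 1) y\<close> commutes with pointwise minima of height
  functions. Only the reservoir breaks this, because the second copy may carry other marks. Index 0
  is therefore controlled by the first copy alone, which shares its marks with \<open>g\<close>;
  this is the purpose of \<open>g1 0 \<le> g 0\<close>.\<close>

lemma run_ge_min:
  assumes "map fst ls = map fst ls'"
    and "\<And>i. min (g1 i) (g2 i) \<le> g i" "g1 0 \<le> g 0"
  shows "min (run ls g1 i) (run ls' g2 i) \<le> run ls g i"
proof -
  have "length ls = length ls'" using assms(1) map_eq_imp_length_eq by blast
  then show ?thesis using assms
  proof (induction ls ls' arbitrary: g g1 g2 rule: list_induct2)
    case (Cons l ls l' ls')
    obtain a c c' where l: "l = (a, c)" "l' = (a, c')"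
      using Cons.prems(1) by (cases l; cases l') auto
    have "min (step l g1 j) (step l' g2 j) \<le> step l g j" for j
    proof (cases "a = 0 \<or> j \<noteq> a")
      case True
      then show ?thesis using Cons.prems(2)[of j] Cons.prems(3)
        unfolding l step_def by (auto simp: min_le_iff_disj)
    next
      case False
      then obtain k where k: "j = Suc k" "a = Suc k" by (cases j) auto
      show ?thesis
        using Cons.prems(2)[of k] Cons.prems(2)[of "Suc k"]
        unfolding l step_def k by (simp add: min_le_iff_disj) linarith
    qed
    moreover have "step l g1 0 \<le> step l g 0"
      using Cons.prems(3) unfolding l step_def by auto
    moreover have "map fst ls = map fst ls'" using Cons.prems(1) by simp
    ultimately show ?case unfolding run_simps by (intro Cons.IH)
  qed simp
qed

text \<open>The difference conditions say that occupation numbers increase from \<open>g\<close> to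
  \<open>g1\<close> and \<open>g2\<close>, and from these to \<open>g12\<close>; rings preserve this
  order (attractiveness). If both minima on the right are attained at the same argument, the
  inequality at that index suffices. If one is \<open>g1 (Suc k) + 1\<close> and the other
  \<open>g2 k\<close>, the order enters through
  \<open>g k - g2 k \<le> g1 k - g12 k \<le> g1 (Suc k) - g12 (Suc k)\<close>.\<close>

lemma run_submodular:
  fixes g g1 g2 g12 :: "nat \<Rightarrow> int"
  assumes "\<And>i. g i + g12 i \<le> g1 i + g2 i"
    and "g 0 = g1 0" "g 0 = g2 0" "g 0 = g12 0"
    and "\<And>i. g i - g1 i \<le> g (Suc i) - g1 (Suc i)"
    and "\<And>i. g i - g2 i \<le> g (Suc i) - g2 (Suc i)"
    and "\<And>i. g1 i - g12 i \<le> g1 (Suc i) - g12 (Suc i)"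
    and "\<And>i. g2 i - g12 i \<le> g2 (Suc i) - g12 (Suc i)"
  shows "run ls g i + run ls g12 i \<le> run ls g1 i + run ls g2 i"
  using assms
proof (induction ls arbitrary: g g1 g2 g12)
  case (Cons l ls)
  have att: "step l u j - step l v j \<le> step l u (Suc j) - step l v (Suc j)"
    if a: "\<And>i. u i - v i \<le> u (Suc i) - v (Suc i)" "u 0 = v 0" for u v :: "nat \<Rightarrow> int" and j
  proof (cases "fst l")
    case 0
    with a(1)[of j] a(2) show ?thesis by (auto simp: step_def)
  next
    case (Suc k)
    show ?thesis
    proof (cases "j = k \<or> j = Suc k")
      case True
      then show ?thesis
        using a(1)[of k] a(1)[of "Suc k"] Suc by (elim disjE) (simp_all add: step_def min_def)
    next
      case False
      then show ?thesis using a(1)[of j] Suc by (simp add: step_def)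
    qed
  qed
  have z: "step l g 0 = step l g1 0" "step l g 0 = step l g2 0" "step l g 0 = step l g12 0"
    using Cons.prems(2-4) by (auto simp: step_def)
  have sub: "step l g j + step l g12 j \<le> step l g1 j + step l g2 j" for j
  proof (cases "fst l = 0 \<or> j \<noteq> fst l")
    case True
    then show ?thesis using Cons(2)[of j] by (auto simp: step_def)
  next
    case False
    then obtain k where k: "j = Suc k" "fst l = Suc k" by (cases j) auto
    show ?thesis
      using Cons(2)[of k] Cons(2)[of "Suc k"] Cons(6-9)[of k] k
      by (simp add: step_def)
  qed
  have "run ls (step l g) i + run ls (step l g12) i \<le> run ls (step l g1) i + run ls (step l g2) i"
    using Cons.prems(2-4)
    by (intro Cons.IH sub z att Cons.prems(5-8)) simp_all
  then show ?case by simp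
qed simp

subsection \<open>Geometric occupation numbers\<close>

definition geo :: "real \<Rightarrow> nat pmf" where
  "geo a = geometric_pmf (1 - a)"

lemma pmf_geo [simp]: "0 < a \<Longrightarrow> a < 1 \<Longrightarrow> pmf (geo a) k = a ^ k * (1 - a)"
  by (simp add: geo_def)

lemma nn_integral_geo_power:
  assumes "0 < a" "a < 1" "0 \<le> s" "a * s < 1"
  shows "(\<integral>\<^sup>+k. ennreal (s ^ k) \<partial>geo a) = ennreal ((1 - a) / (1 - a * s))"
proof -
  have s: "(\<lambda>k. (1 - a) * (a * s) ^ k) sums ((1 - a) * (1 / (1 - a * s)))"
    using assms by (intro sums_mult geometric_sums) (simp add: abs_mult)
  have "(\<integral>\<^sup>+k. ennreal (s ^ k) \<partial>geo a) = (\<Sum>k. ennreal (pmf (geo a) k) * ennreal (s ^ k))"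
    by (simp add: nn_integral_measure_pmf nn_integral_count_space_nat)
  also have "\<dots> = (\<Sum>k. ennreal ((1 - a) * (a * s) ^ k))"
    using assms by (intro suminf_cong) (simp flip: ennreal_mult add: power_mult_distrib mult_ac)
  also have "\<dots> = ennreal ((1 - a) / (1 - a * s))"
    using assms s by (subst suminf_ennreal_eq[OF _ s]) auto
  finally show ?thesis .
qed

text \<open>Successive geometric weights have ratio \<open>a\<close>, so removing a particle from an
  occupied site costs the factor \<open>a\<close>. This is the local form of stationarity.\<close>

lemma nn_integral_geo_pos:
  assumes "0 < a" "a < 1"
  shows "(\<integral>\<^sup>+k. (if 0 < k then g k else 0) \<partial>geo a) = ennreal a * (\<integral>\<^sup>+k. g (Suc k) \<partial>geo a)"
proof -
  let ?f = "\<lambda>k. ennreal (pmf (geo a) k) * (if 0 < k then g k else 0)"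
  have "(\<integral>\<^sup>+k. (if 0 < k then g k else 0) \<partial>geo a) = (\<Sum>k. ?f k)"
    by (simp add: nn_integral_measure_pmf nn_integral_count_space_nat)
  also have "\<dots> = (\<Sum>k. ?f (Suc k))"
    by (subst suminf_offset[of _ 1]) (auto intro: summableI)
  also have "\<dots> = (\<Sum>k. ennreal a * (ennreal (pmf (geo a) k) * g (Suc k)))"
    using assms by (intro suminf_cong) (simp add: mult.assoc ennreal_mult flip: mult.assoc)
  also have "\<dots> = ennreal a * (\<integral>\<^sup>+k. g (Suc k) \<partial>geo a)"
    by (simp add: nn_integral_measure_pmf nn_integral_count_space_nat)
  finally show ?thesis .
qed

lemma nn_integral_Pi_geo_pos:
  assumes "finite A" "i \<in> A" "p i = geo a" "0 < a" "a < 1"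
  shows "(\<integral>\<^sup>+w. (if 0 < w i then g w else 0) \<partial>Pi_pmf A 0 p) =
    ennreal a * (\<integral>\<^sup>+w. g (w(i := Suc (w i))) \<partial>Pi_pmf A 0 p)"
proof -
  define B where "B = A - {i}"
  have A: "A = insert i B" "finite B" "i \<notin> B" using assms by (auto simp: B_def)
  have "(\<integral>\<^sup>+w. (if 0 < w i then g w else 0) \<partial>Pi_pmf A 0 p) =
      (\<integral>\<^sup>+k. (\<integral>\<^sup>+w. (if 0 < k then g (w(i := k)) else 0) \<partial>Pi_pmf B 0 p) \<partial>geo a)"
    by (simp add: A(1) Pi_pmf_insert[OF A(2,3)] assms(3) nn_integral_pair_pmf' cong: if_cong)
  also have "\<dots> = (\<integral>\<^sup>+k. (if 0 < k then \<integral>\<^sup>+w. g (w(i := k)) \<partial>Pi_pmf B 0 p else 0) \<partial>geo a)"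
    by (intro nn_integral_cong) auto
  also have "\<dots> = ennreal a * (\<integral>\<^sup>+k. (\<integral>\<^sup>+w. g (w(i := Suc k)) \<partial>Pi_pmf B 0 p) \<partial>geo a)"
    using assms by (subst nn_integral_geo_pos) auto
  also have "\<dots> = ennreal a * (\<integral>\<^sup>+w. g (w(i := Suc (w i))) \<partial>Pi_pmf A 0 p)"
    by (simp add: A(1) Pi_pmf_insert[OF A(2,3)] assms(3) nn_integral_pair_pmf')
  finally show ?thesis .
qed

text \<open>The q for which the generating functions satisfy (1 - b) / (1 - b s) = (1 - a) / (1 - a
  s) times (1 - q + q (1 - b) / (1 - b s)): the particles that raise \<open>geo a\<close> to
  \<open>geo b\<close> are absent with probability 1 - q and otherwise distributed as
  \<open>geo b\<close>.\<close>

definition thinning :: "real \<Rightarrow> real \<Rightarrow> real" where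
  "thinning a b = (b - a) / (b * (1 - a))"

lemma thinning_bounds:
  assumes "0 < a" "a \<le> b" "b < 1"
  shows "0 \<le> thinning a b" "thinning a b < 1"
  using assms by (auto simp: thinning_def divide_simps algebra_simps)

lemma geo_split:
  assumes "0 < a" "a \<le> b" "b < 1"
  shows "map_pmf (\<lambda>(x, c, g). x + (if c then g else 0))
     (pair_pmf (geo a) (pair_pmf (bernoulli_pmf (thinning a b)) (geo b))) = geo b"
    (is "?L = _")
proof (rule pmf_eqI)
  fix k
  let ?q = "thinning a b"
  have q: "0 \<le> ?q" "?q \<le> 1" using thinning_bounds[OF assms] by auto
  have L: "?L = bind_pmf (bernoulli_pmf ?q)
     (\<lambda>c. if c then geo a \<bind> (\<lambda>x. map_pmf ((+) x) (geo b)) else geo a)"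
  proof -
    have "?L = geo a \<bind> (\<lambda>x. bernoulli_pmf ?q \<bind>
        (\<lambda>c. geo b \<bind> (\<lambda>g. return_pmf (x + (if c then g else 0)))))"
      by (simp add: pair_pmf_def map_pmf_def bind_assoc_pmf bind_return_pmf)
    also have "\<dots> = bernoulli_pmf ?q \<bind> (\<lambda>c. geo a \<bind>
        (\<lambda>x. geo b \<bind> (\<lambda>g. return_pmf (x + (if c then g else 0)))))"
      by (rule bind_commute_pmf)
    also have "\<dots> = bind_pmf (bernoulli_pmf ?q)
        (\<lambda>c. if c then geo a \<bind> (\<lambda>x. map_pmf ((+) x) (geo b)) else geo a)"
      by (intro bind_pmf_cong refl) (auto simp: map_pmf_def bind_return_pmf')
    finally show ?thesis .
  qed
  have "pmf (geo a \<bind> (\<lambda>x. map_pmf ((+) x) (geo b))) k =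
      measure_pmf.expectation (geo a) (\<lambda>x. measure_pmf.prob (geo b) ((+) x -` {k}))"
    by (simp add: pmf_bind pmf_map)
  also have "(\<lambda>x. (+) x -` {k}) = (\<lambda>x. if x \<le> k then {k - x} else {})"
    by (auto simp: fun_eq_iff)
  also have "(\<lambda>x. measure_pmf.prob (geo b) (if x \<le> k then {k - x} else {})) =
      (\<lambda>x. if x \<le> k then pmf (geo b) (k - x) else 0)"
    by (auto simp: measure_pmf_single fun_eq_iff)
  also have "measure_pmf.expectation (geo a) \<dots> = (\<Sum>i\<le>k. pmf (geo b) (k - i) * pmf (geo a) i)"
    by (subst integral_measure_pmf_real[where A = "{..k}"]) (auto split: if_splits)
  also have "\<dots> = (1 - a) * (1 - b) * (\<Sum>i\<le>k. a ^ i * b ^ (k - i))"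
    using assms by (simp add: sum_distrib_left mult_ac)
  finally have conv: "pmf (geo a \<bind> (\<lambda>x. map_pmf ((+) x) (geo b))) k =
    (1 - a) * (1 - b) * (\<Sum>i\<le>k. a ^ i * b ^ (k - i))" .
  have "a ^ Suc k - b ^ Suc k = (a - b) * (\<Sum>i\<le>k. a ^ i * b ^ (k - i))"
    using power_diff_sumr2[of a "Suc k" b] by (simp add: lessThan_Suc_atMost mult.commute del: power_Suc)
  then have tele: "(b - a) * (\<Sum>i\<le>k. a ^ i * b ^ (k - i)) = b ^ Suc k - a ^ Suc k"
    by (simp add: algebra_simps)
  have "pmf ?L k = ?q * ((1 - a) * (1 - b) * (\<Sum>i\<le>k. a ^ i * b ^ (k - i))) + (1 - ?q) * (a ^ k * (1 - a))"
    unfolding L pmf_bind[of "bernoulli_pmf ?q"] using assms q by (simp add: conv)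
  also have "?q * ((1 - a) * (1 - b) * (\<Sum>i\<le>k. a ^ i * b ^ (k - i))) = (1 - b) * (b ^ Suc k - a ^ Suc k) / b"
    using assms unfolding tele[symmetric] thinning_def by (simp add: field_simps)
  also have "(1 - ?q) * (a ^ k * (1 - a)) = (1 - b) * a ^ Suc k / b"
    using assms unfolding thinning_def by (simp add: field_simps)
  also have "(1 - b) * (b ^ Suc k - a ^ Suc k) / b + (1 - b) * a ^ Suc k / b = pmf (geo b) k"
    using assms by (simp add: field_simps)
  finally show "pmf ?L k = pmf (geo b) k" .
qed

definition geo_coupling :: "real \<Rightarrow> real \<Rightarrow> (nat \<times> nat) pmf" where
  "geo_coupling a b = map_pmf (\<lambda>(x, c, g). (x, x + (if c then g else 0)))
     (pair_pmf (geo a) (pair_pmf (bernoulli_pmf (thinning a b)) (geo b)))"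

lemma geo_coupling:
  assumes "0 < a" "a \<le> b" "b < 1"
  shows "map_pmf fst (geo_coupling a b) = geo a" "map_pmf snd (geo_coupling a b) = geo b"
    "AE z in geo_coupling a b. fst z \<le> snd z"
proof -
  show "map_pmf fst (geo_coupling a b) = geo a"
    by (simp add: geo_coupling_def map_pmf_comp case_prod_unfold map_fst_pair_pmf)
  show "map_pmf snd (geo_coupling a b) = geo b"
    using geo_split[OF assms] by (simp add: geo_coupling_def map_pmf_comp case_prod_unfold)
  show "AE z in geo_coupling a b. fst z \<le> snd z"
    by (auto simp: AE_measure_pmf_iff geo_coupling_def)
qed

section \<open>Particle dynamics on the sites 1 to n\<close>

definition move :: "nat \<Rightarrow> nat \<Rightarrow> (nat \<Rightarrow> nat) \<Rightarrow> nat \<Rightarrow> nat" where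
  "move n i w = (if w i = 0 then w
     else if i < n then w(i := w i - 1, Suc i := Suc (w (Suc i))) else w(i := w i - 1))"

definition update :: "nat \<Rightarrow> letter \<Rightarrow> (nat \<Rightarrow> nat) \<Rightarrow> nat \<Rightarrow> nat" where
  "update n l w = (if fst l = 0 then if snd l then w(1 := Suc (w 1)) else w else move n (fst l) w)"

definition arrivals :: "letter list \<Rightarrow> nat" where
  "arrivals ls = length (filter (\<lambda>l. fst l = 0 \<and> snd l) ls)"

text \<open>Heights recovered from the height \<open>x\<close> at index 0. Beyond \<open>n\<close>
  the value is a default that letters of sites up to \<open>n\<close> leave untouched, so that
  \<open>step_stack\<close> can be an equation between functions.\<close>

definition stack :: "nat \<Rightarrow> int \<Rightarrow> (nat \<Rightarrow> nat) \<Rightarrow> nat \<Rightarrow> int" where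
  "stack n x w i = (if i \<le> n then x - int (\<Sum>j=1..i. w j) else 0)"

lemma stack_Suc: "Suc i \<le> n \<Longrightarrow> stack n x w (Suc i) = stack n x w i - int (w (Suc i))"
  by (simp add: stack_def)

lemma sum_upd_outside: "k \<notin> A \<Longrightarrow> (\<Sum>j\<in>A. (w(k := v)) j) = (\<Sum>j\<in>A. w j)"
  by (intro sum.cong) auto

lemma sum_upd_inside:
  fixes w :: "nat \<Rightarrow> nat"
  assumes "finite A" "k \<in> A"
  shows "int (\<Sum>j\<in>A. (w(k := v)) j) = int (\<Sum>j\<in>A. w j) + int v - int (w k)"
  using assms by (simp add: sum.remove[of A k] sum_upd_outside)

lemma step_stack:
  assumes "fst l \<le> n" "1 \<le> n"
  shows "step l (stack n x w) = stack n (x + of_bool (fst l = 0 \<and> snd l)) (update n l w)"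
proof
  fix i
  obtain k c where l: "l = (k, c)" by (cases l)
  have k: "k \<le> n" using assms l by simp
  show "step l (stack n x w) i = stack n (x + of_bool (fst l = 0 \<and> snd l)) (update n l w) i"
  proof (cases k)
    case 0
    show ?thesis
    proof (cases "i = 0")
      case False
      then have "int (\<Sum>j=1..i. (w(1 := Suc (w 1))) j) = int (\<Sum>j=1..i. w j) + 1"
        by (subst sum_upd_inside) auto
      with False 0 show ?thesis by (auto simp: step_def l stack_def update_def)
    qed (use 0 in \<open>auto simp: step_def l stack_def update_def\<close>)
  next
    case (Suc m)
    have st: "step l (stack n x w) i =
        (if i = k then if w k = 0 then stack n x w k else stack n x w k + 1 else stack n x w i)"
      using stack_Suc[of m n x w] k Suc by (auto simp: step_def l min_def)
    show ?thesis
    proof (cases "w k = 0 \<or> n < i")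
      case True
      then show ?thesis using Suc k unfolding st by (auto simp: l update_def move_def stack_def)
    next
      case False
      then have w: "0 < w k" "i \<le> n" by auto
      \<comment> \<open>Removing a particle from \<open>k\<close> lowers the partial sums from
        \<open>k\<close> on, and adding it to \<open>Suc k\<close> restores them from
        \<open>Suc k\<close> on. Only the height at \<open>k\<close> changes.\<close>
      have 1: "int (\<Sum>j=1..i. (w(k := w k - 1)) j) = int (\<Sum>j=1..i. w j) - of_bool (k \<le> i)"
      proof (cases "k \<le> i")
        case True
        then show ?thesis using w Suc by (subst sum_upd_inside) auto
      next
        case False
        then show ?thesis by (subst sum_upd_outside) auto
      qed
      have 2: "int (\<Sum>j=1..i. (w(k := w k - 1, Suc k := Suc (w (Suc k)))) j) =
          int (\<Sum>j=1..i. (w(k := w k - 1)) j) + of_bool (Suc k \<le> i)"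
      proof (cases "Suc k \<le> i")
        case True
        then show ?thesis by (subst sum_upd_inside) auto
      next
        case False
        then show ?thesis by (subst sum_upd_outside) auto
      qed
      define S1 where "S1 = int (\<Sum>j=1..i. (w(k := w k - 1)) j)"
      define S2 where "S2 = int (\<Sum>j=1..i. (w(k := w k - 1, Suc k := Suc (w (Suc k)))) j)"
      define S where "S = int (\<Sum>j=1..i. w j)"
      have "step l (stack n x w) i = x - S + of_bool (i = k)"
        using w unfolding st by (auto simp: stack_def S_def)
      moreover have "update n l w = (if k < n then w(k := w k - 1, Suc k := Suc (w (Suc k))) else w(k := w k - 1))"
        using w Suc by (simp add: l update_def move_def)
      then have "stack n (x + of_bool (fst l = 0 \<and> snd l)) (update n l w) i = x - (if k < n then S2 else S1)"
        using w Suc by (simp add: l stack_def S1_def S2_def)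
      ultimately show ?thesis
        using 1 2 w(2) k unfolding S1_def[symmetric] S2_def[symmetric] S_def[symmetric] by auto
    qed
  qed
qed

lemma run_stack:
  assumes "\<And>l. l \<in> set ls \<Longrightarrow> fst l \<le> n" "1 \<le> n"
  shows "run ls (stack n x w) = stack n (x + int (arrivals ls)) (fold (update n) ls w)"
  using assms
proof (induction ls arbitrary: x w)
  case (Cons l ls)
  have "run (l # ls) (stack n x w) = run ls (step l (stack n x w))" by simp
  also have "step l (stack n x w) = stack n (x + of_bool (fst l = 0 \<and> snd l)) (update n l w)"
    using Cons.prems by (intro step_stack) auto
  also have "run ls \<dots> = stack n (x + of_bool (fst l = 0 \<and> snd l) + int (arrivals ls))
      (fold (update n) ls (update n l w))"
    using Cons.prems by (intro Cons.IH) auto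
  finally show ?case by (simp add: arrivals_def add_ac)
qed (simp add: arrivals_def)

lemma run_cong:
  assumes "\<And>l. l \<in> set ls \<Longrightarrow> fst l \<le> n" "\<And>i. i \<le> n \<Longrightarrow> g i = g' i" "i \<le> n"
  shows "run ls g i = run ls g' i"
  using assms
proof (induction ls arbitrary: g g')
  case (Cons l ls)
  have "step l g j = step l g' j" if "j \<le> n" for j
    using Cons.prems(1)[of l] Cons.prems(2)[of "fst l"] Cons.prems(2)[of "fst l - 1"]
      Cons.prems(2)[of j] Cons.prems(2)[of 0] that by (auto simp: step_def)
  then have "run ls (step l g) i = run ls (step l g') i"
    using Cons.prems(1,3) by (intro Cons.IH) auto
  then show ?case by simp
qed simp

lemma profile_eq_stack:
  assumes "i \<le> n"
  shows "profile p w i = stack n (int (\<Sum>j=1..p. w j)) w i"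
  using assms
proof (induction i)
  case 0
  then show ?case by (simp add: profile_0 stack_def)
next
  case (Suc i)
  then show ?case by (simp add: profile_Suc stack_Suc)
qed

text \<open>Conservation of particles on the sites 1 to \<open>n\<close>. The three terms depend on
  the initial state, on the marks and on the final state, so an exponential of the current
  factorizes into three weights.\<close>

lemma run_profile:
  assumes "\<And>l. l \<in> set ls \<Longrightarrow> fst l \<le> n" "1 \<le> n"
  shows "run ls (profile p w) n =
    int (\<Sum>j=1..p. w j) + int (arrivals ls) - int (\<Sum>j=1..n. fold (update n) ls w j)"
proof -
  have "run ls (profile p w) n = run ls (stack n (int (\<Sum>j=1..p. w j)) w) n"
    by (rule run_cong[OF assms(1)]) (auto simp: profile_eq_stack)
  then show ?thesis by (simp add: run_stack[OF assms] stack_def)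
qed

subsection \<open>The exponentially tilted system\<close>

text \<open>The mark thins the reservoir clock to rate \<open>a\<close>, which is the probability
  that a stationary site of parameter \<open>a\<close> is occupied and hence the mean rate at which
  it emits particles.\<close>

definition letter_pmf :: "nat \<Rightarrow> real \<Rightarrow> letter pmf" where
  "letter_pmf n a = pair_pmf (pmf_of_set {0..n}) (bernoulli_pmf a)"

text \<open>The superposition of n + 1 independent Poisson clocks of rate 1, observed up to time
  \<open>t\<close>.\<close>

definition word_pmf :: "nat \<Rightarrow> real \<Rightarrow> real \<Rightarrow> letter list pmf" where
  "word_pmf n t a = bind_pmf (poisson_pmf (real (Suc n) * t)) (\<lambda>k. replicate_pmf k (letter_pmf n a))"

definition initial_pmf :: "nat \<Rightarrow> nat \<Rightarrow> real \<Rightarrow> real \<Rightarrow> (nat \<Rightarrow> nat) pmf" where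
  "initial_pmf n p a b = Pi_pmf {1..n} 0 (\<lambda>i. geo (if i \<le> p then a else b))"

definition current_pmf :: "nat \<Rightarrow> nat \<Rightarrow> real \<Rightarrow> real \<Rightarrow> real \<Rightarrow> int pmf" where
  "current_pmf n p t a b =
     map_pmf (\<lambda>(w, ls). run ls (profile p w) n) (pair_pmf (initial_pmf n p a b) (word_pmf n t a))"

lemma nn_integral_pmf_swap:
  "(\<integral>\<^sup>+x. \<integral>\<^sup>+y. f x y \<partial>measure_pmf Q \<partial>measure_pmf P) = (\<integral>\<^sup>+y. \<integral>\<^sup>+x. f x y \<partial>measure_pmf P \<partial>measure_pmf Q)"
proof -
  have "(\<integral>\<^sup>+x. \<integral>\<^sup>+y. f x y \<partial>measure_pmf Q \<partial>measure_pmf P) = (\<integral>\<^sup>+z. f (fst z) (snd z) \<partial>pair_pmf P Q)"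
    by (simp add: nn_integral_pair_pmf')
  also have "\<dots> = (\<integral>\<^sup>+z. f (snd z) (fst z) \<partial>pair_pmf Q P)"
    by (subst pair_commute_pmf) (simp add: case_prod_unfold)
  finally show ?thesis by (simp add: nn_integral_pair_pmf')
qed

lemma set_word_pmf:
  assumes "ls \<in> set_pmf (word_pmf n t a)" "l \<in> set ls" "0 < t"
  shows "fst l \<le> n"
  using assms by (auto simp: word_pmf_def letter_pmf_def set_replicate_pmf lists_eq_set)

lemma set_replicate_letter_pmf:
  assumes "ls \<in> set_pmf (replicate_pmf k (letter_pmf n a))" "l \<in> set ls"
  shows "fst l \<le> n"
  using assms by (auto simp: letter_pmf_def set_replicate_pmf lists_eq_set)

lemma telescope_shift:
  "T (1::nat) + (\<Sum>i=1..n. Z i + T (Suc i)) = (\<Sum>i=1..n. Z i + T i) + (T (Suc n) :: ennreal)"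
  by (induction n) (simp_all add: add_ac)

text \<open>Global balance for tandem queues with Poisson arrivals of rate \<open>b\<close>.\<close>

lemma balance:
  fixes f :: "(nat \<Rightarrow> nat) \<Rightarrow> ennreal"
  assumes "1 \<le> n" "0 < b" "b < 1"
  defines "P \<equiv> Pi_pmf {1..n} 0 (\<lambda>_. geo b)"
  shows "ennreal b * (\<integral>\<^sup>+w. f (w(1 := Suc (w 1))) \<partial>P) + (\<Sum>i=1..n. \<integral>\<^sup>+w. f (move n i w) \<partial>P) =
    ennreal (real n + b) * (\<integral>\<^sup>+w. f w \<partial>P)"
proof -
  \<comment> \<open>\<open>Z i\<close> and \<open>T i\<close> are the parts of the integral with
    site \<open>i\<close> empty and occupied; by the geometric weights, \<open>T i\<close> is
    \<open>b\<close> times the integral with one particle added at \<open>i\<close>. A ring of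
    \<open>i\<close> turns \<open>T i\<close> into \<open>T (Suc i)\<close>, so the flows telescope.
    At \<open>Suc n\<close> the particle has left the system, hence the separate case.\<close>
  define Z where "Z i = (\<integral>\<^sup>+w. (if w i = 0 then f w else 0) \<partial>P)" for i
  define T where "T i = ennreal b * (if i \<le> n then \<integral>\<^sup>+w. f (w(i := Suc (w i))) \<partial>P else \<integral>\<^sup>+w. f w \<partial>P)" for i
  have T: "(\<integral>\<^sup>+w. (if 0 < w i then f w else 0) \<partial>P) = T i" if "i \<in> {1..n}" for i
    using that assms(2,3) unfolding P_def T_def by (subst nn_integral_Pi_geo_pos) auto
  have ZT: "Z i + T i = (\<integral>\<^sup>+w. f w \<partial>P)" if "i \<in> {1..n}" for i
    unfolding T[OF that, symmetric] Z_def
    by (subst nn_integral_add[symmetric]) (auto intro!: nn_integral_cong)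
  have mv: "(\<integral>\<^sup>+w. f (move n i w) \<partial>P) = Z i + T (Suc i)" if i: "i \<in> {1..n}" for i
  proof -
    have "(\<integral>\<^sup>+w. f (move n i w) \<partial>P) = (\<integral>\<^sup>+w. (if w i = 0 then f w else 0) +
        (if 0 < w i then f (move n i w) else 0) \<partial>P)"
      by (intro nn_integral_cong) (auto simp: move_def)
    also have "\<dots> = Z i + (\<integral>\<^sup>+w. (if 0 < w i then f (move n i w) else 0) \<partial>P)"
      by (simp add: nn_integral_add Z_def)
    also have "(\<integral>\<^sup>+w. (if 0 < w i then f (move n i w) else 0) \<partial>P) =
        ennreal b * (\<integral>\<^sup>+w. f (move n i (w(i := Suc (w i)))) \<partial>P)"
      using i assms(2,3) unfolding P_def by (subst nn_integral_Pi_geo_pos) auto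
    also have "move n i (w(i := Suc (w i))) = (if i < n then w(Suc i := Suc (w (Suc i))) else w)" for w
      by (auto simp: move_def fun_eq_iff)
    then have "ennreal b * (\<integral>\<^sup>+w. f (move n i (w(i := Suc (w i)))) \<partial>P) = T (Suc i)"
      by (auto simp: T_def)
    finally show ?thesis .
  qed
  have "ennreal b * (\<integral>\<^sup>+w. f (w(1 := Suc (w 1))) \<partial>P) + (\<Sum>i=1..n. \<integral>\<^sup>+w. f (move n i w) \<partial>P) =
      T 1 + (\<Sum>i=1..n. Z i + T (Suc i))"
    using assms(1) by (simp add: T_def mv)
  also have "\<dots> = (\<Sum>i=1..n. Z i + T i) + T (Suc n)" by (rule telescope_shift)
  also have "\<dots> = of_nat n * (\<integral>\<^sup>+w. f w \<partial>P) + ennreal b * (\<integral>\<^sup>+w. f w \<partial>P)"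
    by (simp add: ZT) (simp add: T_def)
  also have "\<dots> = ennreal (real n + b) * (\<integral>\<^sup>+w. f w \<partial>P)"
    using assms(2) by (simp add: distrib_right ennreal_of_nat_eq_real_of_nat)
  finally show ?thesis .
qed

lemma nn_integral_letter_pmf:
  assumes "0 \<le> a" "a \<le> 1"
  shows "(\<integral>\<^sup>+l. g l \<partial>letter_pmf n a) =
    (\<Sum>i=0..n. g (i, True) * ennreal a + g (i, False) * ennreal (1 - a)) / of_nat (Suc n)"
  using assms by (simp add: letter_pmf_def nn_integral_pair_pmf' nn_integral_pmf_of_set ennreal_of_nat_eq_real_of_nat)

text \<open>The weight \<open>b / a\<close> on a released particle replaces the arrival rate
  \<open>a\<close> by \<open>b\<close>, for which the product measure is stationary by
  \<open>balance\<close>. The weighted letter has total mass 1 + (b - a) / (n + 1), and this is the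
  factor gained per letter.\<close>

lemma tilted_letter:
  fixes f :: "(nat \<Rightarrow> nat) \<Rightarrow> ennreal"
  assumes "1 \<le> n" "0 < a" "a < 1" "0 < b" "b < 1"
  defines "P \<equiv> Pi_pmf {1..n} 0 (\<lambda>_. geo b)"
  shows "(\<integral>\<^sup>+w. \<integral>\<^sup>+l. ennreal ((b / a) ^ arrivals [l]) * f (update n l w) \<partial>letter_pmf n a \<partial>P) =
    ennreal (1 + (b - a) / real (Suc n)) * (\<integral>\<^sup>+w. f w \<partial>P)"
proof -
  let ?g = "\<lambda>w l. ennreal ((b / a) ^ arrivals [l]) * f (update n l w)"
  have ba: "ennreal (b / a) * (x * ennreal a) = ennreal b * x" for x
  proof -
    have "ennreal (b / a) * (x * ennreal a) = ennreal (b / a) * ennreal a * x" by (simp add: mult_ac)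
    also have "ennreal (b / a) * ennreal a = ennreal b"
      using assms by (simp flip: ennreal_mult)
    finally show ?thesis .
  qed
  have split: "x * ennreal a + x * ennreal (1 - a) = x" for x
    using assms by (simp flip: distrib_left ennreal_plus)
  have *: "(\<integral>\<^sup>+l. ?g w l \<partial>letter_pmf n a) =
      (ennreal b * f (w(1 := Suc (w 1))) + f w * ennreal (1 - a) + (\<Sum>i=1..n. f (move n i w))) / of_nat (Suc n)"
    for w
  proof -
    have "{0..n} = insert 0 {1..n}" by auto
    then have "(\<Sum>i=0..n. ?g w (i, True) * ennreal a + ?g w (i, False) * ennreal (1 - a)) =
        ennreal b * f (w(1 := Suc (w 1))) + f w * ennreal (1 - a) +
        (\<Sum>i=1..n. ?g w (i, True) * ennreal a + ?g w (i, False) * ennreal (1 - a))"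
      by (simp add: update_def arrivals_def ba mult.assoc)
    also have "(\<Sum>i=1..n. ?g w (i, True) * ennreal a + ?g w (i, False) * ennreal (1 - a)) =
        (\<Sum>i=1..n. f (move n i w))"
      by (intro sum.cong refl) (auto simp: update_def arrivals_def split)
    finally show ?thesis using assms by (simp only: nn_integral_letter_pmf)
  qed
  have "(\<integral>\<^sup>+w. \<integral>\<^sup>+l. ?g w l \<partial>letter_pmf n a \<partial>P) =
      (ennreal b * (\<integral>\<^sup>+w. f (w(1 := Suc (w 1))) \<partial>P) + (\<integral>\<^sup>+w. f w \<partial>P) * ennreal (1 - a) +
       (\<Sum>i=1..n. \<integral>\<^sup>+w. f (move n i w) \<partial>P)) / of_nat (Suc n)"
    unfolding * by (simp add: nn_integral_divide nn_integral_add nn_integral_cmult nn_integral_multc nn_integral_sum)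
  also have "\<dots> = (ennreal (real n + b) * (\<integral>\<^sup>+w. f w \<partial>P) + (\<integral>\<^sup>+w. f w \<partial>P) * ennreal (1 - a)) / of_nat (Suc n)"
    using balance[OF assms(1,4,5), of f] unfolding P_def by (simp add: add_ac)
  also have "\<dots> = ennreal (real n + b + (1 - a)) / of_nat (Suc n) * (\<integral>\<^sup>+w. f w \<partial>P)"
    using assms by (simp add: ennreal_plus distrib_left distrib_right mult.commute ennreal_times_divide divide_ennreal_def mult_ac)
  also have "ennreal (real n + b + (1 - a)) / of_nat (Suc n) = ennreal (1 + (b - a) / real (Suc n))"
  proof -
    have "real n + b + (1 - a) = (1 + (b - a) / real (Suc n)) * real (Suc n)"
      by (simp add: field_simps)
    then show ?thesis
      using assms by (simp add: ennreal_of_nat_eq_real_of_nat divide_ennreal del: of_nat_Suc)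
  qed
  finally show ?thesis .
qed

lemma tilted_word:
  fixes f :: "(nat \<Rightarrow> nat) \<Rightarrow> ennreal"
  assumes "1 \<le> n" "0 < a" "a < 1" "0 < b" "b < 1"
  defines "P \<equiv> Pi_pmf {1..n} 0 (\<lambda>_. geo b)"
  shows "(\<integral>\<^sup>+w. \<integral>\<^sup>+ls. ennreal ((b / a) ^ arrivals ls) * f (fold (update n) ls w) \<partial>replicate_pmf k (letter_pmf n a) \<partial>P) =
    ennreal ((1 + (b - a) / real (Suc n)) ^ k) * (\<integral>\<^sup>+w. f w \<partial>P)"
proof (induction k)
  case 0
  show ?case by (simp add: arrivals_def)
next
  case (Suc k)
  let ?c = "1 + (b - a) / real (Suc n)"
  have "0 \<le> (1 + real n + (b - a)) / real (Suc n)" using assms(2-5) by (intro divide_nonneg_pos) auto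
  also have "\<dots> = ?c" by (simp add: add_divide_distrib)
  finally have c: "0 \<le> ?c" .
  define F where "F w = (\<integral>\<^sup>+ls. ennreal ((b / a) ^ arrivals ls) * f (fold (update n) ls w)
      \<partial>replicate_pmf k (letter_pmf n a))" for w
  have arr: "arrivals (l # ls) = arrivals [l] + arrivals ls" for l ls by (simp add: arrivals_def)
  have "(\<integral>\<^sup>+w. \<integral>\<^sup>+ls. ennreal ((b / a) ^ arrivals ls) * f (fold (update n) ls w) \<partial>replicate_pmf (Suc k) (letter_pmf n a) \<partial>P)
      = (\<integral>\<^sup>+w. \<integral>\<^sup>+l. ennreal ((b / a) ^ arrivals [l]) * F (update n l w) \<partial>letter_pmf n a \<partial>P)"
  proof (intro nn_integral_cong)
    fix w
    have "ennreal ((b / a) ^ arrivals (l # ls)) * f (fold (update n) (l # ls) w) =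
        ennreal ((b / a) ^ arrivals [l]) * (ennreal ((b / a) ^ arrivals ls) * f (fold (update n) ls (update n l w)))"
      for l ls using assms(2,4) unfolding arr[of l ls] by (simp add: power_add ennreal_mult mult.assoc)
    then show "(\<integral>\<^sup>+ls. ennreal ((b / a) ^ arrivals ls) * f (fold (update n) ls w) \<partial>replicate_pmf (Suc k) (letter_pmf n a)) =
        (\<integral>\<^sup>+l. ennreal ((b / a) ^ arrivals [l]) * F (update n l w) \<partial>letter_pmf n a)"
      unfolding F_def by (simp add: nn_integral_cmult[symmetric])
  qed
  also have "\<dots> = ennreal ?c * (\<integral>\<^sup>+w. F w \<partial>P)"
    unfolding P_def by (rule tilted_letter[OF assms(1-5)])
  also have "(\<integral>\<^sup>+w. F w \<partial>P) = ennreal (?c ^ k) * (\<integral>\<^sup>+w. f w \<partial>P)"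
    unfolding F_def by (rule Suc.IH)
  finally show ?case using c by (simp add: ennreal_mult mult.assoc)
qed

text \<open>Weighting \<open>geo a\<close> by powers of \<open>b / a\<close> yields
  \<open>geo b\<close> up to the normalization (1 - a) / (1 - b), and the sites beyond
  \<open>p\<close> have parameter \<open>b\<close> already. The exponent is the initial height at
  index 0, which is the first weight supplied by \<open>run_profile\<close>.\<close>

lemma tilted_initial:
  fixes g :: "(nat \<Rightarrow> nat) \<Rightarrow> ennreal"
  assumes "0 < a" "a < 1" "0 < b" "b < 1" "p \<le> n"
  shows "(\<integral>\<^sup>+w. ennreal ((b / a) ^ (\<Sum>j=1..p. w j)) * g w \<partial>initial_pmf n p a b) =
    ennreal (((1 - a) / (1 - b)) ^ p) * (\<integral>\<^sup>+w. g w \<partial>Pi_pmf {1..n} 0 (\<lambda>_. geo b))"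
proof -
  let ?r = "(1 - a) / (1 - b)"
  have *: "pmf (initial_pmf n p a b) w * (b / a) ^ (\<Sum>j=1..p. w j) = ?r ^ p * pmf (Pi_pmf {1..n} 0 (\<lambda>_. geo b)) w"
    for w
  proof -
    have "(b / a) ^ (\<Sum>j=1..p. w j) = (\<Prod>j\<in>{1..p}. (b / a) ^ w j)" by (rule power_sum)
    also have "\<dots> = (\<Prod>j\<in>{1..n}. if j \<le> p then (b / a) ^ w j else 1)"
      using assms(5) by (intro prod.mono_neutral_cong_left) auto
    finally have 1: "(b / a) ^ (\<Sum>j=1..p. w j) = (\<Prod>j\<in>{1..n}. if j \<le> p then (b / a) ^ w j else 1)" .
    have "?r ^ p = (\<Prod>j\<in>{1..p}. ?r)" by simp
    also have "\<dots> = (\<Prod>j\<in>{1..n}. if j \<le> p then ?r else 1)"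
      using assms(5) by (intro prod.mono_neutral_cong_left) auto
    finally have 2: "?r ^ p = (\<Prod>j\<in>{1..n}. if j \<le> p then ?r else 1)" .
    have 3: "pmf (geo (if j \<le> p then a else b)) (w j) * (if j \<le> p then (b / a) ^ w j else 1) =
        (if j \<le> p then ?r else 1) * pmf (geo b) (w j)" for j
      using assms by (auto simp: power_divide field_simps)
    show ?thesis
      unfolding 1 2 initial_pmf_def pmf_Pi[OF finite_atLeastAtMost]
      by (auto simp: prod.distrib[symmetric] 3 simp del: pmf_geo intro!: prod.cong)
  qed
  have "(\<integral>\<^sup>+w. ennreal ((b / a) ^ (\<Sum>j=1..p. w j)) * g w \<partial>initial_pmf n p a b) =
      (\<integral>\<^sup>+w. ennreal (?r ^ p) * (ennreal (pmf (Pi_pmf {1..n} 0 (\<lambda>_. geo b)) w) * g w) \<partial>count_space UNIV)"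
    unfolding nn_integral_measure_pmf
    using assms by (intro nn_integral_cong)
      (simp add: mult.assoc[symmetric] ennreal_mult[symmetric] *[unfolded One_nat_def] )
  also have "\<dots> = ennreal (?r ^ p) * (\<integral>\<^sup>+w. g w \<partial>Pi_pmf {1..n} 0 (\<lambda>_. geo b))"
    by (simp add: nn_integral_cmult nn_integral_measure_pmf)
  finally show ?thesis .
qed

section \<open>Exponential moments and mean of the current in the finite system\<close>

lemma nn_integral_poisson_power:
  assumes "0 < r" "0 \<le> c"
  shows "(\<integral>\<^sup>+k. ennreal (c ^ k) \<partial>poisson_pmf r) = ennreal (exp (r * (c - 1)))"
proof -
  have s: "(\<lambda>k. exp (- r) * ((r * c) ^ k /\<^sub>R fact k)) sums (exp (- r) * exp (r * c))"
    by (intro sums_mult exp_converges)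
  have "(\<integral>\<^sup>+k. ennreal (c ^ k) \<partial>poisson_pmf r) = (\<Sum>k. ennreal (pmf (poisson_pmf r) k) * ennreal (c ^ k))"
    by (simp add: nn_integral_measure_pmf nn_integral_count_space_nat)
  also have "\<dots> = (\<Sum>k. ennreal (exp (- r) * ((r * c) ^ k /\<^sub>R fact k)))"
    using assms by (intro suminf_cong) (simp flip: ennreal_mult add: power_mult_distrib field_simps)
  also have "\<dots> = ennreal (exp (- r) * exp (r * c))"
    using assms by (intro suminf_ennreal_eq[OF _ s]) auto
  also have "exp (- r) * exp (r * c) = exp (r * (c - 1))"
    by (simp add: exp_add[symmetric] algebra_simps)
  finally show ?thesis .
qed

lemma nn_integral_poisson_id:
  assumes "0 < r"
  shows "(\<integral>\<^sup>+k. ennreal (real k) \<partial>poisson_pmf r) = ennreal r"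
proof -
  have s: "(\<lambda>k. r * (exp (- r) * (r ^ k /\<^sub>R fact k))) sums (r * (exp (- r) * exp r))"
    by (intro sums_mult exp_converges)
  have "(\<integral>\<^sup>+k. ennreal (real k) \<partial>poisson_pmf r) = (\<Sum>k. ennreal (pmf (poisson_pmf r) k) * ennreal (real k))"
    by (simp add: nn_integral_measure_pmf nn_integral_count_space_nat)
  also have "\<dots> = (\<Sum>k. ennreal (pmf (poisson_pmf r) (Suc k)) * ennreal (real (Suc k)))"
    by (subst suminf_offset[of _ 1]) (auto intro: summableI)
  also have "\<dots> = (\<Sum>k. ennreal (r * (exp (- r) * (r ^ k /\<^sub>R fact k))))"
  proof (intro suminf_cong)
    fix k
    have "r ^ Suc k / fact (Suc k) * exp (- r) * real (Suc k) = r * (exp (- r) * (r ^ k /\<^sub>R fact k))"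
      by (simp add: divide_simps del: of_nat_Suc)
    then show "ennreal (pmf (poisson_pmf r) (Suc k)) * ennreal (real (Suc k)) =
        ennreal (r * (exp (- r) * (r ^ k /\<^sub>R fact k)))"
      using assms by (simp flip: ennreal_mult del: of_nat_Suc fact_Suc power_Suc)
  qed
  also have "\<dots> = ennreal (r * (exp (- r) * exp r))"
    using assms by (intro suminf_ennreal_eq[OF _ s]) auto
  finally show ?thesis by (simp flip: exp_add)
qed

text \<open>Weighting by \<open>(b/a)\<close> to the power of the height at index 0 turns the initial density \<open>a\<close>
  and the arrival rate \<open>a\<close> into \<open>b\<close>, which makes the system stationary.\<close>

theorem mgf_current:
  assumes "0 < a" "a < 1" "0 < b" "b < 1" "1 \<le> n" "p \<le> n" "0 < t"
  shows "(\<integral>\<^sup>+x. ennreal (exp (ln (b / a) * real_of_int x)) \<partial>current_pmf n p t a b) =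
    ennreal (exp ((b - a) * t) * ((1 - b) / (1 - a)) ^ (n - p))"
proof -
  let ?r = "b / a" and ?c = "1 + (b - a) / real (Suc n)" and ?L = "real (Suc n) * t"
  let ?P = "Pi_pmf {1..n} 0 (\<lambda>_. geo b)"
  \<comment> \<open>The weight of the final state. After the tilt this state consists of independent
    \<open>geo b\<close> variables, so only their generating function at \<open>a / b\<close> has to
    be evaluated.\<close>
  define f where "f w = ennreal ((a / b) ^ (\<Sum>j=1..n. w j))" for w :: "nat \<Rightarrow> nat"
  define G where "G k w = (\<integral>\<^sup>+ls. ennreal (?r ^ arrivals ls) * f (fold (update n) ls w)
      \<partial>replicate_pmf k (letter_pmf n a))" for k w
  have c: "0 \<le> ?c"
  proof -
    have "0 \<le> (1 + real n + (b - a)) / real (Suc n)" using assms(1-4) by (intro divide_nonneg_pos) auto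
    also have "\<dots> = ?c" by (simp add: add_divide_distrib)
    finally show ?thesis .
  qed
  have pw: "ennreal (exp (ln ?r * real_of_int (run ls (profile p w) n))) =
      ennreal (?r ^ (\<Sum>j=1..p. w j)) * (ennreal (?r ^ arrivals ls) * f (fold (update n) ls w))"
    if "\<And>l. l \<in> set ls \<Longrightarrow> fst l \<le> n" for w ls
  proof -
    have e: "exp (ln ?r * real k) = ?r ^ k" for k
      using assms by (simp add: exp_of_nat2_mult)
    have J: "run ls (profile p w) n = int (\<Sum>j=1..p. w j) + int (arrivals ls) - int (\<Sum>j=1..n. fold (update n) ls w j)"
      using that assms(5) by (rule run_profile)
    have "exp (ln ?r * real_of_int (run ls (profile p w) n)) =
        exp (ln ?r * real (\<Sum>j=1..p. w j)) * exp (ln ?r * real (arrivals ls)) /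
        exp (ln ?r * real (\<Sum>j=1..n. fold (update n) ls w j))"
      unfolding J by (simp add: exp_add[symmetric] exp_diff[symmetric] algebra_simps del: of_nat_sum)
    also have "\<dots> = ?r ^ (\<Sum>j=1..p. w j) * (?r ^ arrivals ls * (a / b) ^ (\<Sum>j=1..n. fold (update n) ls w j))"
      unfolding e using assms by (simp add: power_divide)
    finally show ?thesis using assms by (simp add: f_def ennreal_mult)
  qed
  have "(\<integral>\<^sup>+x. ennreal (exp (ln ?r * real_of_int x)) \<partial>current_pmf n p t a b) =
      (\<integral>\<^sup>+w. \<integral>\<^sup>+k. \<integral>\<^sup>+ls. ennreal (exp (ln ?r * real_of_int (run ls (profile p w) n)))
        \<partial>replicate_pmf k (letter_pmf n a) \<partial>poisson_pmf ?L \<partial>initial_pmf n p a b)"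
    by (simp add: current_pmf_def nn_integral_pair_pmf' word_pmf_def)
  also have "\<dots> = (\<integral>\<^sup>+w. \<integral>\<^sup>+k. ennreal (?r ^ (\<Sum>j=1..p. w j)) * G k w \<partial>poisson_pmf ?L \<partial>initial_pmf n p a b)"
  proof (intro nn_integral_cong)
    fix w k
    have "(\<integral>\<^sup>+ls. ennreal (exp (ln ?r * real_of_int (run ls (profile p w) n))) \<partial>replicate_pmf k (letter_pmf n a))
      = (\<integral>\<^sup>+ls. ennreal (?r ^ (\<Sum>j=1..p. w j)) * (ennreal (?r ^ arrivals ls) * f (fold (update n) ls w))
      \<partial>replicate_pmf k (letter_pmf n a))"
      by (intro nn_integral_cong_AE AE_pmfI pw set_replicate_letter_pmf)
    then show "(\<integral>\<^sup>+ls. ennreal (exp (ln ?r * real_of_int (run ls (profile p w) n))) \<partial>replicate_pmf k (letter_pmf n a))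
      = ennreal (?r ^ (\<Sum>j=1..p. w j)) * G k w"
      by (simp add: G_def nn_integral_cmult)
  qed
  also have "\<dots> = (\<integral>\<^sup>+k. \<integral>\<^sup>+w. ennreal (?r ^ (\<Sum>j=1..p. w j)) * G k w \<partial>initial_pmf n p a b \<partial>poisson_pmf ?L)"
    by (rule nn_integral_pmf_swap)
  also have "\<dots> = (\<integral>\<^sup>+k. ennreal (((1 - a) / (1 - b)) ^ p) * (ennreal (?c ^ k) * (\<integral>\<^sup>+w. f w \<partial>?P)) \<partial>poisson_pmf ?L)"
  proof (intro nn_integral_cong)
    fix k
    have "(\<integral>\<^sup>+w. G k w \<partial>?P) = ennreal (?c ^ k) * (\<integral>\<^sup>+w. f w \<partial>?P)"
      unfolding G_def by (rule tilted_word[OF assms(5,1-4)])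
    then show "(\<integral>\<^sup>+w. ennreal (?r ^ (\<Sum>j=1..p. w j)) * G k w \<partial>initial_pmf n p a b) =
        ennreal (((1 - a) / (1 - b)) ^ p) * (ennreal (?c ^ k) * (\<integral>\<^sup>+w. f w \<partial>?P))"
      using tilted_initial[OF assms(1-4,6), of "G k"] by simp
  qed
  also have "\<dots> = ennreal (((1 - a) / (1 - b)) ^ p) * (ennreal (exp (?L * (?c - 1))) * (\<integral>\<^sup>+w. f w \<partial>?P))"
    using assms c by (simp add: nn_integral_cmult nn_integral_multc nn_integral_poisson_power)
  also have "?L * (?c - 1) = (b - a) * t" by (simp add: field_simps)
  also have "(\<integral>\<^sup>+w. f w \<partial>?P) = ennreal (((1 - b) / (1 - a)) ^ n)"
  proof -
    have "f w = (\<Prod>j\<in>{1..n}. ennreal ((a / b) ^ w j))" for w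
      unfolding f_def using assms by (subst prod_ennreal) (simp_all add: power_sum)
    then have "(\<integral>\<^sup>+w. f w \<partial>?P) = (\<Prod>j\<in>{1..n}. \<integral>\<^sup>+k. ennreal ((a / b) ^ k) \<partial>geo b)"
      using nn_integral_prod_Pi_pmf[of "{1..n}" 0 "\<lambda>_. geo b" "\<lambda>_ k. ennreal ((a / b) ^ k)"] by simp
    also have "(\<integral>\<^sup>+k. ennreal ((a / b) ^ k) \<partial>geo b) = ennreal ((1 - b) / (1 - a))"
      using assms by (subst nn_integral_geo_power) auto
    finally show ?thesis using assms by (simp add: ennreal_power)
  qed
  also have "ennreal (((1 - a) / (1 - b)) ^ p) * (ennreal (exp ((b - a) * t)) * ennreal (((1 - b) / (1 - a)) ^ n)) =
      ennreal (exp ((b - a) * t) * (((1 - a) / (1 - b)) ^ p * ((1 - b) / (1 - a)) ^ n))"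
    using assms by (simp flip: ennreal_mult add: mult_ac)
  \<comment> \<open>The normalization of the \<open>p\<close> tilted sites cancels against their
    final weight. The result depends on \<open>n - p\<close> only, which makes the later bounds
    uniform in the cut-off \<open>p\<close>.\<close>
  also have "((1 - a) / (1 - b)) ^ p * ((1 - b) / (1 - a)) ^ n = ((1 - b) / (1 - a)) ^ (n - p)"
  proof -
    have "((1 - b) / (1 - a)) ^ n = ((1 - b) / (1 - a)) ^ p * ((1 - b) / (1 - a)) ^ (n - p)"
      using assms(6) by (simp flip: power_add)
    moreover have "((1 - a) / (1 - b)) ^ p * ((1 - b) / (1 - a)) ^ p = 1"
      using assms by (simp flip: power_mult_distrib)
    ultimately show ?thesis by (simp add: mult.assoc[symmetric])
  qed
  finally show ?thesis .
qed

lemma nn_integral_geo_id: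
  assumes "0 < a" "a < 1"
  shows "(\<integral>\<^sup>+k. ennreal (real k) \<partial>geo a) = ennreal (a / (1 - a))"
proof -
  have "(\<integral>\<^sup>+k. ennreal (real k) \<partial>geo a) = ennreal (measure_pmf.expectation (geo a) real)"
    using assms integrable_real_geometric_pmf[of "1 - a"] by (intro nn_integral_eq_integral) (auto simp: geo_def)
  then show ?thesis using assms expectation_geometric_pmf[of "1 - a"] by (simp add: geo_def)
qed

lemma nn_integral_arrivals_replicate:
  assumes "0 \<le> a" "a \<le> 1"
  shows "(\<integral>\<^sup>+ls. ennreal (real (arrivals ls)) \<partial>replicate_pmf k (letter_pmf n a)) =
    ennreal (real k * (a / real (Suc n)))"
proof (induction k)
  case (Suc k)
  have one: "(\<integral>\<^sup>+l. ennreal (real (arrivals [l])) \<partial>letter_pmf n a) = ennreal (a / real (Suc n))"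
  proof -
    have "{0..n} = insert 0 {1..n}" by auto
    then have "(\<Sum>i=0..n. ennreal (real (arrivals [(i, True)])) * ennreal a +
        ennreal (real (arrivals [(i, False)])) * ennreal (1 - a)) = ennreal a"
      by (simp add: arrivals_def)
    then show ?thesis using assms
      by (simp add: nn_integral_letter_pmf ennreal_of_nat_eq_real_of_nat divide_ennreal flip: of_nat_Suc del: of_nat_Suc)
  qed
  have "(\<integral>\<^sup>+ls. ennreal (real (arrivals ls)) \<partial>replicate_pmf (Suc k) (letter_pmf n a)) =
     (\<integral>\<^sup>+l. \<integral>\<^sup>+ls. ennreal (real (arrivals [l])) + ennreal (real (arrivals ls))
       \<partial>replicate_pmf k (letter_pmf n a) \<partial>letter_pmf n a)"
  proof -
    have arr: "arrivals (l # ls) = arrivals [l] + arrivals ls" for l ls by (simp add: arrivals_def)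
    have arr': "ennreal (real (arrivals (l # ls))) = ennreal (real (arrivals [l])) + ennreal (real (arrivals ls))" for l ls
      by (subst arr) (simp add: ennreal_plus)
    show ?thesis
      unfolding replicate_pmf.simps nn_integral_bind_pmf nn_integral_return_pmf[OF zero_le]
      by (intro nn_integral_cong arr')
  qed
  also have "\<dots> = ennreal (a / real (Suc n)) + ennreal (real k * (a / real (Suc n)))"
    by (simp add: nn_integral_add one Suc.IH)
  also have "\<dots> = ennreal (real (Suc k) * (a / real (Suc n)))"
  proof -
    have "real (Suc k) * x = x + real k * x" for x by (simp add: algebra_simps)
    then show ?thesis using assms by (simp only:) (subst ennreal_plus; simp)
  qed
  finally show ?case .
qed (simp add: arrivals_def)

text \<open>By stationarity (\<open>tilted_word\<close> with equal parameters) the final content of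
  the sites has its initial mean. In \<open>run_profile\<close> this leaves the mean number of
  arrivals minus the mean content of the sites beyond \<open>p\<close>.\<close>

theorem mean_current:
  assumes "0 < a" "a < 1" "1 \<le> n" "p \<le> n" "0 < t"
  shows "integrable (current_pmf n p t a a) real_of_int"
    and "measure_pmf.expectation (current_pmf n p t a a) real_of_int = a * t - real (n - p) * (a / (1 - a))"
proof -
  let ?r = "a / (1 - a)" and ?L = "real (Suc n) * t"
  let ?Q = "pair_pmf (initial_pmf n p a a) (word_pmf n t a)"
  let ?P = "Pi_pmf {1..n} 0 (\<lambda>_. geo a)"
  have r: "0 \<le> ?r" using assms by simp
  have init: "initial_pmf n p a a = ?P" by (simp add: initial_pmf_def)
  have comp: "(\<integral>\<^sup>+w. ennreal (real (\<Sum>j=1..m. w j)) \<partial>?P) = ennreal (real m * ?r)" if "m \<le> n" for m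
  proof -
    have "(\<integral>\<^sup>+w. ennreal (real (\<Sum>j=1..m. w j)) \<partial>?P) = (\<Sum>j=1..m. \<integral>\<^sup>+w. ennreal (real (w j)) \<partial>?P)"
    proof -
      have "ennreal (real (\<Sum>j=1..m. w j)) = (\<Sum>j=1..m. ennreal (real (w j)))" for w :: "nat \<Rightarrow> nat"
        by (subst sum_ennreal) auto
      then show ?thesis by (simp only:) (subst nn_integral_sum; simp)
    qed
    also have "\<dots> = (\<Sum>j=1..m. ennreal ?r)"
    proof (intro sum.cong refl)
      fix j assume "j \<in> {1..m}"
      then have "map_pmf (\<lambda>w. w j) ?P = geo a" using that by (subst Pi_pmf_component) auto
      then have "(\<integral>\<^sup>+w. ennreal (real (w j)) \<partial>?P) = (\<integral>\<^sup>+k. ennreal (real k) \<partial>geo a)"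
        by (metis (no_types, lifting) nn_integral_cong nn_integral_map_pmf)
      then show "(\<integral>\<^sup>+w. ennreal (real (w j)) \<partial>?P) = ennreal ?r"
        using assms by (simp add: nn_integral_geo_id)
    qed
    also have "\<dots> = ennreal (real m * ?r)" using r by (simp add: ennreal_of_nat_eq_real_of_nat ennreal_mult del: times_divide_eq_right)
    finally show ?thesis .
  qed
  have A1: "(\<integral>\<^sup>+z. ennreal (real (\<Sum>j=1..p. fst z j)) \<partial>?Q) = ennreal (real p * ?r)"
    using comp[OF assms(4)] by (simp add: nn_integral_pair_pmf' init)
  have A2: "(\<integral>\<^sup>+z. ennreal (real (arrivals (snd z))) \<partial>?Q) = ennreal (a * t)"
  proof -
    have "(\<integral>\<^sup>+z. ennreal (real (arrivals (snd z))) \<partial>?Q) =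
        (\<integral>\<^sup>+k. ennreal (real k) * ennreal (a / real (Suc n)) \<partial>poisson_pmf ?L)"
      using assms by (simp add: nn_integral_pair_pmf' word_pmf_def nn_integral_arrivals_replicate ennreal_mult'
        del: of_nat_Suc times_divide_eq_right)
    also have "\<dots> = ennreal ?L * ennreal (a / real (Suc n))"
      using assms by (simp add: nn_integral_multc nn_integral_poisson_id)
    finally show ?thesis using assms by (simp flip: ennreal_mult)
  qed
  have A3: "(\<integral>\<^sup>+z. ennreal (real (\<Sum>j=1..n. fold (update n) (snd z) (fst z) j)) \<partial>?Q) = ennreal (real n * ?r)"
  proof -
    have st: "(\<integral>\<^sup>+w. \<integral>\<^sup>+ls. ennreal (real (\<Sum>j=1..n. fold (update n) ls w j)) \<partial>replicate_pmf k (letter_pmf n a) \<partial>?P) =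
        ennreal (real n * ?r)" for k
      using tilted_word[OF assms(3,1,2,1,2), where f = "\<lambda>w. ennreal (real (\<Sum>j=1..n. w j))" and k = k] comp[of n] assms
      by simp
    have "(\<integral>\<^sup>+z. ennreal (real (\<Sum>j=1..n. fold (update n) (snd z) (fst z) j)) \<partial>?Q) =
      (\<integral>\<^sup>+w. \<integral>\<^sup>+k. \<integral>\<^sup>+ls. ennreal (real (\<Sum>j=1..n. fold (update n) ls w j)) \<partial>replicate_pmf k (letter_pmf n a)
         \<partial>poisson_pmf ?L \<partial>?P)"
      by (simp add: nn_integral_pair_pmf' word_pmf_def init)
    also have "\<dots> = (\<integral>\<^sup>+k. ennreal (real n * ?r) \<partial>poisson_pmf ?L)"
      by (subst nn_integral_pmf_swap) (simp only: st)
    finally show ?thesis by simp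
  qed
  \<comment> \<open>The current is signed; its integrability and its mean are obtained from three
    nonnegative counts.\<close>
  define X1 X2 X3 where "X1 = (\<lambda>z :: (nat \<Rightarrow> nat) \<times> letter list. real (\<Sum>j=1..p. fst z j))"
    and "X2 = (\<lambda>z :: (nat \<Rightarrow> nat) \<times> letter list. real (arrivals (snd z)))"
    and "X3 = (\<lambda>z. real (\<Sum>j=1..n. fold (update n) (snd z) (fst z) j))"
  have J: "AE z in ?Q. real_of_int (run (snd z) (profile p (fst z)) n) = X1 z + X2 z - X3 z"
  proof -
    have "real_of_int (run (snd z) (profile p (fst z)) n) = X1 z + X2 z - X3 z" if "z \<in> set_pmf ?Q" for z
    proof -
      have "run (snd z) (profile p (fst z)) n = int (\<Sum>j=1..p. fst z j) + int (arrivals (snd z)) -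
          int (\<Sum>j=1..n. fold (update n) (snd z) (fst z) j)"
        using that assms by (intro run_profile) (auto intro: set_word_pmf)
      then show ?thesis unfolding X1_def X2_def X3_def by simp
    qed
    then show ?thesis by (simp add: AE_measure_pmf_iff)
  qed
  have X: "integrable ?Q X1" "integrable ?Q X2" "integrable ?Q X3"
    using A1 A2 A3 r unfolding X1_def X2_def X3_def by (auto intro!: integrableI_nonneg simp: less_top[symmetric] simp del: of_nat_sum)
  have E: "integral\<^sup>L ?Q X1 = real p * ?r" "integral\<^sup>L ?Q X2 = a * t" "integral\<^sup>L ?Q X3 = real n * ?r"
    using A1 A2 A3 r assms unfolding X1_def X2_def X3_def
    by (auto intro!: integral_eq_nn_integral[THEN trans] simp del: of_nat_sum)
  have cur: "current_pmf n p t a a = map_pmf (\<lambda>z. run (snd z) (profile p (fst z)) n) ?Q"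
    by (simp add: current_pmf_def case_prod_unfold)
  have "integrable ?Q (\<lambda>z. X1 z + X2 z - X3 z)" using X by auto
  then have I: "integrable ?Q (\<lambda>z. real_of_int (run (snd z) (profile p (fst z)) n))"
    using J by (subst integrable_cong_AE[OF _ _ J]) auto
  then show "integrable (current_pmf n p t a a) real_of_int"
    unfolding cur by simp
  have "measure_pmf.expectation (current_pmf n p t a a) real_of_int =
      (\<integral>z. real_of_int (run (snd z) (profile p (fst z)) n) \<partial>?Q)"
    unfolding cur by simp
  also have "\<dots> = (\<integral>z. X1 z + X2 z - X3 z \<partial>?Q)"
    using J by (intro integral_cong_AE) auto
  also have "\<dots> = real p * ?r + a * t - real n * ?r" using X E by simp
  also have "\<dots> = a * t - real (n - p) * ?r"
    using assms(4) by (simp add: of_nat_diff algebra_simps diff_divide_distrib)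
  finally show "measure_pmf.expectation (current_pmf n p t a a) real_of_int = a * t - real (n - p) * ?r" .
qed

subsection \<open>Couplings\<close>

lemma map_replicate_pmf: "map_pmf (map f) (replicate_pmf k P) = replicate_pmf k (map_pmf f P)"
proof (induction k)
  case (Suc k)
  have "map_pmf (map f) (replicate_pmf (Suc k) P) =
      bind_pmf P (\<lambda>x. bind_pmf (map_pmf (map f) (replicate_pmf k P)) (\<lambda>xs. return_pmf (f x # xs)))"
    by (simp add: map_bind_pmf bind_map_pmf)
  then show ?case by (simp add: Suc.IH bind_map_pmf)
qed simp

text \<open>Words over an arbitrary alphabet: several coupled words are read off from one such word
  by letterwise projections.\<close>

definition joint_word_pmf :: "nat \<Rightarrow> real \<Rightarrow> 'a pmf \<Rightarrow> 'a list pmf" where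
  "joint_word_pmf n t Q = bind_pmf (poisson_pmf (real (Suc n) * t)) (\<lambda>k. replicate_pmf k Q)"

lemma map_joint_word_pmf:
  "map_pmf f Q = letter_pmf n a \<Longrightarrow> map_pmf (map f) (joint_word_pmf n t Q) = word_pmf n t a"
  by (simp add: joint_word_pmf_def word_pmf_def map_bind_pmf map_replicate_pmf)

lemma current_pmf_joint:
  assumes "map_pmf u W = initial_pmf n p a b" "map_pmf (map f) V = word_pmf n t a"
  shows "current_pmf n p t a b = map_pmf (\<lambda>(w, ls). run (map f ls) (profile p (u w)) n) (pair_pmf W V)"
  unfolding current_pmf_def assms[symmetric] map_pair[symmetric]
  by (simp add: map_pmf_comp case_prod_unfold)

lemma initial_pmf_joint:
  assumes "f d = 0" "\<And>i. i \<in> {1..n} \<Longrightarrow> map_pmf f (T i) = geo (if i \<le> p then a else b)"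
  shows "map_pmf (\<lambda>w i. f (w i)) (Pi_pmf {1..n} d T) = initial_pmf n p a b"
proof -
  have "initial_pmf n p a b = Pi_pmf {1..n} 0 (\<lambda>i. map_pmf f (T i))"
    unfolding initial_pmf_def by (intro Pi_pmf_cong) (auto simp: assms(2))
  also have "\<dots> = map_pmf (\<lambda>w. f \<circ> w) (Pi_pmf {1..n} d T)"
    by (intro Pi_pmf_map) (auto simp: assms(1))
  finally show ?thesis by (simp add: comp_def)
qed

lemma set_Pi_pmfD:
  assumes "w \<in> set_pmf (Pi_pmf A d T)" "finite A"
  shows "w i \<in> (if i \<in> A then set_pmf (T i) else {d})"
  using assms by (auto simp: set_Pi_pmf PiE_dflt_def)

lemma profile_eqI:
  assumes "i \<le> p \<Longrightarrow> (\<And>j. i < j \<Longrightarrow> j \<le> p \<Longrightarrow> w j = w' j)"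
    and "p \<le> i \<Longrightarrow> (\<And>j. p < j \<Longrightarrow> j \<le> i \<Longrightarrow> w j = w' j)"
  shows "profile p w i = profile p w' i"
proof (cases "i \<le> p")
  case True
  then show ?thesis using assms(1) by (auto simp: profile_def intro!: sum.cong)
next
  case False
  then show ?thesis using assms(2) by (auto simp: profile_def intro!: sum.cong)
qed

section \<open>Comparison of currents at different densities\<close>

abbreviation laplace :: "int pmf \<Rightarrow> real \<Rightarrow> real \<Rightarrow> ennreal" where
  "laplace P s m \<equiv> \<integral>\<^sup>+x. ennreal (exp (- s * (real_of_int x - m))) \<partial>measure_pmf P"

text \<open>The heights are the minimum of a part that only depends on the left of the origin and a part
  that only depends on the right, hence changing the right density in one copy and the left
  density in another one gives two currents whose minimum is a lower bound.\<close>

theorem exp_current_le: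
  assumes "0 < a" "a < 1" "0 < b" "b < 1" "0 < a'" "a' < 1" "0 < b'" "b' < 1" "0 \<le> \<phi>"
  shows "laplace (current_pmf n p t a b) \<phi> m \<le>
    laplace (current_pmf n p t a b') \<phi> m +
    laplace (current_pmf n p t a' b) \<phi> m"
proof -
  \<comment> \<open>The entries are initial states with left and right parameters (a, b'), (a, b)
    and (a', b). The first two agree up to \<open>p\<close>, the last two beyond it, so at each
    index the middle height equals one of the outer ones.\<close>
  define T :: "nat \<Rightarrow> (nat \<times> nat \<times> nat) pmf" where
    "T i = (if i \<le> p then map_pmf (\<lambda>(x, y). (x, x, y)) (pair_pmf (geo a) (geo a'))
      else map_pmf (\<lambda>(x, y). (x, y, y)) (pair_pmf (geo b') (geo b)))" for i
  define W where "W = Pi_pmf {1..n} (0, 0, 0) T"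
  \<comment> \<open>Two marks per letter, since the copy with left parameter a' has a reservoir of
    rate a'; \<open>run_ge_min\<close> compares words with equal sites and arbitrary marks.\<close>
  define Q where "Q = pair_pmf (pmf_of_set {0..n}) (pair_pmf (bernoulli_pmf a) (bernoulli_pmf a'))"
  let ?f1 = "\<lambda>(i::nat, c::bool, d::bool). (i, c)" and ?f2 = "\<lambda>(i::nat, c::bool, d::bool). (i, d)"
  define V where "V = joint_word_pmf n t Q"
  have W1: "map_pmf (\<lambda>w i. fst (w i)) W = initial_pmf n p a b'"
    unfolding W_def by (intro initial_pmf_joint)
      (auto simp: T_def map_pmf_comp case_prod_unfold map_fst_pair_pmf map_snd_pair_pmf)
  have W0: "map_pmf (\<lambda>w i. fst (snd (w i))) W = initial_pmf n p a b"
    unfolding W_def by (intro initial_pmf_joint)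
      (auto simp: T_def map_pmf_comp case_prod_unfold map_fst_pair_pmf map_snd_pair_pmf)
  have W2: "map_pmf (\<lambda>w i. snd (snd (w i))) W = initial_pmf n p a' b"
    unfolding W_def by (intro initial_pmf_joint)
      (auto simp: T_def map_pmf_comp case_prod_unfold map_fst_pair_pmf map_snd_pair_pmf)
  have Q1: "map_pmf ?f1 Q = letter_pmf n a"
    using map_pair[of id fst "pmf_of_set {0..n}" "pair_pmf (bernoulli_pmf a) (bernoulli_pmf a')"]
    by (simp add: Q_def letter_pmf_def map_fst_pair_pmf case_prod_unfold)
  have Q2: "map_pmf ?f2 Q = letter_pmf n a'"
    using map_pair[of id snd "pmf_of_set {0..n}" "pair_pmf (bernoulli_pmf a) (bernoulli_pmf a')"]
    by (simp add: Q_def letter_pmf_def map_snd_pair_pmf case_prod_unfold)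
  note V1 = map_joint_word_pmf[OF Q1, of t, folded V_def] and V2 = map_joint_word_pmf[OF Q2, of t, folded V_def]
  define J0 J1 J2 where
    "J0 = (\<lambda>(w, ls). run (map ?f1 ls) (profile p (\<lambda>i. fst (snd (w i :: nat \<times> nat \<times> nat)))) n)" and
    "J1 = (\<lambda>(w, ls). run (map ?f1 ls) (profile p (\<lambda>i. fst (w i :: nat \<times> nat \<times> nat))) n)" and
    "J2 = (\<lambda>(w, ls). run (map ?f2 ls) (profile p (\<lambda>i. snd (snd (w i :: nat \<times> nat \<times> nat)))) n)"
  have cur: "current_pmf n p t a b = map_pmf J0 (pair_pmf W V)"
    "current_pmf n p t a b' = map_pmf J1 (pair_pmf W V)"
    "current_pmf n p t a' b = map_pmf J2 (pair_pmf W V)"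
    unfolding J0_def J1_def J2_def
    by (rule current_pmf_joint[OF W0 V1] current_pmf_joint[OF W1 V1] current_pmf_joint[OF W2 V2])+
  have min: "min (J1 z) (J2 z) \<le> J0 z" if z: "z \<in> set_pmf (pair_pmf W V)" for z
  proof -
    obtain w ls where zw: "z = (w, ls)" by (cases z)
    have w: "w \<in> set_pmf W" using z zw by simp
    have L: "fst (snd (w j)) = fst (w j)" if "j \<le> p" for j
      using set_Pi_pmfD[OF w[unfolded W_def], of j] that by (auto simp: T_def split: if_splits)
    have R: "fst (snd (w j)) = snd (snd (w j))" if "p < j" for j
      using set_Pi_pmfD[OF w[unfolded W_def], of j] that by (auto simp: T_def split: if_splits)
    have "min (run (map ?f1 ls) (profile p (\<lambda>i. fst (w i))) n) (run (map ?f2 ls) (profile p (\<lambda>i. snd (snd (w i)))) n)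
        \<le> run (map ?f1 ls) (profile p (\<lambda>i. fst (snd (w i)))) n"
    proof (rule run_ge_min)
      show "min (profile p (\<lambda>i. fst (w i)) i) (profile p (\<lambda>i. snd (snd (w i))) i)
          \<le> profile p (\<lambda>i. fst (snd (w i))) i" for i
      proof (cases "i \<le> p")
        case True
        have "profile p (\<lambda>i. fst (snd (w i))) i = profile p (\<lambda>i. fst (w i)) i"
          using True by (intro profile_eqI) (auto simp: L)
        then show ?thesis by simp
      next
        case False
        have "profile p (\<lambda>i. fst (snd (w i))) i = profile p (\<lambda>i. snd (snd (w i))) i"
          using False by (intro profile_eqI) (auto simp: R)
        then show ?thesis by simp
      qed
      show "profile p (\<lambda>i. fst (w i)) 0 \<le> profile p (\<lambda>i. fst (snd (w i))) 0"
        by (intro eq_refl profile_eqI) (auto simp: L)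
    qed (auto simp: case_prod_unfold)
    then show ?thesis by (simp add: zw J0_def J1_def J2_def)
  qed
    have "(\<integral>\<^sup>+z. ennreal (exp (- \<phi> * (real_of_int (J0 z) - m))) \<partial>pair_pmf W V) \<le>
        (\<integral>\<^sup>+z. ennreal (exp (- \<phi> * (real_of_int (J1 z) - m))) + ennreal (exp (- \<phi> * (real_of_int (J2 z) - m))) \<partial>pair_pmf W V)"
    proof (intro nn_integral_mono_AE AE_pmfI)
      fix z assume "z \<in> set_pmf (pair_pmf W V)"
      then have "J1 z \<le> J0 z \<or> J2 z \<le> J0 z" using min[of z] by auto
      then have "exp (- \<phi> * (real_of_int (J0 z) - m)) \<le> exp (- \<phi> * (real_of_int (J1 z) - m)) + exp (- \<phi> * (real_of_int (J2 z) - m))"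
      proof
        assume "J1 z \<le> J0 z"
        then have "exp (- \<phi> * (real_of_int (J0 z) - m)) \<le> exp (- \<phi> * (real_of_int (J1 z) - m))"
          using assms(9) by (simp add: mult_left_mono)
        then show ?thesis by (smt (verit) exp_gt_zero)
      next
        assume "J2 z \<le> J0 z"
        then have "exp (- \<phi> * (real_of_int (J0 z) - m)) \<le> exp (- \<phi> * (real_of_int (J2 z) - m))"
          using assms(9) by (simp add: mult_left_mono)
        then show ?thesis by (smt (verit) exp_gt_zero)
      qed
      then show "ennreal (exp (- \<phi> * (real_of_int (J0 z) - m))) \<le>
          ennreal (exp (- \<phi> * (real_of_int (J1 z) - m))) + ennreal (exp (- \<phi> * (real_of_int (J2 z) - m)))"
        by (subst ennreal_plus[symmetric]) (auto intro!: ennreal_leI simp del: ennreal_plus)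
    qed
    then show ?thesis unfolding cur nn_integral_map_pmf by (simp add: nn_integral_add)
qed

text \<open>More particles to the right of the origin lower the initial heights there, hence the
  current, and so raise an exponential of negative sign.\<close>

theorem exp_current_antimono:
  assumes "0 < b'" "b' \<le> b" "b < 1" "0 \<le> \<phi>"
  shows "laplace (current_pmf n p t a b') \<phi> m \<le>
    laplace (current_pmf n p t a b) \<phi> m"
proof -
  note K = geo_coupling[OF assms(1-3)]
  define T where "T i = (if i \<le> p then map_pmf (\<lambda>x. (x, x)) (geo a) else geo_coupling b' b)" for i :: nat
  define W where "W = Pi_pmf {1..n} (0, 0) T"
  define V where "V = word_pmf n t a"
  have V: "map_pmf (map (\<lambda>l. l)) V = word_pmf n t a" by (simp add: V_def)
  have W1: "map_pmf (\<lambda>w i. fst (w i)) W = initial_pmf n p a b'"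
    and W2: "map_pmf (\<lambda>w i. snd (w i)) W = initial_pmf n p a b"
    unfolding W_def by (intro initial_pmf_joint; auto simp: T_def map_pmf_comp K)+
  have le: "run (map (\<lambda>l. l) ls) (profile p (\<lambda>i. snd (w i))) n \<le> run (map (\<lambda>l. l) ls) (profile p (\<lambda>i. fst (w i))) n"
    if w: "w \<in> set_pmf W" for w ls
  proof -
    have L: "fst (w j) = snd (w j)" if "j \<le> p" for j
      using set_Pi_pmfD[OF w[unfolded W_def], of j] that by (auto simp: T_def split: if_splits)
    have R: "fst (w j) \<le> snd (w j)" for j
      using set_Pi_pmfD[OF w[unfolded W_def], of j] K(3) by (auto simp: T_def AE_measure_pmf_iff split: if_splits)
    have "profile p (\<lambda>i. snd (w i)) i \<le> profile p (\<lambda>i. fst (w i)) i" for i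
    proof (cases "i \<le> p")
      case True
      then show ?thesis by (intro eq_refl profile_eqI) (auto simp: L)
    next
      case False
      then show ?thesis using sum_mono[of "{p<..i}" "\<lambda>j. fst (w j)" "\<lambda>j. snd (w j)"] R
        by (simp add: profile_def del: of_nat_sum)
    qed
    then have "run (map (\<lambda>l. l) ls) (profile p (\<lambda>i. snd (w i))) \<le> run (map (\<lambda>l. l) ls) (profile p (\<lambda>i. fst (w i)))"
      by (intro run_mono list.rel_refl) (auto simp: le_fun_def)
    then show ?thesis by (rule le_funD)
  qed
  show ?thesis
    unfolding current_pmf_joint[OF W1 V] current_pmf_joint[OF W2 V] nn_integral_map_pmf
  proof (intro nn_integral_mono_AE AE_pmfI)
    fix z assume "z \<in> set_pmf (pair_pmf W V)"
    then have "fst z \<in> set_pmf W" by auto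
    then show "ennreal (exp (- \<phi> * (real_of_int (case z of (w, ls) \<Rightarrow> run (map (\<lambda>l. l) ls) (profile p (\<lambda>i. fst (w i))) n) - m)))
      \<le> ennreal (exp (- \<phi> * (real_of_int (case z of (w, ls) \<Rightarrow> run (map (\<lambda>l. l) ls) (profile p (\<lambda>i. snd (w i))) n) - m)))"
      using le[of "fst z" "snd z"] assms(4) by (auto simp: case_prod_unfold intro!: ennreal_leI mult_left_mono)
  qed
qed

text \<open>Heights are linear in the occupation numbers, so the configuration
  \<open>w1 + w2 - w\<close> gives equality at time 0 and \<open>run_submodular\<close> applies to
  it. The configuration \<open>w12\<close> has at least as many particles, which only lowers the
  heights.\<close>

lemma run_profile_superadditive:
  assumes "\<And>j. w j \<le> w1 j" "\<And>j. w j \<le> w2 j" "\<And>j. w1 j + w2 j \<le> w j + w12 j"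
    and "\<And>j. j \<le> p \<Longrightarrow> w1 j = w j" "\<And>j. j \<le> p \<Longrightarrow> w2 j = w j" "\<And>j. j \<le> p \<Longrightarrow> w12 j = w j"
  shows "run ls (profile p w) i + run ls (profile p w12) i \<le> run ls (profile p w1) i + run ls (profile p w2) i"
proof -
  define w3 where "w3 j = w1 j + w2 j - w j" for j
  have w3: "int (w3 j) = int (w1 j) + int (w2 j) - int (w j)" for j
    using assms(1)[of j] by (simp add: w3_def of_nat_diff)
  have 0: "profile p w 0 = profile p w1 0" "profile p w 0 = profile p w2 0" "profile p w 0 = profile p w3 0"
    using assms(4,5) by (auto intro!: profile_eqI simp: w3_def)
  have eq: "profile p w j + profile p w3 j = profile p w1 j + profile p w2 j" for j
    by (induction j) (use 0 in \<open>auto simp: profile_Suc w3\<close>)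
  have "run ls (profile p w) i + run ls (profile p w3) i \<le> run ls (profile p w1) i + run ls (profile p w2) i"
    using assms(1,2) eq 0 by (intro run_submodular) (auto simp: profile_Suc w3)
  moreover have "profile p w12 j \<le> profile p w3 j" for j
  proof (cases "j \<le> p")
    case True
    have "profile p w12 j = profile p w3 j"
      using True assms(4-6) by (intro profile_eqI) (auto simp: w3_def)
    then show ?thesis by simp
  next
    case False
    have "(\<Sum>k\<in>{p<..j}. w3 k) \<le> (\<Sum>k\<in>{p<..j}. w12 k)"
      using assms(3) by (intro sum_mono) (simp add: w3_def le_diff_conv add.commute)
    with False show ?thesis by (simp add: profile_def del: of_nat_sum)
  qed
  then have "run ls (profile p w12) \<le> run ls (profile p w3)"
    by (intro run_mono list.rel_refl) (auto simp: le_fun_def)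
  ultimately show ?thesis using le_funD[of "run ls (profile p w12)" "run ls (profile p w3)" i] by simp
qed

lemma bernoulli_and:
  assumes "0 \<le> q" "q \<le> 1"
  shows "map_pmf (\<lambda>z. fst z \<and> snd z) (pair_pmf (bernoulli_pmf q) (bernoulli_pmf (1/2))) = bernoulli_pmf (q / 2)"
    and "map_pmf (\<lambda>z. fst z \<and> \<not> snd z) (pair_pmf (bernoulli_pmf q) (bernoulli_pmf (1/2))) = bernoulli_pmf (q / 2)"
proof -
  show "map_pmf (\<lambda>z. fst z \<and> snd z) (pair_pmf (bernoulli_pmf q) (bernoulli_pmf (1/2))) = bernoulli_pmf (q / 2)"
  proof (rule pmf_eqI)
    fix c
    show "pmf (map_pmf (\<lambda>z. fst z \<and> snd z) (pair_pmf (bernoulli_pmf q) (bernoulli_pmf (1/2)))) c = pmf (bernoulli_pmf (q / 2)) c"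
      using assms by (cases c) (simp_all add: pair_pmf_def map_pmf_def bind_assoc_pmf bind_return_pmf pmf_bind measure_pmf_single)
  qed
  show "map_pmf (\<lambda>z. fst z \<and> \<not> snd z) (pair_pmf (bernoulli_pmf q) (bernoulli_pmf (1/2))) = bernoulli_pmf (q / 2)"
  proof (rule pmf_eqI)
    fix c
    show "pmf (map_pmf (\<lambda>z. fst z \<and> \<not> snd z) (pair_pmf (bernoulli_pmf q) (bernoulli_pmf (1/2)))) c = pmf (bernoulli_pmf (q / 2)) c"
      using assms by (cases c) (simp_all add: pair_pmf_def map_pmf_def bind_assoc_pmf bind_return_pmf pmf_bind measure_pmf_single)
  qed
qed

text \<open>The particles that raise the density from \<open>a\<close> to \<open>b\<close> are split at random into two
  halves, either of which suffices to raise it to \<open>b'\<close>.\<close>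

theorem current_superadditive:
  assumes "0 < a" "a \<le> b'" "b' \<le> b" "b < 1" "thinning a b' = thinning a b / 2"
    and int: "integrable (current_pmf n p t a a) real_of_int" "integrable (current_pmf n p t a b) real_of_int"
      "integrable (current_pmf n p t a b') real_of_int"
  shows "measure_pmf.expectation (current_pmf n p t a a) real_of_int +
    measure_pmf.expectation (current_pmf n p t a b) real_of_int \<le>
    2 * measure_pmf.expectation (current_pmf n p t a b') real_of_int"
proof -
  let ?q = "thinning a b"
  have q: "0 \<le> ?q" "?q \<le> 1" using thinning_bounds[of a b] assms by auto
  define K where "K = geo_coupling b' b"
  have K: "map_pmf fst K = geo b'" "map_pmf snd K = geo b" "\<And>z. z \<in> set_pmf K \<Longrightarrow> fst z \<le> snd z"
    using geo_coupling[of b' b] assms unfolding K_def by (auto simp: AE_measure_pmf_iff)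
  define S where "S = pair_pmf (geo a) (pair_pmf (pair_pmf (bernoulli_pmf ?q) (bernoulli_pmf (1/2))) K)"
  \<comment> \<open>A fair coin decides which half a batch of extra particles joins, so at most one
    of \<open>s1\<close>, \<open>s2\<close> exceeds \<open>s0\<close>. A batch has law
    \<open>geo b\<close> when the target is \<open>b\<close> but \<open>geo b'\<close> when it is
    b'; the monotone coupling \<open>K\<close> makes the latter the smaller one, whence s1 + s2
    \<le> s0 + s12.\<close>
  define s0 s1 s2 s12 :: "nat \<times> (bool \<times> bool) \<times> (nat \<times> nat) \<Rightarrow> nat"
    where "s0 = fst"
    and "s1 = (\<lambda>(x, c, g). x + (if fst c \<and> snd c then fst g else 0))"
    and "s2 = (\<lambda>(x, c, g). x + (if fst c \<and> \<not> snd c then fst g else 0))"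
    and "s12 = (\<lambda>(x, c, g). x + (if fst c then snd g else 0))"
  have S0: "map_pmf s0 S = geo a" by (simp add: S_def s0_def map_fst_pair_pmf)
  have gen: "map_pmf (\<lambda>(x, c, g). x + (if \<beta> c then \<gamma> g else 0)) S = geo b''"
    if "map_pmf \<beta> (pair_pmf (bernoulli_pmf ?q) (bernoulli_pmf (1/2))) = bernoulli_pmf (thinning a b'')"
      "map_pmf \<gamma> K = geo b''" "a \<le> b''" "b'' < 1" for \<beta> \<gamma> b''
  proof -
    have "map_pmf (\<lambda>(x, c, g). x + (if c then g else 0))
        (map_pmf (\<lambda>(x, y). (id x, (\<lambda>(c, g). (\<beta> c, \<gamma> g)) y)) S) = geo b''"
      unfolding S_def map_pair that(1,2) using geo_split[OF assms(1) that(3,4)] by simp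
    then show ?thesis by (simp add: map_pmf_comp case_prod_unfold cong: if_cong)
  qed
  have S1: "map_pmf s1 S = geo b'"
    unfolding s1_def by (rule gen) (use assms(2-4) K(1) bernoulli_and[OF q] in \<open>simp_all add: assms(5)\<close>)
  have S2: "map_pmf s2 S = geo b'"
    unfolding s2_def by (rule gen) (use assms(2-4) K(1) bernoulli_and[OF q] in \<open>simp_all add: assms(5)\<close>)
  have S12: "map_pmf s12 S = geo b"
    unfolding s12_def using assms K by (intro gen) (simp_all add: map_fst_pair_pmf)
  define T where "T i = (if i \<le> p then map_pmf (\<lambda>x. (x, x, x, x)) (geo a)
      else map_pmf (\<lambda>z. (s0 z, s1 z, s2 z, s12 z)) S)" for i :: nat
  define W where "W = Pi_pmf {1..n} (0, 0, 0, 0) T"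
  define V where "V = word_pmf n t a"
  have V: "map_pmf (map (\<lambda>l. l)) V = word_pmf n t a" by (simp add: V_def)
  have W0: "map_pmf (\<lambda>w i. fst (w i)) W = initial_pmf n p a a"
    and W1: "map_pmf (\<lambda>w i. fst (snd (w i))) W = initial_pmf n p a b'"
    and W2: "map_pmf (\<lambda>w i. fst (snd (snd (w i)))) W = initial_pmf n p a b'"
    and W12: "map_pmf (\<lambda>w i. snd (snd (snd (w i)))) W = initial_pmf n p a b"
    unfolding W_def by (intro initial_pmf_joint; auto simp: T_def map_pmf_comp S0 S1 S2 S12)+
  define J0 J1 J2 J12 where
    "J0 = (\<lambda>(w, ls). run (map (\<lambda>l. l) ls) (profile p (\<lambda>i. fst (w i :: nat \<times> nat \<times> nat \<times> nat))) n)" and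
    "J1 = (\<lambda>(w, ls). run (map (\<lambda>l. l) ls) (profile p (\<lambda>i. fst (snd (w i :: nat \<times> nat \<times> nat \<times> nat)))) n)" and
    "J2 = (\<lambda>(w, ls). run (map (\<lambda>l. l) ls) (profile p (\<lambda>i. fst (snd (snd (w i :: nat \<times> nat \<times> nat \<times> nat))))) n)" and
    "J12 = (\<lambda>(w, ls). run (map (\<lambda>l. l) ls) (profile p (\<lambda>i. snd (snd (snd (w i :: nat \<times> nat \<times> nat \<times> nat))))) n)"
  have cur: "current_pmf n p t a a = map_pmf J0 (pair_pmf W V)"
    "current_pmf n p t a b' = map_pmf J1 (pair_pmf W V)"
    "current_pmf n p t a b' = map_pmf J2 (pair_pmf W V)"
    "current_pmf n p t a b = map_pmf J12 (pair_pmf W V)"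
    unfolding J0_def J1_def J2_def J12_def
    by (rule current_pmf_joint[OF W0 V] current_pmf_joint[OF W1 V] current_pmf_joint[OF W2 V] current_pmf_joint[OF W12 V])+
  have le: "J0 z + J12 z \<le> J1 z + J2 z" if z: "z \<in> set_pmf (pair_pmf W V)" for z
  proof -
    obtain w ls where zw: "z = (w, ls)" by (cases z)
    have w: "w \<in> set_pmf W" using z zw by simp
    have site: "fst (w j) \<le> fst (snd (w j)) \<and> fst (w j) \<le> fst (snd (snd (w j))) \<and>
        fst (snd (w j)) + fst (snd (snd (w j))) \<le> fst (w j) + snd (snd (snd (w j))) \<and>
        (j \<le> p \<longrightarrow> fst (snd (w j)) = fst (w j) \<and> fst (snd (snd (w j))) = fst (w j) \<and>
          snd (snd (snd (w j))) = fst (w j))" for j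
    proof (cases "j \<in> {1..n} \<and> p < j")
      case True
      then have "w j \<in> (\<lambda>z. (s0 z, s1 z, s2 z, s12 z)) ` set_pmf S"
        using set_Pi_pmfD[OF w[unfolded W_def], of j] by (auto simp: T_def)
      then obtain x c g where "w j = (s0 (x, c, g), s1 (x, c, g), s2 (x, c, g), s12 (x, c, g))" "g \<in> set_pmf K"
        by (auto simp: S_def)
      then show ?thesis using True K(3)[of g] by (auto simp: s0_def s1_def s2_def s12_def)
    next
      case False
      then show ?thesis using set_Pi_pmfD[OF w[unfolded W_def], of j] by (auto simp: T_def split: if_splits)
    qed
    show ?thesis unfolding zw J0_def J1_def J2_def J12_def prod.case
      by (rule run_profile_superadditive) (use site in blast)+
  qed
  have i: "integrable (pair_pmf W V) (\<lambda>z. real_of_int (J0 z))" "integrable (pair_pmf W V) (\<lambda>z. real_of_int (J12 z))"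
    "integrable (pair_pmf W V) (\<lambda>z. real_of_int (J1 z))" "integrable (pair_pmf W V) (\<lambda>z. real_of_int (J2 z))"
    using int(1) int(2) int(3)[unfolded cur(2)] int(3)[unfolded cur(3)] unfolding cur(1,4) by simp_all
  have "(\<integral>z. real_of_int (J0 z) + real_of_int (J12 z) \<partial>pair_pmf W V) \<le>
      (\<integral>z. real_of_int (J1 z) + real_of_int (J2 z) \<partial>pair_pmf W V)"
    using i by (intro integral_mono_AE Bochner_Integration.integrable_add AE_pmfI)
      (auto simp del: set_pair_pmf simp flip: of_int_add intro: le)
  moreover have "measure_pmf.expectation (current_pmf n p t a b') real_of_int = (\<integral>z. real_of_int (J1 z) \<partial>pair_pmf W V)"
    unfolding cur(2) by simp
  moreover have "measure_pmf.expectation (current_pmf n p t a b') real_of_int = (\<integral>z. real_of_int (J2 z) \<partial>pair_pmf W V)"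
    unfolding cur(3) by simp
  ultimately show ?thesis unfolding cur(1,4) using i by simp
qed

text \<open>A site receives no extra particles with probability \<open>1 - thinning a b\<close>, and
  if this holds at all \<open>n - p\<close> sites the two systems coincide. The factor tends to 1 as
  \<open>b\<close> decreases to \<open>a\<close>, so second moments for \<open>b\<close> close to
  \<open>a\<close> transfer to the stationary current.\<close>

lemma current_pmf_dominates:
  fixes F :: "int \<Rightarrow> ennreal"
  assumes "0 < a" "a \<le> b" "b < 1" "p \<le> n"
  shows "ennreal ((1 - thinning a b) ^ (n - p)) * (\<integral>\<^sup>+x. F x \<partial>current_pmf n p t a a) \<le>
    (\<integral>\<^sup>+x. F x \<partial>current_pmf n p t a b)"
proof -
  let ?q = "1 - thinning a b"
  have q: "0 \<le> ?q" using thinning_bounds[OF assms(1-3)] by auto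
  have geo: "?q * pmf (geo a) k \<le> pmf (geo b) k" for k
  proof -
    have "?q * pmf (geo a) k = (1 - b) * (a ^ Suc k / b)"
      using assms by (simp add: thinning_def field_simps)
    also have "a ^ Suc k / b \<le> b ^ Suc k / b"
      using assms by (intro divide_right_mono power_mono) auto
    finally show ?thesis using assms by (simp add: mult.commute)
  qed
  have init: "?q ^ (n - p) * pmf (initial_pmf n p a a) w \<le> pmf (initial_pmf n p a b) w" for w
  proof -
    have "?q ^ (n - p) = (\<Prod>j\<in>{p<..n}. ?q)" by simp
    also have "\<dots> = (\<Prod>j\<in>{1..n}. if j \<le> p then 1 else ?q)"
      by (intro prod.mono_neutral_cong_left) auto
    finally have e: "?q ^ (n - p) = (\<Prod>j\<in>{1..n}. if j \<le> p then 1 else ?q)" .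
    have "(\<Prod>j\<in>{1..n}. (if j \<le> p then 1 else ?q) * pmf (geo a) (w j)) \<le>
        (\<Prod>j\<in>{1..n}. pmf (geo (if j \<le> p then a else b)) (w j))"
      using q geo by (intro prod_mono) (auto simp del: pmf_geo)
    then show ?thesis unfolding e initial_pmf_def pmf_Pi[OF finite_atLeastAtMost]
      by (auto simp: prod.distrib simp del: pmf_geo)
  qed
  define H where "H w = (\<integral>\<^sup>+ls. F (run ls (profile p w) n) \<partial>word_pmf n t a)" for w
  have cur: "(\<integral>\<^sup>+x. F x \<partial>current_pmf n p t a b) = (\<integral>\<^sup>+w. H w \<partial>initial_pmf n p a b)" for b
    by (simp add: current_pmf_def nn_integral_pair_pmf' H_def)
  have "ennreal (?q ^ (n - p)) * (\<integral>\<^sup>+w. H w \<partial>initial_pmf n p a a) =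
      (\<integral>\<^sup>+w. ennreal (?q ^ (n - p) * pmf (initial_pmf n p a a) w) * H w \<partial>count_space UNIV)"
    using q by (simp add: nn_integral_measure_pmf nn_integral_cmult[symmetric] ennreal_mult mult.assoc)
  also have "\<dots> \<le> (\<integral>\<^sup>+w. ennreal (pmf (initial_pmf n p a b) w) * H w \<partial>count_space UNIV)"
    using init by (intro nn_integral_mono mult_right_mono ennreal_leI) auto
  also have "\<dots> = (\<integral>\<^sup>+w. H w \<partial>initial_pmf n p a b)" by (simp add: nn_integral_measure_pmf)
  finally show ?thesis unfolding cur .
qed

subsection \<open>The cumulant generating function on the characteristic\<close>

text \<open>For a = \<rho> / (1 + \<rho>) the factor \<open>(1 - a)\<^sup>2\<close> is the
  characteristic speed.\<close>

definition sites :: "real \<Rightarrow> real \<Rightarrow> nat" where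
  "sites a t = nat \<lfloor>(1 - a)\<^sup>2 * t\<rfloor>"

definition drift :: "real \<Rightarrow> real \<Rightarrow> real" where
  "drift a t = a * t - real (sites a t) * (a / (1 - a))"

text \<open>The logarithm of the right-hand side of \<open>mgf_current\<close> for the parameters a
  and a exp \<theta> with \<open>n - p = sites a t\<close>, centered by \<theta> times the
  stationary mean.\<close>

definition log_mgf :: "real \<Rightarrow> real \<Rightarrow> real \<Rightarrow> real" where
  "log_mgf a t \<theta> = (a * exp \<theta> - a) * t + real (sites a t) * (ln (1 - a * exp \<theta>) - ln (1 - a))
     - \<theta> * drift a t"

lemma exp_minus_one_bounds:
  fixes x :: real
  assumes "\<bar>x\<bar> \<le> 1"
  shows "\<bar>exp x - 1\<bar> \<le> 2 * \<bar>x\<bar>" "\<bar>x\<bar> / 2 \<le> \<bar>exp x - 1\<bar>"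
proof -
  have 1: "\<bar>exp x - 1\<bar> \<le> 2 * \<bar>x\<bar> \<and> \<bar>x\<bar> / 2 \<le> \<bar>exp x - 1\<bar>"
  proof (cases "0 \<le> x")
    case True
    have "exp x \<le> 1 + x + x\<^sup>2" using True assms by (intro exp_bound) auto
    moreover have "x\<^sup>2 \<le> x" using True assms by (simp add: power2_eq_square mult_left_le_one_le)
    moreover have "1 + x \<le> exp x" by (rule exp_ge_add_one_self)
    ultimately show ?thesis using True by linarith
  next
    case False
    define y where "y = - x"
    have y: "0 < y" "y \<le> 1" using False assms by (auto simp: y_def)
    have "1 + y \<le> exp y" by (rule exp_ge_add_one_self)
    then have "exp (- y) \<le> 1 / (1 + y)" using y by (simp add: exp_minus field_simps)
    also have "\<dots> \<le> 1 - y / 2" using y by (simp add: field_simps mult_left_le_one_le)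
    finally have "exp x \<le> 1 - y / 2" by (simp add: y_def)
    moreover have "1 + x \<le> exp x" by (rule exp_ge_add_one_self)
    ultimately show ?thesis using y unfolding y_def by linarith
  qed
  show "\<bar>exp x - 1\<bar> \<le> 2 * \<bar>x\<bar>" "\<bar>x\<bar> / 2 \<le> \<bar>exp x - 1\<bar>" using 1 by auto
qed

text \<open>On the characteristic the first two derivatives of the cumulant generating function at 0
  vanish up to the rounding of the site; this is the source of the exponent \<open>1/3\<close>.\<close>

lemma log_mgf_bounds:
  assumes a: "0 < a" "a < 1"
  obtains \<delta> C c :: real where "0 < \<delta>" "0 < C" "0 < c"
    and "\<And>\<theta>. \<bar>\<theta>\<bar> \<le> \<delta> \<Longrightarrow> a * exp \<theta> < 1"
    and "\<And>t \<theta>. 0 \<le> t \<Longrightarrow> \<bar>\<theta>\<bar> \<le> \<delta> \<Longrightarrow> \<bar>log_mgf a t \<theta>\<bar> \<le> C * (t * \<bar>\<theta>\<bar> ^ 3 + \<theta>\<^sup>2)"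
    and "\<And>t \<theta>. 0 \<le> t \<Longrightarrow> 0 \<le> \<theta> \<Longrightarrow> \<theta> \<le> \<delta> \<Longrightarrow> log_mgf a t \<theta> \<le> C * \<theta>\<^sup>2"
    and "\<And>t \<theta>. 0 \<le> t \<Longrightarrow> - \<delta> \<le> \<theta> \<Longrightarrow> \<theta> \<le> 0 \<Longrightarrow> c * (t * \<bar>\<theta>\<bar> ^ 3) \<le> log_mgf a t \<theta>"
proof -
  \<comment> \<open>\<open>\<delta>\<close> keeps a exp \<theta> at or below the midpoint (1 + a) /
    2 between a and 1. \<open>K\<close> is the growth rate per unit time if the site is not rounded,
    and \<open>M\<close> is the coefficient of the rounding error.\<close>
  define \<delta> where "\<delta> = min 1 (ln ((1 + a) / (2 * a)))"
  define K where "K \<theta> = a * (exp \<theta> - 1 - \<theta>) + (1 - a)\<^sup>2 * (ln (1 - a * exp \<theta>) - ln (1 - a) + \<theta> * (a / (1 - a)))" for \<theta>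
  define M where "M \<theta> = ln (1 - a * exp \<theta>) - ln (1 - a) + \<theta> * (a / (1 - a))" for \<theta>
  \<comment> \<open>The summands of \<open>C\<close> come from the bounds on the derivatives of
    \<open>K\<close> and \<open>M\<close>; 3 c \<theta>^2 is the lower bound on minus the derivative
    of \<open>K\<close>.\<close>
  define C where "C = 8 * a\<^sup>2 / (1 - a) + 4 * a / (1 - a)\<^sup>2"
  define c where "c = a\<^sup>2 / 12"
  have \<delta>: "0 < \<delta>" "\<delta> \<le> 1" using a by (auto simp: \<delta>_def field_simps)
  have C: "0 < C" "8 * a\<^sup>2 / (1 - a) \<le> C" "4 * a / (1 - a)\<^sup>2 \<le> C" using a by (auto simp: C_def add_pos_pos)
  have c: "0 < c" using a by (simp add: c_def)
  have b: "a * exp \<theta> \<le> (1 + a) / 2" if "\<bar>\<theta>\<bar> \<le> \<delta>" for \<theta>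
  proof -
    have "\<theta> \<le> ln ((1 + a) / (2 * a))" using that by (auto simp: \<delta>_def)
    then have "exp \<theta> \<le> (1 + a) / (2 * a)" using a by (subst (asm) ln_ge_iff) auto
    then show ?thesis using a by (simp add: field_simps)
  qed
  have b1: "a * exp \<theta> < 1" if "\<bar>\<theta>\<bar> \<le> \<delta>" for \<theta> using b[OF that] a by (simp add: field_simps)
  have b2: "1 / (1 - a * exp \<theta>) \<le> 2 / (1 - a)" "1 \<le> 1 / (1 - a * exp \<theta>)" if "\<bar>\<theta>\<bar> \<le> \<delta>" for \<theta>
  proof -
    show "1 / (1 - a * exp \<theta>) \<le> 2 / (1 - a)" using b[OF that] b1[OF that] a by (simp add: field_simps)
    show "1 \<le> 1 / (1 - a * exp \<theta>)" using b1[OF that] a by simp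
  qed
  have dM: "(M has_real_derivative - (a * exp \<theta> - a) / ((1 - a) * (1 - a * exp \<theta>))) (at \<theta>)" if "\<bar>\<theta>\<bar> \<le> \<delta>" for \<theta>
    unfolding M_def using b1[OF that] a
    by (auto intro!: derivative_eq_intros simp: divide_simps) (simp add: algebra_simps)
  \<comment> \<open>Here the characteristic speed enters: with b = a exp \<theta>, the factor
    \<open>(1 - a)\<^sup>2\<close> cancels the term linear in b - a and leaves a square.\<close>
  have dK: "(K has_real_derivative - (a * exp \<theta> - a)\<^sup>2 / (1 - a * exp \<theta>)) (at \<theta>)" if "\<bar>\<theta>\<bar> \<le> \<delta>" for \<theta>
  proof -
    have "((\<lambda>\<theta>. a * (exp \<theta> - 1 - \<theta>) + (1 - a)\<^sup>2 * M \<theta>) has_real_derivative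
        a * (exp \<theta> - 1) + (1 - a)\<^sup>2 * (- (a * exp \<theta> - a) / ((1 - a) * (1 - a * exp \<theta>)))) (at \<theta>)"
      by (auto intro!: derivative_eq_intros dM[OF that])
    moreover have "a * (exp \<theta> - 1) + (1 - a)\<^sup>2 * (- (a * exp \<theta> - a) / ((1 - a) * (1 - a * exp \<theta>))) =
        - (a * exp \<theta> - a)\<^sup>2 / (1 - a * exp \<theta>)"
      using b1[OF that] a by (simp add: divide_simps power2_eq_square) (simp add: algebra_simps)
    moreover have "K = (\<lambda>\<theta>. a * (exp \<theta> - 1 - \<theta>) + (1 - a)\<^sup>2 * M \<theta>)"
      by (simp add: K_def M_def fun_eq_iff)
    ultimately show ?thesis by simp
  qed
  have e: "\<bar>a * exp \<theta> - a\<bar> \<le> 2 * a * \<bar>\<theta>\<bar>" "a * \<bar>\<theta>\<bar> / 2 \<le> \<bar>a * exp \<theta> - a\<bar>" if "\<bar>\<theta>\<bar> \<le> \<delta>" for \<theta>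
  proof -
    have eq: "\<bar>a * exp \<theta> - a\<bar> = a * \<bar>exp \<theta> - 1\<bar>" using a abs_mult[of a "exp \<theta> - 1"] by (simp add: right_diff_distrib)
    have \<theta>: "\<bar>\<theta>\<bar> \<le> 1" using that \<delta> by simp
    show "\<bar>a * exp \<theta> - a\<bar> \<le> 2 * a * \<bar>\<theta>\<bar>"
      unfolding eq using mult_left_mono[OF exp_minus_one_bounds(1)[OF \<theta>], of a] a by (simp add: mult_ac)
    show "a * \<bar>\<theta>\<bar> / 2 \<le> \<bar>a * exp \<theta> - a\<bar>"
      unfolding eq using mult_left_mono[OF exp_minus_one_bounds(2)[OF \<theta>], of a] a by simp
  qed
  have dKu: "(a * exp \<theta> - a)\<^sup>2 / (1 - a * exp \<theta>) \<le> C * \<theta>\<^sup>2" if "\<bar>\<theta>\<bar> \<le> \<delta>" for \<theta>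
  proof -
    have "(a * exp \<theta> - a)\<^sup>2 \<le> (2 * a * \<bar>\<theta>\<bar>)\<^sup>2" using e(1)[OF that] a by (intro abs_le_square_iff[THEN iffD1]) auto
    then have "(a * exp \<theta> - a)\<^sup>2 * (1 / (1 - a * exp \<theta>)) \<le> (2 * a * \<bar>\<theta>\<bar>)\<^sup>2 * (2 / (1 - a))"
      using b2[OF that] b1[OF that] a by (intro mult_mono) auto
    also have "\<dots> = 8 * a\<^sup>2 / (1 - a) * \<theta>\<^sup>2" by (simp add: power2_eq_square)
    also have "\<dots> \<le> C * \<theta>\<^sup>2" using C by (intro mult_right_mono) auto
    finally show ?thesis by simp
  qed
  have dKl: "3 * c * \<theta>\<^sup>2 \<le> (a * exp \<theta> - a)\<^sup>2 / (1 - a * exp \<theta>)" if "\<bar>\<theta>\<bar> \<le> \<delta>" for \<theta>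
  proof -
    have "(a * \<bar>\<theta>\<bar> / 2)\<^sup>2 \<le> (a * exp \<theta> - a)\<^sup>2" using e(2)[OF that] a by (intro abs_le_square_iff[THEN iffD1]) auto
    then have "(a * \<bar>\<theta>\<bar> / 2)\<^sup>2 * 1 \<le> (a * exp \<theta> - a)\<^sup>2 * (1 / (1 - a * exp \<theta>))"
      using b2[OF that] b1[OF that] a by (intro mult_mono) auto
    moreover have "(a * \<bar>\<theta>\<bar> / 2)\<^sup>2 = 3 * c * \<theta>\<^sup>2"
      by (simp add: c_def power_mult_distrib power_divide)
    ultimately show ?thesis by simp
  qed
  have dMu: "\<bar>- (a * exp \<theta> - a) / ((1 - a) * (1 - a * exp \<theta>))\<bar> \<le> C * \<bar>\<theta>\<bar>" if "\<bar>\<theta>\<bar> \<le> \<delta>" for \<theta>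
  proof -
    have "\<bar>- (a * exp \<theta> - a) / ((1 - a) * (1 - a * exp \<theta>))\<bar> = \<bar>a * exp \<theta> - a\<bar> * (1 / (1 - a)) * (1 / (1 - a * exp \<theta>))"
      using b1[OF that] a by (simp add: abs_mult)
    also have "\<dots> \<le> (2 * a * \<bar>\<theta>\<bar>) * (1 / (1 - a)) * (2 / (1 - a))"
      using e(1)[OF that] b2[OF that] b1[OF that] a by (intro mult_mono) auto
    also have "\<dots> = 4 * a / (1 - a)\<^sup>2 * \<bar>\<theta>\<bar>" by (simp add: power2_eq_square)
    also have "\<dots> \<le> C * \<bar>\<theta>\<bar>" using C by (intro mult_right_mono) auto
    finally show ?thesis .
  qed
  have z: "K 0 = 0" "M 0 = 0" by (simp_all add: K_def M_def)
  \<comment> \<open>Monotonicity of \<open>K\<close>, \<open>K + c\<theta>\<^sup>3\<close> and \<open>K + C\<theta>\<^sup>3\<close> and their common zero give all cubic bounds.\<close>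
  have Kneg: "K \<theta> \<le> 0" "- (C * \<theta> ^ 3) \<le> K \<theta>" if "0 \<le> \<theta>" "\<theta> \<le> \<delta>" for \<theta>
  proof -
    have "K \<theta> \<le> K 0"
    proof (rule DERIV_nonpos_imp_nonincreasing[OF that(1)])
      fix x assume "0 \<le> x" "x \<le> \<theta>"
      then have x: "\<bar>x\<bar> \<le> \<delta>" using that by simp
      show "\<exists>y. (K has_real_derivative y) (at x) \<and> y \<le> 0"
        using dK[OF x] b1[OF x] by (intro exI[of _ "- (a * exp x - a)\<^sup>2 / (1 - a * exp x)"]) (auto intro!: divide_nonpos_pos)
    qed
    then show "K \<theta> \<le> 0" by (simp add: z)
    have "(\<lambda>x. K x + C * x ^ 3) 0 \<le> (\<lambda>x. K x + C * x ^ 3) \<theta>"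
    proof (rule DERIV_nonneg_imp_nondecreasing[OF that(1)])
      fix x assume "0 \<le> x" "x \<le> \<theta>"
      then have x: "\<bar>x\<bar> \<le> \<delta>" using that by simp
      have "((\<lambda>x. K x + C * x ^ 3) has_real_derivative - (a * exp x - a)\<^sup>2 / (1 - a * exp x) + 3 * (C * x\<^sup>2)) (at x)"
        by (auto intro!: derivative_eq_intros dK[OF x])
      moreover have "0 \<le> - (a * exp x - a)\<^sup>2 / (1 - a * exp x) + 3 * (C * x\<^sup>2)"
      proof -
        have "0 \<le> C * x\<^sup>2" using C by simp
        then show ?thesis using dKu[OF x] by simp
      qed
      ultimately show "\<exists>y. ((\<lambda>x. K x + C * x ^ 3) has_real_derivative y) (at x) \<and> 0 \<le> y" by blast
    qed
    then show "- (C * \<theta> ^ 3) \<le> K \<theta>" by (simp add: z)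
  qed
  have Kpos: "c * \<bar>\<theta>\<bar> ^ 3 \<le> K \<theta>" "K \<theta> \<le> C * \<bar>\<theta>\<bar> ^ 3" if "- \<delta> \<le> \<theta>" "\<theta> \<le> 0" for \<theta>
  proof -
    have cube: "\<bar>\<theta>\<bar> ^ 3 = - (\<theta> ^ 3)" using that by (simp add: power3_eq_cube)
    have "(\<lambda>x. K x + c * x ^ 3) 0 \<le> (\<lambda>x. K x + c * x ^ 3) \<theta>"
    proof (rule DERIV_nonpos_imp_nonincreasing[OF that(2)])
      fix x assume "\<theta> \<le> x" "x \<le> 0"
      then have x: "\<bar>x\<bar> \<le> \<delta>" using that by simp
      have "((\<lambda>x. K x + c * x ^ 3) has_real_derivative - (a * exp x - a)\<^sup>2 / (1 - a * exp x) + 3 * (c * x\<^sup>2)) (at x)"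
        by (auto intro!: derivative_eq_intros dK[OF x])
      moreover have "- (a * exp x - a)\<^sup>2 / (1 - a * exp x) + 3 * (c * x\<^sup>2) \<le> 0" using dKl[OF x] by simp
      ultimately show "\<exists>y. ((\<lambda>x. K x + c * x ^ 3) has_real_derivative y) (at x) \<and> y \<le> 0" by blast
    qed
    then show "c * \<bar>\<theta>\<bar> ^ 3 \<le> K \<theta>" by (simp add: z cube)
    have "(\<lambda>x. K x + C * x ^ 3) \<theta> \<le> (\<lambda>x. K x + C * x ^ 3) 0"
    proof (rule DERIV_nonneg_imp_nondecreasing[OF that(2)])
      fix x assume "\<theta> \<le> x" "x \<le> 0"
      then have x: "\<bar>x\<bar> \<le> \<delta>" using that by simp
      have "((\<lambda>x. K x + C * x ^ 3) has_real_derivative - (a * exp x - a)\<^sup>2 / (1 - a * exp x) + 3 * (C * x\<^sup>2)) (at x)"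
        by (auto intro!: derivative_eq_intros dK[OF x])
      moreover have "0 \<le> - (a * exp x - a)\<^sup>2 / (1 - a * exp x) + 3 * (C * x\<^sup>2)"
      proof -
        have "0 \<le> C * x\<^sup>2" using C by simp
        then show ?thesis using dKu[OF x] by simp
      qed
      ultimately show "\<exists>y. ((\<lambda>x. K x + C * x ^ 3) has_real_derivative y) (at x) \<and> 0 \<le> y" by blast
    qed
    then show "K \<theta> \<le> C * \<bar>\<theta>\<bar> ^ 3" by (simp add: z cube)
  qed
  have M_bounds: "M \<theta> \<le> 0" "- M \<theta> \<le> C * \<theta>\<^sup>2" if \<theta>: "\<bar>\<theta>\<bar> \<le> \<delta>" for \<theta>
  proof -
    have "\<bar>M \<theta> - M 0\<bar> \<le> C * \<bar>\<theta>\<bar> * \<bar>\<theta> - 0\<bar>"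
    proof (rule field_differentiable_bound[of "{- \<bar>\<theta>\<bar>..\<bar>\<theta>\<bar>}" M "\<lambda>x. - (a * exp x - a) / ((1 - a) * (1 - a * exp x))", simplified real_norm_def])
      fix x assume "x \<in> {- \<bar>\<theta>\<bar>..\<bar>\<theta>\<bar>}"
      then have x: "\<bar>x\<bar> \<le> \<delta>" "\<bar>x\<bar> \<le> \<bar>\<theta>\<bar>" using \<theta> by auto
      show "(M has_field_derivative - (a * exp x - a) / ((1 - a) * (1 - a * exp x))) (at x within {- \<bar>\<theta>\<bar>..\<bar>\<theta>\<bar>})"
        using dM[OF x(1)] by (rule has_field_derivative_at_within)
      have "C * \<bar>x\<bar> \<le> C * \<bar>\<theta>\<bar>" using x C by (intro mult_left_mono) auto
      then show "\<bar>- (a * exp x - a) / ((1 - a) * (1 - a * exp x))\<bar> \<le> C * \<bar>\<theta>\<bar>" using dMu[OF x(1)] by linarith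
    qed auto
    then show "- M \<theta> \<le> C * \<theta>\<^sup>2" using abs_mult[of \<theta> \<theta>] by (simp add: z power2_eq_square mult.assoc)
    have "1 - a * exp \<theta> \<le> (1 - a) * (1 - \<theta> * (a / (1 - a)))"
    proof -
      have "(1 - a) * (1 - \<theta> * (a / (1 - a))) = 1 - a - \<theta> * a" using a by (simp add: right_diff_distrib)
      then show ?thesis
        using a exp_ge_add_one_self[of \<theta>] mult_left_mono[of "1 + \<theta>" "exp \<theta>" a] by (simp add: algebra_simps)
    qed
    also have "\<dots> \<le> (1 - a) * exp (- (\<theta> * (a / (1 - a))))"
      using a exp_ge_add_one_self[of "- (\<theta> * (a / (1 - a)))"] by (intro mult_left_mono) auto
    finally have "ln (1 - a * exp \<theta>) \<le> ln ((1 - a) * exp (- (\<theta> * (a / (1 - a)))))"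
      using b1[OF \<theta>] a by (subst ln_le_cancel_iff) auto
    also have "\<dots> = ln (1 - a) - \<theta> * (a / (1 - a))" using a by (simp add: ln_mult)
    finally show "M \<theta> \<le> 0" by (simp add: M_def)
  qed
  \<comment> \<open>Rounding moves the site by some \<open>\<epsilon>\<close> in [0, 1]. As
    \<open>M\<close> is nonpositive and of order \<theta>^2, this adds a nonnegative term of that
    order.\<close>
  have rep: "\<exists>\<epsilon>. 0 \<le> \<epsilon> \<and> \<epsilon> \<le> 1 \<and> (\<forall>\<theta>. log_mgf a t \<theta> = t * K \<theta> + \<epsilon> * (- M \<theta>))" if "0 \<le> t" for t
  proof -
    define \<epsilon> where "\<epsilon> = (1 - a)\<^sup>2 * t - real (sites a t)"
    have s: "real (sites a t) = (1 - a)\<^sup>2 * t - \<epsilon>" by (simp add: \<epsilon>_def)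
    have "real (sites a t) = of_int \<lfloor>(1 - a)\<^sup>2 * t\<rfloor>" using that by (simp add: sites_def)
    then have "0 \<le> \<epsilon>" "\<epsilon> \<le> 1" unfolding \<epsilon>_def by linarith+
    moreover have "log_mgf a t \<theta> = t * K \<theta> + \<epsilon> * (- M \<theta>)" for \<theta>
      unfolding log_mgf_def drift_def s K_def M_def by (simp add: algebra_simps)
    ultimately show ?thesis by blast
  qed
  show thesis
  proof (rule that[OF \<delta>(1) C(1) c b1])
    fix t \<theta> :: real assume t: "0 \<le> t" and \<theta>: "\<bar>\<theta>\<bar> \<le> \<delta>"
    obtain \<epsilon> where \<epsilon>: "0 \<le> \<epsilon>" "\<epsilon> \<le> 1" "log_mgf a t \<theta> = t * K \<theta> + \<epsilon> * (- M \<theta>)" using rep[OF t] by blast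
    have "\<bar>K \<theta>\<bar> \<le> C * \<bar>\<theta>\<bar> ^ 3"
    proof (cases "0 \<le> \<theta>")
      case True
      then show ?thesis using Kneg[of \<theta>] \<theta> by simp
    next
      case False
      have "0 \<le> c * \<bar>\<theta>\<bar> ^ 3" using c by simp
      then show ?thesis using Kpos[of \<theta>] \<theta> False by simp
    qed
    then have "\<bar>t * K \<theta>\<bar> \<le> t * (C * \<bar>\<theta>\<bar> ^ 3)" using t by (simp add: abs_mult mult_left_mono)
    moreover have "\<bar>\<epsilon> * (- M \<theta>)\<bar> \<le> 1 * (C * \<theta>\<^sup>2)"
      unfolding abs_mult using \<epsilon> M_bounds[OF \<theta>] by (intro mult_mono) auto
    ultimately show "\<bar>log_mgf a t \<theta>\<bar> \<le> C * (t * \<bar>\<theta>\<bar> ^ 3 + \<theta>\<^sup>2)"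
      unfolding \<epsilon>(3) by (simp add: algebra_simps)
  next
    fix t \<theta> :: real assume t: "0 \<le> t" and \<theta>: "0 \<le> \<theta>" "\<theta> \<le> \<delta>"
    obtain \<epsilon> where \<epsilon>: "0 \<le> \<epsilon>" "\<epsilon> \<le> 1" "log_mgf a t \<theta> = t * K \<theta> + \<epsilon> * (- M \<theta>)" using rep[OF t] by blast
    have "t * K \<theta> \<le> 0" using t Kneg[OF \<theta>] by (simp add: mult_nonneg_nonpos)
    moreover have "\<epsilon> * (- M \<theta>) \<le> 1 * (C * \<theta>\<^sup>2)"
      using \<epsilon> M_bounds[of \<theta>] \<theta> by (intro mult_mono) auto
    ultimately show "log_mgf a t \<theta> \<le> C * \<theta>\<^sup>2" unfolding \<epsilon>(3) by simp
  next
    fix t \<theta> :: real assume t: "0 \<le> t" and \<theta>: "- \<delta> \<le> \<theta>" "\<theta> \<le> 0"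
    obtain \<epsilon> where \<epsilon>: "0 \<le> \<epsilon>" "\<epsilon> \<le> 1" "log_mgf a t \<theta> = t * K \<theta> + \<epsilon> * (- M \<theta>)" using rep[OF t] by blast
    have "t * (c * \<bar>\<theta>\<bar> ^ 3) \<le> t * K \<theta>" using t Kpos[OF \<theta>] by (intro mult_left_mono) auto
    moreover have "0 \<le> \<epsilon> * (- M \<theta>)" using \<epsilon> M_bounds[of \<theta>] \<theta> by (intro mult_nonneg_nonneg) auto
    ultimately show "c * (t * \<bar>\<theta>\<bar> ^ 3) \<le> log_mgf a t \<theta>" unfolding \<epsilon>(3) by (simp add: mult_ac)
  qed
qed

text \<open>Both parameters are written relative to \<open>a\<close> and the centering is always the
  drift at \<open>a\<close>, so every comparison system is expressed through the single function
  \<open>log_mgf a t\<close>.\<close>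

lemma mgf_centered:
  assumes "0 < a" "a * exp \<kappa> < 1" "a * exp \<theta> < 1" "a < 1" "1 \<le> p" "0 < t"
  shows "(\<integral>\<^sup>+x. ennreal (exp ((\<theta> - \<kappa>) * (real_of_int x - drift a t)))
      \<partial>current_pmf (p + sites a t) p t (a * exp \<kappa>) (a * exp \<theta>)) =
    ennreal (exp (log_mgf a t \<theta> - log_mgf a t \<kappa>))"
proof -
  let ?b = "a * exp \<theta>" and ?a = "a * exp \<kappa>"
  have "ln (?b / ?a) = \<theta> - \<kappa>" using assms by (simp add: ln_div flip: exp_diff)
  then have m: "(\<integral>\<^sup>+x. ennreal (exp ((\<theta> - \<kappa>) * real_of_int x)) \<partial>current_pmf (p + sites a t) p t ?a ?b) =
      ennreal (exp ((?b - ?a) * t) * ((1 - ?b) / (1 - ?a)) ^ sites a t)"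
    using mgf_current[of ?a ?b "p + sites a t" p t] assms by simp
  have "(\<integral>\<^sup>+x. ennreal (exp ((\<theta> - \<kappa>) * (real_of_int x - drift a t))) \<partial>current_pmf (p + sites a t) p t ?a ?b) =
      (\<integral>\<^sup>+x. ennreal (exp (- (\<theta> - \<kappa>) * drift a t)) * ennreal (exp ((\<theta> - \<kappa>) * real_of_int x))
        \<partial>current_pmf (p + sites a t) p t ?a ?b)"
    by (intro nn_integral_cong) (simp add: algebra_simps flip: ennreal_mult exp_add)
  also have "\<dots> = ennreal (exp (- (\<theta> - \<kappa>) * drift a t) * (exp ((?b - ?a) * t) * ((1 - ?b) / (1 - ?a)) ^ sites a t))"
    using assms by (simp add: nn_integral_cmult m ennreal_mult)
  also have "((1 - ?b) / (1 - ?a)) ^ sites a t = exp (real (sites a t) * (ln (1 - ?b) - ln (1 - ?a)))"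
    using assms by (simp add: exp_of_nat_mult exp_diff)
  also have "exp (- (\<theta> - \<kappa>) * drift a t) * (exp ((?b - ?a) * t) * exp (real (sites a t) * (ln (1 - ?b) - ln (1 - ?a)))) =
      exp (log_mgf a t \<theta> - log_mgf a t \<kappa>)"
    unfolding exp_add[symmetric] log_mgf_def by (simp add: algebra_simps)
  finally show ?thesis .
qed

subsection \<open>Moment estimates for the finite system\<close>

text \<open>The fourth-order remainder of the exponential series is nonnegative on both sides of
  0.\<close>

lemma exp_ge_cubic:
  fixes x :: real
  assumes "0 \<le> x"
  shows "1 - x + x\<^sup>2 / 2 - x ^ 3 / 6 \<le> exp (- x)" and "x ^ 3 / 6 \<le> exp x"
proof -
  have ex: "(\<Sum>m<4. y ^ m / fact m) \<le> exp y" for y :: real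
  proof -
    obtain u where "exp y = (\<Sum>m<4. y ^ m / fact m) + exp u / fact 4 * y ^ 4"
      using Maclaurin_exp_le[of y 4] by blast
    moreover have "0 \<le> exp u / fact 4 * y ^ 4" by simp
    ultimately show ?thesis by linarith
  qed
  have sum4: "(\<Sum>m<4. y ^ m / fact m) = 1 + y + y\<^sup>2 / 2 + y ^ 3 / 6" for y :: real
    by (simp add: eval_nat_numeral fact_numeral)
  show "1 - x + x\<^sup>2 / 2 - x ^ 3 / 6 \<le> exp (- x)"
    using ex[of "- x"] unfolding sum4 by simp
  have "0 \<le> x\<^sup>2 / 2" by simp
  then show "x ^ 3 / 6 \<le> exp x"
    using ex[of x] assms unfolding sum4 by linarith
qed

lemma neg_ln_bounds:
  fixes u :: real
  assumes "0 < u" "u \<le> 1/2"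
  shows "u \<le> - ln (1 - u)" "- ln (1 - u) \<le> 2 * u"
proof -
  show "u \<le> - ln (1 - u)" using ln_le_minus_one[of "1 - u"] assms by simp
  have "- ln (1 - u) = ln (1 / (1 - u))" using assms by (simp add: ln_div)
  also have "\<dots> \<le> 1 / (1 - u) - 1" using assms by (intro ln_le_minus_one) auto
  also have "\<dots> \<le> 2 * u" using assms by (simp add: field_simps)
  finally show "- ln (1 - u) \<le> 2 * u" .
qed

lemma log_mgf_0 [simp]: "log_mgf a t 0 = 0"
  by (simp add: log_mgf_def)

text \<open>All bounds are uniform in the number \<open>p\<close> of sites kept on the left, so that
  they survive the limit. In the passage to the limit, exponent 1 carries the lower bound on the
  variance, exponent 2 gives its uniform integrability, and exponent 3 bounds the error term of
  \<open>exp_second_order\<close>.\<close>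

theorem stationary_current_estimates:
  assumes a: "0 < a" "a < 1"
  obtains t0 B c :: real where "1 \<le> t0" "0 < B" "0 < c"
    and "\<And>t p s. t0 \<le> t \<Longrightarrow> 1 \<le> p \<Longrightarrow> s \<in> {1, 2, 3} \<Longrightarrow>
      laplace (current_pmf (p + sites a t) p t a a) (s / t powr (1/3)) (drift a t) \<le> ennreal B"
    and "\<And>t p. t0 \<le> t \<Longrightarrow> 1 \<le> p \<Longrightarrow>
      ennreal (1 + c) \<le> laplace (current_pmf (p + sites a t) p t a a) (1 / t powr (1/3)) (drift a t)"
    and "\<And>t p. t0 \<le> t \<Longrightarrow> 1 \<le> p \<Longrightarrow>
      (\<integral>\<^sup>+x. ennreal ((real_of_int x - drift a t)\<^sup>2) \<partial>current_pmf (p + sites a t) p t a a)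
        \<le> ennreal (B * (t powr (1/3))\<^sup>2)"
proof -
  obtain \<delta> C c where \<delta>: "0 < \<delta>" and C: "0 < C" and c: "0 < c"
    and dens: "\<And>\<theta>. \<bar>\<theta>\<bar> \<le> \<delta> \<Longrightarrow> a * exp \<theta> < 1"
    and F_abs: "\<And>t \<theta>. 0 \<le> t \<Longrightarrow> \<bar>\<theta>\<bar> \<le> \<delta> \<Longrightarrow> \<bar>log_mgf a t \<theta>\<bar> \<le> C * (t * \<bar>\<theta>\<bar> ^ 3 + \<theta>\<^sup>2)"
    and F_pos: "\<And>t \<theta>. 0 \<le> t \<Longrightarrow> 0 \<le> \<theta> \<Longrightarrow> \<theta> \<le> \<delta> \<Longrightarrow> log_mgf a t \<theta> \<le> C * \<theta>\<^sup>2"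
    and F_neg: "\<And>t \<theta>. 0 \<le> t \<Longrightarrow> - \<delta> \<le> \<theta> \<Longrightarrow> \<theta> \<le> 0 \<Longrightarrow> c * (t * \<bar>\<theta>\<bar> ^ 3) \<le> log_mgf a t \<theta>"
    using log_mgf_bounds[OF a] by blast
  \<comment> \<open>With r = t^(1/3), logarithms of parameters are perturbed by at most 4 / r: up to
    1 / r for the density and up to 3 / r for the exponent. The bound 4 / \<delta> keeps them
    admissible, and r \<ge> C gives C \<theta>^2 \<le> 1 for \<theta> \<le> 1 / r. \<open>B1\<close>
    stems from two terms, each the exponential of at most two values of \<open>log_mgf\<close>,
    which are bounded by (64 + 16) C.\<close>
  define r0 where "r0 = max 1 (max (4 / \<delta>) C)"
  define B1 where "B1 = 2 * exp (160 * C)"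
  define B2 where "B2 = 2 * C + 2 * B1 / (1 - a) + B1"
  define B where "B = B1 + 4 * B2"
  have B1: "0 < B1" by (simp add: B1_def)
  have B2: "0 < B2" using C B1 a by (simp add: B2_def add_pos_pos)
  have r0: "1 \<le> r0" "4 / \<delta> \<le> r0" "C \<le> r0" by (auto simp: r0_def)
  have main: "(s \<in> {1, 2, 3} \<longrightarrow>
      laplace (current_pmf (p + sites a t) p t a a) (s / t powr (1/3)) (drift a t) \<le> ennreal B) \<and>
      ennreal (1 + c) \<le> laplace (current_pmf (p + sites a t) p t a a) (1 / t powr (1/3)) (drift a t) \<and>
      (\<integral>\<^sup>+x. ennreal ((real_of_int x - drift a t)\<^sup>2) \<partial>current_pmf (p + sites a t) p t a a)
        \<le> ennreal (B * (t powr (1/3))\<^sup>2)"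
    if t: "r0 ^ 3 \<le> t" and p: "1 \<le> p" for t p and s :: real
  proof -
    define r where "r = t powr (1/3)"
    define \<mu> where "\<mu> = drift a t"
    define n where "n = p + sites a t"
    have t1: "1 \<le> t" using r0(1) t one_le_power[of r0 3] by linarith
    have rt: "r ^ 3 = t" using t1 by (simp add: r_def powr_power)
    have "r0 \<le> r"
    proof (rule ccontr)
      assume "\<not> r0 \<le> r"
      then have "r ^ 3 < r0 ^ 3" using t1 by (intro power_strict_mono) (auto simp: r_def)
      with rt t show False by simp
    qed
    with r0 have r: "1 \<le> r" "4 / \<delta> \<le> r" "C \<le> r" by auto
    have r\<delta>: "4 / r \<le> \<delta>" using r \<delta> by (simp add: field_simps)
    have n: "1 \<le> n" "p \<le> n" "n - p = sites a t" using p by (auto simp: n_def)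
    have small: "\<bar>x\<bar> \<le> \<delta>" if "\<bar>x\<bar> \<le> 4 / r" for x using that r\<delta> by simp
    have F80: "\<bar>log_mgf a t x\<bar> \<le> 80 * C" if x: "\<bar>x\<bar> \<le> 4 / r" for x
    proof -
      have "t * \<bar>x\<bar> ^ 3 \<le> t * (4 / r) ^ 3" using x t1 by (intro mult_left_mono power_mono) auto
      also have "\<dots> = 64" using rt r t1 by (simp add: power_divide)
      finally have 1: "t * \<bar>x\<bar> ^ 3 \<le> 64" .
      have "x\<^sup>2 \<le> (4 / r)\<^sup>2" using x r by (intro abs_le_square_iff[THEN iffD1]) auto
      also have "\<dots> \<le> 16" using r by (simp add: power_divide field_simps)
      finally have "C * (t * \<bar>x\<bar> ^ 3 + x\<^sup>2) \<le> C * 80" using 1 C by (intro mult_left_mono) auto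
      then show ?thesis using F_abs[of t x] small[OF x] t1 by simp
    qed
    \<comment> \<open>Either the right parameter is lowered to a exp (- s / r) or the left one is
      raised to a exp (\<kappa> + s / r). In both cases the logarithm of right over left parameter
      becomes - s / r, the exponent at which \<open>mgf_current\<close> is exact.\<close>
    have expB: "laplace (current_pmf n p t a (a * exp \<kappa>)) (s / r) \<mu> \<le> ennreal B1"
      if s: "s \<in> {1, 2, 3}" and \<kappa>: "0 \<le> \<kappa>" "\<kappa> \<le> 1 / r" for s \<kappa>
    proof -
      have sr: "0 < s" "0 < s / r" "s / r \<le> 3 / r" using s r by (auto simp: divide_right_mono)
      have k4: "3 / r + 1 / r = 4 / r" by (simp add: add_divide_distrib[symmetric])
      have b: "\<bar>\<kappa>\<bar> \<le> 4 / r" "\<bar>- (s / r)\<bar> \<le> 4 / r" "\<bar>\<kappa> + s / r\<bar> \<le> 4 / r"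
        using sr \<kappa> k4 r by (auto simp: divide_right_mono)
      have d: "a * exp \<kappa> < 1" "a * exp (- (s / r)) < 1" "a * exp (\<kappa> + s / r) < 1"
        using b by (auto intro!: dens small simp del: mult_exp_exp)
      have "laplace (current_pmf n p t a (a * exp \<kappa>)) (s / r) \<mu> \<le>
        laplace (current_pmf n p t a (a * exp (- (s / r)))) (s / r) \<mu> +
        laplace (current_pmf n p t (a * exp (\<kappa> + s / r)) (a * exp \<kappa>)) (s / r) \<mu>"
        using a d sr by (intro exp_current_le) auto
      also have "laplace (current_pmf n p t a (a * exp (- (s / r)))) (s / r) \<mu> =
          ennreal (exp (log_mgf a t (- (s / r))))"
        using mgf_centered[of a 0 "- (s / r)" p t] a d p t1 by (simp add: n_def \<mu>_def)
      also have "laplace (current_pmf n p t (a * exp (\<kappa> + s / r)) (a * exp \<kappa>)) (s / r) \<mu> =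
          ennreal (exp (log_mgf a t \<kappa> - log_mgf a t (\<kappa> + s / r)))"
        using mgf_centered[of a "\<kappa> + s / r" \<kappa> p t] a d p t1 by (simp add: n_def \<mu>_def)
      also have "ennreal (exp (log_mgf a t (- (s / r)))) + ennreal (exp (log_mgf a t \<kappa> - log_mgf a t (\<kappa> + s / r))) \<le>
          ennreal (exp (160 * C)) + ennreal (exp (160 * C))"
        using F80[OF b(1)] F80[OF b(2)] F80[OF b(3)] C by (intro add_mono ennreal_leI) auto
      finally show ?thesis by (simp add: B1_def flip: ennreal_plus)
    qed
    have upper: "(\<integral>\<^sup>+x. ennreal ((real_of_int x - \<mu>)\<^sup>2) \<partial>current_pmf n p t a a) \<le> ennreal (4 * B2 * r\<^sup>2)"
    proof -
      \<comment> \<open>A dyadic sequence of densities. Since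
        \<open>thinning a (a / (1 - u)) = u / (1 - a)\<close>, halving \<open>u\<close> halves the
        thinning probability exactly, as \<open>current_superadditive\<close> demands. The start at
        probability 1 / (2 r) makes the first \<theta> of order 1 / r.\<close>
      define u where "u k = (1 - a) * (1 / (2 * r)) / 2 ^ k" for k :: nat
      define \<theta> where "\<theta> k = - ln (1 - u k)" for k
      define \<beta> where "\<beta> k = a / (1 - u k)" for k
      define P where "P k = measure_pmf (current_pmf n p t a (\<beta> k))" for k
      have u: "0 < u k" "u k \<le> 1/2" "u k \<le> (1 - a) / (2 * r)" "2 * u k \<le> 1 / r" "u (Suc k) = u k / 2" for k
      proof -
        show "0 < u k" using a r by (simp add: u_def)
        have "u k \<le> (1 - a) * (1 / (2 * r)) / 1" unfolding u_def using a r by (intro divide_left_mono) auto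
        then show *: "u k \<le> (1 - a) / (2 * r)" by simp
        have "(1 - a) / (2 * r) \<le> 1 / (2 * r)" using a r by (intro divide_right_mono) auto
        with * have **: "u k \<le> 1 / (2 * r)" by simp
        then show "2 * u k \<le> 1 / r" by (simp add: field_simps)
        have "1 / (2 * r) \<le> 1/2" using r by (simp add: field_simps)
        with ** show "u k \<le> 1/2" by simp
        show "u (Suc k) = u k / 2" by (simp add: u_def)
      qed
      have \<theta>: "u k \<le> \<theta> k" "0 < \<theta> k" "\<theta> k \<le> 1 / r" "a * exp (\<theta> k) = \<beta> k" for k
      proof -
        show *: "u k \<le> \<theta> k" unfolding \<theta>_def by (rule neg_ln_bounds(1)[OF u(1,2)])
        then show "0 < \<theta> k" using u(1)[of k] by simp
        show "\<theta> k \<le> 1 / r" using neg_ln_bounds(2)[OF u(1,2), of k] u(4)[of k] unfolding \<theta>_def by simp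
        show "a * exp (\<theta> k) = \<beta> k" using u(2)[of k] by (simp add: \<theta>_def \<beta>_def exp_minus field_simps)
      qed
      have \<beta>: "a \<le> \<beta> k" "\<beta> k < 1" "\<beta> (Suc k) \<le> \<beta> k" "thinning a (\<beta> k) = u k / (1 - a)" for k
      proof -
        show "a \<le> \<beta> k" using u(1,2)[of k] a by (simp add: \<beta>_def field_simps)
        have "\<theta> k \<le> \<delta>" using \<theta>(3)[of k] r\<delta> r by (smt (verit) divide_right_mono)
        then show "\<beta> k < 1" using dens[of "\<theta> k"] \<theta>(2)[of k] by (simp add: \<theta>(4))
        show "\<beta> (Suc k) \<le> \<beta> k" unfolding \<beta>_def u(5) using u(1,2)[of k] a by (intro divide_left_mono) auto
        show "thinning a (\<beta> k) = u k / (1 - a)" using a u(1,2)[of k] by (simp add: thinning_def \<beta>_def divide_simps) (simp add: algebra_simps)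
      qed
      have X1: "(\<integral>\<^sup>+x. ennreal (exp (- (1 / r) * (real_of_int x - \<mu>))) \<partial>P k) \<le> ennreal B1" for k
        using expB[of 1 "\<theta> k"] \<theta>[of k] by (simp add: P_def)
      have X2: "(\<integral>\<^sup>+x. ennreal (exp (\<theta> k * (real_of_int x - \<mu>))) \<partial>P k) = ennreal (exp (log_mgf a t (\<theta> k)))" for k
        using mgf_centered[of a 0 "\<theta> k" p t] a p t1 \<beta>(2)[of k] by (simp add: n_def \<mu>_def \<theta>(4) P_def)
      have I1: "integrable (P k) (\<lambda>x. exp (- (1 / r) * (real_of_int x - \<mu>)))" for k
        using X1[of k] by (intro integrableI_nonneg) (auto simp: P_def intro: le_less_trans)
      have I2: "integrable (P k) (\<lambda>x. exp (\<theta> k * (real_of_int x - \<mu>)))" for k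
        using X2[of k] by (intro integrableI_nonneg) (auto simp: P_def)
      have E1: "(\<integral>x. exp (- (1 / r) * (real_of_int x - \<mu>)) \<partial>P k) \<le> B1" for k
        using X1[of k] B1 I1[of k] by (subst (asm) nn_integral_eq_integral) (auto simp: ennreal_le_iff)
      have E2: "(\<integral>x. exp (\<theta> k * (real_of_int x - \<mu>)) \<partial>P k) = exp (log_mgf a t (\<theta> k))" for k
        using X2[of k] I2[of k] by (subst (asm) nn_integral_eq_integral) (auto simp: integral_nonneg_AE)
      have Y: "- y \<le> r * exp (- (1 / r) * y)" "y \<le> (1 / \<theta> k) * exp (\<theta> k * y)" for y k
      proof -
        have "- (1 / r) * y \<le> exp (- (1 / r) * y)" using exp_ge_add_one_self[of "- (1 / r) * y"] by linarith
        then have "r * (- (1 / r) * y) \<le> r * exp (- (1 / r) * y)" using r by (intro mult_left_mono) auto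
        then show "- y \<le> r * exp (- (1 / r) * y)" using r by simp
        have "\<theta> k * y \<le> exp (\<theta> k * y)" using exp_ge_add_one_self[of "\<theta> k * y"] by linarith
        then show "y \<le> (1 / \<theta> k) * exp (\<theta> k * y)" using \<theta>(2)[of k] by (simp add: field_simps)
      qed
      have I: "integrable (P k) (\<lambda>x. real_of_int x - \<mu>)" for k
      proof (rule Bochner_Integration.integrable_bound)
        show "integrable (P k) (\<lambda>x. r * exp (- (1 / r) * (real_of_int x - \<mu>)) + (1 / \<theta> k) * exp (\<theta> k * (real_of_int x - \<mu>)))"
          using I1[of k] I2[of k] by (intro Bochner_Integration.integrable_add integrable_mult_right)
        show "AE x in P k. norm (real_of_int x - \<mu>) \<le>
            norm (r * exp (- (1 / r) * (real_of_int x - \<mu>)) + (1 / \<theta> k) * exp (\<theta> k * (real_of_int x - \<mu>)))"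
        proof (intro AE_I2)
          fix x :: int
          define y where "y = real_of_int x - \<mu>"
          have "0 \<le> r * exp (- (1 / r) * y)" "0 \<le> (1 / \<theta> k) * exp (\<theta> k * y)" using r \<theta>(2)[of k] by auto
          then have "\<bar>y\<bar> \<le> \<bar>r * exp (- (1 / r) * y) + (1 / \<theta> k) * exp (\<theta> k * y)\<bar>" using Y(1)[of y] Y(2)[of y k] by linarith
          then show "norm (real_of_int x - \<mu>) \<le>
            norm (r * exp (- (1 / r) * (real_of_int x - \<mu>)) + (1 / \<theta> k) * exp (\<theta> k * (real_of_int x - \<mu>)))"
            by (simp add: y_def)
        qed
      qed (simp add: P_def)
      have I': "integrable (P k) real_of_int" for k
      proof -
        have "integrable (P k) (\<lambda>x. (real_of_int x - \<mu>) + \<mu>)"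
          by (intro Bochner_Integration.integrable_add I) (simp add: P_def)
        then show ?thesis by simp
      qed
      \<comment> \<open>The mean current lost by raising the right parameter to
        \<open>\<beta> k\<close>. For k = 0 it is at most of order r by the exponential moment, and
        each halving of the extra particles at least halves it; hence it is at most of order r^2
        \<theta>.\<close>
      define D where "D k = - (\<integral>x. real_of_int x - \<mu> \<partial>P k)" for k
      have D: "D k = \<mu> - (\<integral>x. real_of_int x \<partial>P k)" for k
        using I'[of k] by (simp add: D_def P_def)
      have mean: "integrable (current_pmf n p t a a) real_of_int" "(\<integral>x. real_of_int x \<partial>current_pmf n p t a a) = \<mu>"
        using mean_current[OF a n(1,2), of t] t1 by (simp_all add: n(3) \<mu>_def drift_def)
      have D0: "D 0 \<le> r * B1"
      proof -
        have "D 0 = (\<integral>x. - (real_of_int x - \<mu>) \<partial>P 0)"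
          by (simp only: D_def Bochner_Integration.integral_minus)
        also have "\<dots> \<le> (\<integral>x. r * exp (- (1 / r) * (real_of_int x - \<mu>)) \<partial>P 0)"
          by (intro integral_mono Bochner_Integration.integrable_minus integrable_mult_right I I1 Y(1))
        also have "\<dots> \<le> r * B1" using E1[of 0] r by simp
        finally show ?thesis .
      qed
      have DS: "D (Suc k) \<le> D k / 2" for k
      proof -
        have "(\<integral>x. real_of_int x \<partial>current_pmf n p t a a) + (\<integral>x. real_of_int x \<partial>P k) \<le> 2 * (\<integral>x. real_of_int x \<partial>P (Suc k))"
          unfolding P_def
          using a \<beta>(1)[of "Suc k"] \<beta>(2,3,4)[of k] \<beta>(4)[of "Suc k"] u(5)[of k] mean(1) I'[of k] I'[of "Suc k"]
          by (intro current_superadditive) (auto simp: P_def)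
        then show ?thesis unfolding D mean(2) by simp
      qed
      have Dk: "D k \<le> r * B1 / 2 ^ k" for k
      proof (induction k)
        case (Suc k)
        have "D (Suc k) \<le> D k / 2" by (rule DS)
        also have "\<dots> \<le> (r * B1 / 2 ^ k) / 2" using Suc by (intro divide_right_mono) auto
        finally show ?case by simp
      qed (use D0 in simp)
      have D\<theta>: "D k \<le> \<theta> k * (2 * r\<^sup>2 * B1 / (1 - a))" for k
      proof -
        have "r * B1 / 2 ^ k = u k * (2 * r\<^sup>2 * B1 / (1 - a))"
          using a r by (simp add: u_def power2_eq_square)
        also have "\<dots> \<le> \<theta> k * (2 * r\<^sup>2 * B1 / (1 - a))"
          using \<theta>(1)[of k] a B1 by (intro mult_right_mono) auto
        finally show ?thesis using Dk[of k] by simp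
      qed
      \<comment> \<open>For nonnegative y the quadratic Taylor polynomial lies below the
        exponential. For negative y the error is cubic and is absorbed by exp (- y / r), whose mean
        is bounded by \<open>B1\<close>.\<close>
      have pointwise: "(\<theta> k)\<^sup>2 * y\<^sup>2 / 2 \<le> exp (\<theta> k * y) - 1 - \<theta> k * y + (\<theta> k) ^ 3 * r ^ 3 * exp (- (1 / r) * y)" for y k
      proof (cases "0 \<le> y")
        case True
        then have "1 + \<theta> k * y + (\<theta> k * y)\<^sup>2 / 2 \<le> exp (\<theta> k * y)"
          using \<theta>(2)[of k] by (intro exp_lower_Taylor_quadratic) auto
        moreover have "0 \<le> (\<theta> k) ^ 3 * r ^ 3 * exp (- (1 / r) * y)" using \<theta>(2)[of k] r by simp
        ultimately show ?thesis by (simp add: power_mult_distrib)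
      next
        case False
        define z where "z = - y"
        have z: "0 \<le> z" "y = - z" using False by (auto simp: z_def)
        have "1 - \<theta> k * z + (\<theta> k * z)\<^sup>2 / 2 - (\<theta> k * z) ^ 3 / 6 \<le> exp (- (\<theta> k * z))"
          using \<theta>(2)[of k] z by (intro exp_ge_cubic) auto
        moreover have "(\<theta> k * z) ^ 3 / 6 \<le> (\<theta> k) ^ 3 * r ^ 3 * exp ((1 / r) * z)"
        proof -
          have "(z / r) ^ 3 / 6 \<le> exp (z / r)" using z r by (intro exp_ge_cubic) auto
          then have "(\<theta> k) ^ 3 * r ^ 3 * ((z / r) ^ 3 / 6) \<le> (\<theta> k) ^ 3 * r ^ 3 * exp (z / r)"
            using \<theta>(2)[of k] r by (intro mult_left_mono) auto
          then show ?thesis using r by (simp add: power_divide power_mult_distrib)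
        qed
        ultimately show ?thesis by (simp add: z(2) power_mult_distrib)
      qed
      \<comment> \<open>After integration every term is at most of order \<theta>^2 r^2: the
        exponential moment minus 1 because \<open>log_mgf\<close> is at most C \<theta>^2 for
        positive \<theta>, the linear term by the bound on the loss, and the cubic one because
        \<theta> r \<le> 1.\<close>
      have sq: "(\<integral>\<^sup>+x. ennreal ((\<theta> k)\<^sup>2 * (real_of_int x - \<mu>)\<^sup>2 / 2) \<partial>P k) \<le> ennreal ((\<theta> k)\<^sup>2 * (B2 * r\<^sup>2))" for k
      proof -
        let ?g = "\<lambda>x. exp (\<theta> k * (real_of_int x - \<mu>)) - 1 - \<theta> k * (real_of_int x - \<mu>) +
          (\<theta> k) ^ 3 * r ^ 3 * exp (- (1 / r) * (real_of_int x - \<mu>))"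
        have Ig: "integrable (P k) ?g"
          using I1[of k] I2[of k] I[of k] by (auto simp: P_def)
        have g0: "0 \<le> ?g x" for x
          using pointwise[of k "real_of_int x - \<mu>"] by (rule order_trans[rotated]) simp
        have "(\<integral>x. ?g x \<partial>P k) = (\<integral>x. exp (\<theta> k * (real_of_int x - \<mu>)) \<partial>P k) - 1 - \<theta> k * (\<integral>x. real_of_int x - \<mu> \<partial>P k) +
            (\<theta> k) ^ 3 * r ^ 3 * (\<integral>x. exp (- (1 / r) * (real_of_int x - \<mu>)) \<partial>P k)"
          using I1[of k] I2[of k] I[of k] by (simp add: P_def)
        also have "\<dots> \<le> exp (log_mgf a t (\<theta> k)) - 1 + \<theta> k * D k + (\<theta> k) ^ 3 * r ^ 3 * B1"
          using E1[of k] E2[of k] \<theta>(2)[of k] r by (simp add: D_def)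
        also have "\<dots> \<le> 2 * C * (\<theta> k)\<^sup>2 + (\<theta> k)\<^sup>2 * (2 * r\<^sup>2 * B1 / (1 - a)) + (\<theta> k)\<^sup>2 * (r\<^sup>2 * B1)"
        proof -
          have \<theta>r: "\<theta> k * r \<le> 1" using \<theta>(3)[of k] r by (simp add: field_simps)
          have "C * (\<theta> k)\<^sup>2 \<le> r * (\<theta> k)\<^sup>2" using r by (intro mult_right_mono) auto
          also have "\<dots> = (\<theta> k * r) * \<theta> k" by (simp add: power2_eq_square)
          also have "\<dots> \<le> 1 * 1" using \<theta>r \<theta>(2,3)[of k] r by (intro mult_mono) (auto simp: order_trans[OF \<theta>(3)])
          finally have C1: "C * (\<theta> k)\<^sup>2 \<le> 1" by simp
          have C0: "0 \<le> C * (\<theta> k)\<^sup>2" using C by simp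
          have "\<theta> k \<le> \<delta>" using \<theta>(3)[of k] r\<delta> r by (smt (verit) divide_right_mono)
          then have "exp (log_mgf a t (\<theta> k)) \<le> exp (C * (\<theta> k)\<^sup>2)" using F_pos[of t "\<theta> k"] \<theta>(2)[of k] t1 by simp
          also have "\<dots> \<le> 1 + C * (\<theta> k)\<^sup>2 + (C * (\<theta> k)\<^sup>2)\<^sup>2" using C0 C1 by (rule exp_bound)
          also have "(C * (\<theta> k)\<^sup>2)\<^sup>2 \<le> C * (\<theta> k)\<^sup>2" using C0 C1 by (simp add: power2_eq_square[of "C * (\<theta> k)\<^sup>2"] mult_left_le_one_le)
          finally have 1: "exp (log_mgf a t (\<theta> k)) - 1 \<le> 2 * C * (\<theta> k)\<^sup>2" by simp
          have "\<theta> k * D k \<le> \<theta> k * (\<theta> k * (2 * r\<^sup>2 * B1 / (1 - a)))"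
            using D\<theta>[of k] \<theta>(2)[of k] by (intro mult_left_mono) auto
          then have 2: "\<theta> k * D k \<le> (\<theta> k)\<^sup>2 * (2 * r\<^sup>2 * B1 / (1 - a))" by (simp add: power2_eq_square)
          have "(\<theta> k) ^ 3 * r ^ 3 * B1 = (\<theta> k * r) * ((\<theta> k)\<^sup>2 * (r\<^sup>2 * B1))"
            by (simp add: power2_eq_square power3_eq_cube)
          also have "\<dots> \<le> 1 * ((\<theta> k)\<^sup>2 * (r\<^sup>2 * B1))" using \<theta>r B1 by (intro mult_right_mono) auto
          finally have 3: "(\<theta> k) ^ 3 * r ^ 3 * B1 \<le> (\<theta> k)\<^sup>2 * (r\<^sup>2 * B1)" by simp
          show ?thesis using 1 2 3 by linarith
        qed
        also have "\<dots> \<le> (\<theta> k)\<^sup>2 * (B2 * r\<^sup>2)"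
        proof -
          have "2 * C * 1 \<le> 2 * C * r\<^sup>2" using C r one_le_power[of r 2] by (intro mult_left_mono) auto
          then have "2 * C + 2 * r\<^sup>2 * B1 / (1 - a) + r\<^sup>2 * B1 \<le> B2 * r\<^sup>2" by (simp add: B2_def algebra_simps)
          then have "(\<theta> k)\<^sup>2 * (2 * C + 2 * r\<^sup>2 * B1 / (1 - a) + r\<^sup>2 * B1) \<le> (\<theta> k)\<^sup>2 * (B2 * r\<^sup>2)"
            by (intro mult_left_mono) auto
          then show ?thesis by (simp add: algebra_simps)
        qed
        finally have Eg: "(\<integral>x. ?g x \<partial>P k) \<le> (\<theta> k)\<^sup>2 * (B2 * r\<^sup>2)" .
        have "(\<integral>\<^sup>+x. ennreal ((\<theta> k)\<^sup>2 * (real_of_int x - \<mu>)\<^sup>2 / 2) \<partial>P k) \<le> (\<integral>\<^sup>+x. ennreal (?g x) \<partial>P k)"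
          by (intro nn_integral_mono ennreal_leI pointwise)
        also have "\<dots> = ennreal (\<integral>x. ?g x \<partial>P k)" using Ig g0 by (intro nn_integral_eq_integral) auto
        also have "\<dots> \<le> ennreal ((\<theta> k)\<^sup>2 * (B2 * r\<^sup>2))" using Eg by (rule ennreal_leI)
        finally show ?thesis .
      qed
      have sq': "(\<integral>\<^sup>+x. ennreal ((real_of_int x - \<mu>)\<^sup>2) \<partial>P k) \<le> ennreal (2 * B2 * r\<^sup>2)" for k
      proof -
        have "(\<integral>\<^sup>+x. ennreal ((real_of_int x - \<mu>)\<^sup>2) \<partial>P k) =
            (\<integral>\<^sup>+x. ennreal (2 / (\<theta> k)\<^sup>2) * ennreal ((\<theta> k)\<^sup>2 * (real_of_int x - \<mu>)\<^sup>2 / 2) \<partial>P k)"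
          using \<theta>(2)[of k] by (intro nn_integral_cong) (simp flip: ennreal_mult)
        also have "\<dots> \<le> ennreal (2 / (\<theta> k)\<^sup>2) * ennreal ((\<theta> k)\<^sup>2 * (B2 * r\<^sup>2))"
          using sq[of k] by (subst nn_integral_cmult) (auto simp: P_def intro: mult_left_mono)
        also have "\<dots> = ennreal (2 * B2 * r\<^sup>2)"
          using \<theta>(2)[of k] B2 by (simp flip: ennreal_mult)
        finally show ?thesis .
      qed
      \<comment> \<open>The bound on the second moment does not depend on \<open>k\<close>. Take
        \<open>k\<close> so large that with probability at least 1/2 none of the \<open>N\<close>
        sites right of the origin has extra particles; this costs a factor 2.\<close>
      define N where "N = sites a t"
      have "\<exists>k. real N / r * (1 / 2) ^ k < 1"
      proof (cases "N = 0")
        case False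
        then have "0 < r / real N" using r by simp
        then obtain k where "(1 / 2) ^ k < r / real N" using real_arch_pow_inv[of "r / real N" "1/2"] by auto
        then show ?thesis using False r by (intro exI[of _ k]) (simp add: field_simps)
      qed auto
      then obtain k where k: "real N / r * (1 / 2) ^ k < 1" by blast
      have thin: "thinning a (\<beta> k) = 1 / (2 * r) * (1 / 2) ^ k"
      proof -
        have "u k = (1 - a) * (1 / (2 * r) * (1 / 2) ^ k)" by (simp add: u_def power_one_over)
        then show ?thesis using a by (simp add: \<beta>(4))
      qed
      have "1/2 \<le> 1 - real N * thinning a (\<beta> k)" using k r unfolding thin by (simp add: field_simps)
      also have "\<dots> \<le> (1 - thinning a (\<beta> k)) ^ N"
        using Bernoulli_inequality[of "- thinning a (\<beta> k)" N] thinning_bounds[of a "\<beta> k"] \<beta>[of k] a by simp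
      finally have half: "1/2 \<le> (1 - thinning a (\<beta> k)) ^ N" .
      have "ennreal (1/2) * (\<integral>\<^sup>+x. ennreal ((real_of_int x - \<mu>)\<^sup>2) \<partial>current_pmf n p t a a) \<le>
          ennreal ((1 - thinning a (\<beta> k)) ^ N) * (\<integral>\<^sup>+x. ennreal ((real_of_int x - \<mu>)\<^sup>2) \<partial>current_pmf n p t a a)"
        using half by (intro mult_right_mono ennreal_leI) auto
      also have "\<dots> \<le> (\<integral>\<^sup>+x. ennreal ((real_of_int x - \<mu>)\<^sup>2) \<partial>P k)"
        using current_pmf_dominates[of a "\<beta> k" p n] a \<beta>(1,2)[of k] n by (simp add: N_def P_def)
      also note sq'[of k]
      finally have "ennreal 2 * (ennreal (1/2) * (\<integral>\<^sup>+x. ennreal ((real_of_int x - \<mu>)\<^sup>2) \<partial>current_pmf n p t a a)) \<le>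
          ennreal 2 * ennreal (2 * B2 * r\<^sup>2)" by (rule mult_left_mono) auto
      also have "ennreal 2 * (ennreal (1/2) * (\<integral>\<^sup>+x. ennreal ((real_of_int x - \<mu>)\<^sup>2) \<partial>current_pmf n p t a a)) =
          (\<integral>\<^sup>+x. ennreal ((real_of_int x - \<mu>)\<^sup>2) \<partial>current_pmf n p t a a)"
      proof -
        have "ennreal 2 * ennreal (1/2) = 1" by (subst ennreal_mult[symmetric]) auto
        then show ?thesis by (simp flip: mult.assoc del: ennreal_numeral)
      qed
      also have "ennreal 2 * ennreal (2 * B2 * r\<^sup>2) = ennreal (4 * B2 * r\<^sup>2)"
        using B2 by (subst ennreal_mult[symmetric]) auto
      finally show ?thesis .
    qed
    \<comment> \<open>At the exponent - 1 / r the cubic lower bound for \<open>log_mgf\<close>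
      equals \<open>c\<close>, because t / r^3 = 1.\<close>
    have lower: "ennreal (1 + c) \<le> laplace (current_pmf n p t a a) (1 / r) \<mu>"
    proof -
      have s1: "\<bar>- (1 / r)\<bar> \<le> 4 / r" using r by (auto simp: divide_right_mono)
      have "c = c * (t * \<bar>- (1 / r)\<bar> ^ 3)" using rt r t1 by (simp add: power_divide)
      also have "\<dots> \<le> log_mgf a t (- (1 / r))" using small[OF s1] t1 r by (intro F_neg) auto
      finally have "1 + c \<le> exp (log_mgf a t (- (1 / r)))"
        using exp_ge_add_one_self[of "log_mgf a t (- (1 / r))"] by linarith
      then have "ennreal (1 + c) \<le> ennreal (exp (log_mgf a t (- (1 / r))))" by (rule ennreal_leI)
      also have "\<dots> = laplace (current_pmf n p t a (a * exp (- (1 / r)))) (1 / r) \<mu>"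
        using mgf_centered[of a 0 "- (1 / r)" p t] a dens[OF small[OF s1]] p t1 by (simp add: n_def \<mu>_def)
      also have "\<dots> \<le> laplace (current_pmf n p t a a) (1 / r) \<mu>"
        using a r by (intro exp_current_antimono) auto
      finally show ?thesis .
    qed
    have "laplace (current_pmf n p t a a) (s / r) \<mu> \<le> ennreal B" if "s \<in> {1, 2, 3}"
    proof -
      have "B1 \<le> B" using B2 by (simp add: B_def)
      then show ?thesis using expB[OF that, of 0] r by (auto intro: order_trans ennreal_leI)
    qed
    moreover have "4 * B2 * r\<^sup>2 \<le> B * r\<^sup>2" using B1 by (intro mult_right_mono) (auto simp: B_def)
    then have "(\<integral>\<^sup>+x. ennreal ((real_of_int x - \<mu>)\<^sup>2) \<partial>current_pmf n p t a a) \<le> ennreal (B * r\<^sup>2)"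
      by (rule order_trans[OF upper ennreal_leI])
    ultimately show ?thesis using lower unfolding r_def \<mu>_def n_def by blast
  qed
  show thesis
  proof (rule that[of "r0 ^ 3" B c])
    show "1 \<le> r0 ^ 3" using r0 by simp
    show "0 < B" using B1 B2 by (simp add: B_def)
    show "0 < c" by (rule c)
  next
    fix t s :: real and p :: nat
    assume "r0 ^ 3 \<le> t" "1 \<le> p" "s \<in> {1, 2, 3}"
    then show "laplace (current_pmf (p + sites a t) p t a a) (s / t powr (1/3)) (drift a t) \<le> ennreal B"
      by (rule main[of t p s, THEN conjunct1, rule_format])
  next
    fix t :: real and p :: nat
    assume tp: "r0 ^ 3 \<le> t" "1 \<le> p"
    show "ennreal (1 + c) \<le> laplace (current_pmf (p + sites a t) p t a a) (1 / t powr (1/3)) (drift a t)"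
      by (rule main[OF tp, THEN conjunct2, THEN conjunct1])
    show "(\<integral>\<^sup>+x. ennreal ((real_of_int x - drift a t)\<^sup>2) \<partial>current_pmf (p + sites a t) p t a a)
        \<le> ennreal (B * (t powr (1/3))\<^sup>2)"
      by (rule main[OF tp, THEN conjunct2, THEN conjunct2])
  qed
qed

subsection \<open>Passage to the infinite system\<close>

text \<open>Fatou's lemma for counting measure; convergence of each point probability is the form in
  which the cut-off is removed.\<close>

lemma pmf_fatou:
  fixes g :: "int \<Rightarrow> real"
  assumes lim: "\<And>k. (\<lambda>p. pmf (P p) k) \<longlonglongrightarrow> pmf Q k"
    and "\<And>k. 0 \<le> g k" and B: "\<And>p. 1 \<le> p \<Longrightarrow> (\<integral>\<^sup>+x. ennreal (g x) \<partial>P p) \<le> B"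
  shows "(\<integral>\<^sup>+x. ennreal (g x) \<partial>Q) \<le> B"
proof -
  have "(\<integral>\<^sup>+x. ennreal (g x) \<partial>Q) = (\<integral>\<^sup>+k. ennreal (pmf Q k * g k) \<partial>count_space UNIV)"
    using assms(2) by (simp add: nn_integral_measure_pmf ennreal_mult)
  also have "\<dots> = (\<integral>\<^sup>+k. liminf (\<lambda>p. ennreal (pmf (P p) k * g k)) \<partial>count_space UNIV)"
  proof (intro nn_integral_cong)
    fix k
    have "(\<lambda>p. ennreal (pmf (P p) k * g k)) \<longlonglongrightarrow> ennreal (pmf Q k * g k)"
      by (intro tendsto_ennrealI tendsto_mult lim tendsto_const)
    then show "ennreal (pmf Q k * g k) = liminf (\<lambda>p. ennreal (pmf (P p) k * g k))"
      by (rule lim_imp_Liminf[OF sequentially_bot, symmetric])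
  qed
  also have "\<dots> \<le> liminf (\<lambda>p. \<integral>\<^sup>+k. ennreal (pmf (P p) k * g k) \<partial>count_space UNIV)"
    by (intro nn_integral_liminf) auto
  also have "\<dots> = liminf (\<lambda>p. \<integral>\<^sup>+x. ennreal (g x) \<partial>P p)"
    using assms(2) by (simp add: nn_integral_measure_pmf ennreal_mult)
  also have "\<dots> \<le> B"
  proof -
    have "eventually (\<lambda>p. (\<integral>\<^sup>+x. ennreal (g x) \<partial>P p) \<le> B) sequentially"
      using B by (auto simp: eventually_sequentially)
    then have "liminf (\<lambda>p. \<integral>\<^sup>+x. ennreal (g x) \<partial>P p) \<le> liminf (\<lambda>p. B)" by (rule Liminf_mono)
    then show ?thesis by (simp add: Liminf_const)
  qed
  finally show ?thesis .
qed

lemma integrable_pmf_squareD: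
  fixes g :: "int \<Rightarrow> real"
  assumes "(\<integral>\<^sup>+x. ennreal ((g x)\<^sup>2) \<partial>measure_pmf Q) \<le> ennreal C"
  shows "integrable (measure_pmf Q) (\<lambda>x. (g x)\<^sup>2)" "integrable (measure_pmf Q) g"
proof -
  show sq: "integrable (measure_pmf Q) (\<lambda>x. (g x)\<^sup>2)"
    using assms by (intro integrableI_nonneg) (auto intro: le_less_trans)
  show "integrable (measure_pmf Q) g"
  proof (rule Bochner_Integration.integrable_bound[of _ "\<lambda>x. (g x)\<^sup>2 + 1"])
    show "AE x in measure_pmf Q. norm (g x) \<le> norm ((g x)\<^sup>2 + 1)"
    proof (intro AE_I2)
      fix x
      have "0 \<le> (\<bar>g x\<bar> - 1/2)\<^sup>2" by simp
      then show "norm (g x) \<le> norm ((g x)\<^sup>2 + 1)" by (simp add: power2_eq_square algebra_simps)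
    qed
  qed (use sq in auto)
qed

text \<open>Uniform integrability enters through Fatou's lemma for the nonnegative function
  \<open>g\<^sup>2/K + K/4 - g\<close>.\<close>

lemma pmf_expectation_lower_limit:
  fixes g :: "int \<Rightarrow> real"
  assumes lim: "\<And>k. (\<lambda>p. pmf (P p) k) \<longlonglongrightarrow> pmf Q k"
    and C: "0 < C" "\<And>p. 1 \<le> p \<Longrightarrow> (\<integral>\<^sup>+x. ennreal ((g x)\<^sup>2) \<partial>P p) \<le> ennreal C"
    and \<epsilon>: "\<And>p. 1 \<le> p \<Longrightarrow> \<epsilon> \<le> measure_pmf.expectation (P p) g"
  shows "integrable Q g" "\<epsilon> \<le> measure_pmf.expectation Q g"
proof -
  have CQ: "(\<integral>\<^sup>+x. ennreal ((g x)\<^sup>2) \<partial>Q) \<le> ennreal C"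
    using lim C by (intro pmf_fatou[of P Q]) auto
  note IQ = integrable_pmf_squareD[OF CQ]
  show "integrable Q g" by (rule IQ(2))
  have "\<epsilon> \<le> measure_pmf.expectation Q g + e" if e: "0 < e" for e
  proof -
    \<comment> \<open>The function \<open>w\<close> below is the square of g - K / 2 divided by
      \<open>K\<close>, hence nonnegative. With this \<open>K\<close> the quadratic part contributes
      at most \<open>e\<close> to its mean, and K / 4 cancels in the end.\<close>
    define K where "K = C / e"
    have K: "0 < K" "C / K = e" using C e by (simp_all add: K_def)
    define w where "w x = (g x)\<^sup>2 / K + K / 4 - g x" for x
    have w0: "0 \<le> w x" for x
    proof -
      have "K * w x = (g x - K / 2)\<^sup>2" using K by (simp add: w_def power2_eq_square algebra_simps)
      then show ?thesis using K by (metis zero_le_mult_iff zero_le_power2 less_le_not_le)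
    qed
    have wP: "(\<integral>x. w x \<partial>P p) \<le> e + K / 4 - \<epsilon>" "(\<integral>\<^sup>+x. ennreal (w x) \<partial>P p) = ennreal (\<integral>x. w x \<partial>P p)"
      if p: "1 \<le> p" for p
    proof -
      note I = integrable_pmf_squareD[OF C(2)[OF p]]
      have "ennreal (\<integral>x. (g x)\<^sup>2 \<partial>P p) \<le> ennreal C"
        using C(2)[OF p] nn_integral_eq_integral[OF I(1)] by simp
      then have "(\<integral>x. (g x)\<^sup>2 \<partial>P p) \<le> C" using C(1) by simp
      then have "(\<integral>x. (g x)\<^sup>2 \<partial>P p) / K \<le> e" using K(1) by (simp add: K(2)[symmetric] divide_right_mono)
      moreover have "(\<integral>x. w x \<partial>P p) = (\<integral>x. (g x)\<^sup>2 \<partial>P p) / K + K / 4 - (\<integral>x. g x \<partial>P p)"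
        unfolding w_def using I by simp
      ultimately show "(\<integral>x. w x \<partial>P p) \<le> e + K / 4 - \<epsilon>" using \<epsilon>[OF p] by simp
      show "(\<integral>\<^sup>+x. ennreal (w x) \<partial>P p) = ennreal (\<integral>x. w x \<partial>P p)"
        using w0 I by (intro nn_integral_eq_integral) (auto simp: w_def)
    qed
    have "(\<integral>\<^sup>+x. ennreal (w x) \<partial>Q) \<le> ennreal (e + K / 4 - \<epsilon>)"
      using lim w0 wP by (intro pmf_fatou[of P Q]) (auto intro: ennreal_leI)
    moreover have "(\<integral>\<^sup>+x. ennreal (w x) \<partial>Q) = ennreal (\<integral>x. w x \<partial>Q)"
      using w0 IQ by (intro nn_integral_eq_integral) (auto simp: w_def)
    ultimately have le: "ennreal (\<integral>x. w x \<partial>Q) \<le> ennreal (e + K / 4 - \<epsilon>)" by simp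
    have "0 \<le> (\<integral>x. w x \<partial>P 1)" using w0 by simp
    then have "0 \<le> e + K / 4 - \<epsilon>" using wP(1)[of 1] by simp
    then have "(\<integral>x. w x \<partial>Q) \<le> e + K / 4 - \<epsilon>" using le by (simp add: ennreal_le_iff)
    moreover have "(\<integral>x. w x \<partial>Q) = (\<integral>x. (g x)\<^sup>2 \<partial>Q) / K + K / 4 - (\<integral>x. g x \<partial>Q)"
      unfolding w_def using IQ by simp
    moreover have "0 \<le> (\<integral>x. (g x)\<^sup>2 \<partial>Q) / K" using K by simp
    ultimately show ?thesis by simp
  qed
  then show "\<epsilon> \<le> measure_pmf.expectation Q g" by (rule field_le_epsilon)
qed

text \<open>For negative \<open>x\<close> and y = - x, the remainder is at most y^2 exp y / 2. The
  arithmetic-geometric mean inequality with weight \<open>A\<close> splits this product, and y^2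
  \<le> 2 exp y turns the second part into exp (3 y). A large \<open>A\<close> makes the exponential
  term small at the expense of the quadratic one.\<close>

lemma exp_second_order:
  fixes x A :: real
  assumes "0 < A"
  shows "exp (- x) - 1 + x \<le> (1/2 + A/4) * x\<^sup>2 + exp (- 3 * x) / (2 * A)"
proof (cases "0 \<le> x")
  case True
  define f where "f x = exp (- x) - 1 + x - x\<^sup>2 / 2" for x :: real
  have "f x \<le> f 0"
  proof (rule DERIV_nonpos_imp_nonincreasing[OF True])
    fix y :: real
    have "(f has_real_derivative (- exp (- y) + 1 - y)) (at y)"
      unfolding f_def by (auto intro!: derivative_eq_intros)
    moreover have "- exp (- y) + 1 - y \<le> 0" using exp_ge_add_one_self[of "- y"] by linarith
    ultimately show "\<exists>z. (f has_real_derivative z) (at y) \<and> z \<le> 0" by blast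
  qed
  then have "exp (- x) - 1 + x \<le> x\<^sup>2 / 2" by (simp add: f_def)
  moreover have "0 \<le> A / 4 * x\<^sup>2" "0 \<le> exp (- 3 * x) / (2 * A)" using assms by auto
  ultimately show ?thesis unfolding distrib_right by linarith
next
  case False
  define y where "y = - x"
  have y: "0 < y" using False by (simp add: y_def)
  define f where "f u = exp u - 1 - u - u\<^sup>2 / 2 * exp u" for u :: real
  have "f y \<le> f 0"
  proof (rule DERIV_nonpos_imp_nonincreasing[of 0 y f])
    fix u :: real assume u: "0 \<le> u" "u \<le> y"
    have deriv: "(f has_real_derivative (exp u * (1 - u) - 1 - u\<^sup>2 / 2 * exp u)) (at u)"
      unfolding f_def by (auto intro!: derivative_eq_intros simp: algebra_simps)
    have "exp u * (1 - u) \<le> exp u * exp (- u)"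
      using exp_ge_add_one_self[of "- u"] by (intro mult_left_mono) auto
    then have "exp u * (1 - u) \<le> 1" by (simp flip: exp_add)
    moreover have "0 \<le> u\<^sup>2 / 2 * exp u" by simp
    ultimately have "exp u * (1 - u) - 1 - u\<^sup>2 / 2 * exp u \<le> 0" by linarith
    with deriv show "\<exists>z. (f has_real_derivative z) (at u) \<and> z \<le> 0" by blast
  qed (use y in simp)
  then have 1: "exp y - 1 - y \<le> y\<^sup>2 / 2 * exp y" by (simp add: f_def)
  have "0 \<le> (A * y - y * exp y)\<^sup>2" by simp
  then have "2 * A * (y\<^sup>2 * exp y) \<le> A\<^sup>2 * y\<^sup>2 + y\<^sup>2 * (exp y)\<^sup>2"
    by (simp add: power2_eq_square algebra_simps)
  moreover have "y\<^sup>2 * (exp y)\<^sup>2 \<le> 2 * exp y * (exp y)\<^sup>2"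
  proof -
    have "1 + y + y\<^sup>2 / 2 \<le> exp y" using y by (intro exp_lower_Taylor_quadratic) auto
    then have "y\<^sup>2 \<le> 2 * exp y" using y by linarith
    then show ?thesis by (intro mult_right_mono) auto
  qed
  moreover have "2 * exp y * (exp y)\<^sup>2 = 2 * exp (3 * y)"
    by (simp add: power2_eq_square flip: exp_add)
  ultimately have "2 * A * (y\<^sup>2 * exp y) \<le> A\<^sup>2 * y\<^sup>2 + 2 * exp (3 * y)"
    by linarith
  then have "(2 * A * (y\<^sup>2 * exp y)) / (4 * A) \<le> (A\<^sup>2 * y\<^sup>2 + 2 * exp (3 * y)) / (4 * A)"
    using assms by (intro divide_right_mono) auto
  then have "y\<^sup>2 / 2 * exp y \<le> A / 4 * y\<^sup>2 + exp (3 * y) / (2 * A)"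
    using assms by (simp add: add_divide_distrib power2_eq_square)
  moreover have "0 \<le> y\<^sup>2 / 2" by simp
  ultimately have "exp y - 1 - y \<le> (1/2 + A/4) * y\<^sup>2 + exp (3 * y) / (2 * A)"
    using 1 unfolding distrib_right by linarith
  then show ?thesis by (simp add: y_def)
qed

text \<open>For the lower bound, E X = 0 gives c \<le> E (exp (- X) - 1 + X), and by
  \<open>exp_second_order\<close> the right-hand side is at most a multiple of the variance of X
  plus c / 2.\<close>

theorem limit_variance_bounds:
  assumes a: "0 < a" "a < 1"
  obtains t0 D :: real where "0 < t0" "0 < D"
    and "\<And>t Q. t0 \<le> t \<Longrightarrow> (\<And>k. (\<lambda>p. pmf (current_pmf (p + sites a t) p t a a) k) \<longlonglongrightarrow> pmf Q k) \<Longrightarrow>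
      integrable Q (\<lambda>x. (real_of_int x)\<^sup>2) \<and>
      inverse D * t powr (2/3) \<le> measure_pmf.variance Q real_of_int \<and>
      measure_pmf.variance Q real_of_int \<le> D * t powr (2/3)"
proof -
  obtain t0 B c where t0: "1 \<le> t0" and B: "0 < B" and c: "0 < c"
    and exps: "\<And>t p s. t0 \<le> t \<Longrightarrow> 1 \<le> p \<Longrightarrow> s \<in> {1, 2, 3} \<Longrightarrow>
      laplace (current_pmf (p + sites a t) p t a a) (s / t powr (1/3)) (drift a t) \<le> ennreal B"
    and low: "\<And>t p. t0 \<le> t \<Longrightarrow> 1 \<le> p \<Longrightarrow>
      ennreal (1 + c) \<le> laplace (current_pmf (p + sites a t) p t a a) (1 / t powr (1/3)) (drift a t)"
    and sq: "\<And>t p. t0 \<le> t \<Longrightarrow> 1 \<le> p \<Longrightarrow>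
      (\<integral>\<^sup>+x. ennreal ((real_of_int x - drift a t)\<^sup>2) \<partial>current_pmf (p + sites a t) p t a a)
        \<le> ennreal (B * (t powr (1/3))\<^sup>2)"
    using stationary_current_estimates[OF a] by blast
  \<comment> \<open>The solution of c / 2 = (1/2 + A / 4) d for A = B / c, the choice that makes the
    exponential term of \<open>exp_second_order\<close> at most c / 2.\<close>
  define d where "d = (c / 2) / (1/2 + B / c / 4)"
  have d: "0 < d" using B c by (simp add: d_def add_pos_pos)
  define D where "D = max B (1 / d)"
  have D: "0 < D" "B \<le> D" "inverse D \<le> d"
  proof -
    show "0 < D" "B \<le> D" using B by (auto simp: D_def)
    have "1 / d \<le> D" by (simp add: D_def)
    then have "inverse D \<le> inverse (1 / d)" using d by (intro le_imp_inverse_le) auto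
    then show "inverse D \<le> d" by simp
  qed
  show thesis
  proof (rule that[of t0 D])
    show "0 < t0" "0 < D" using t0 D by auto
    fix t Q
    assume t: "t0 \<le> t" and lim: "\<And>k. (\<lambda>p. pmf (current_pmf (p + sites a t) p t a a) k) \<longlonglongrightarrow> pmf Q k"
    define P where "P p = current_pmf (p + sites a t) p t a a" for p
    note lim = lim[folded P_def]
    define r where "r = t powr (1/3)"
    define \<mu> where "\<mu> = drift a t"
    have tr: "0 < r" "r\<^sup>2 = t powr (2/3)" using t t0 by (simp_all add: r_def powr_power)
    note exps = exps[OF t, folded P_def r_def \<mu>_def] and low = low[OF t, folded P_def r_def \<mu>_def]
      and sq = sq[OF t, folded P_def r_def \<mu>_def]
    have mean: "integrable (P p) real_of_int" "(\<integral>x. real_of_int x \<partial>P p) = \<mu>" if "1 \<le> p" for p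
      using mean_current[of a "p + sites a t" p t] a that t t0 by (simp_all add: P_def \<mu>_def drift_def)
    have Br: "0 < B * r\<^sup>2" using B tr(1) by simp
    have sqQ: "(\<integral>\<^sup>+x. ennreal ((real_of_int x - \<mu>)\<^sup>2) \<partial>Q) \<le> ennreal (B * r\<^sup>2)"
      using lim sq by (intro pmf_fatou[of P Q]) auto
    note IQ = integrable_pmf_squareD[OF sqQ]
    \<comment> \<open>The limit keeps the mean: lower semicontinuity is applied to the centered
      current and to its negative.\<close>
    have "0 \<le> measure_pmf.expectation Q (\<lambda>x. real_of_int x - \<mu>)"
      using lim Br sq mean by (intro pmf_expectation_lower_limit(2)[of P Q "B * r\<^sup>2"]) auto
    moreover have "0 \<le> measure_pmf.expectation Q (\<lambda>x. - (real_of_int x - \<mu>))"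
      using lim Br sq mean by (intro pmf_expectation_lower_limit(2)[of P Q "B * r\<^sup>2"]) (auto simp: power2_commute)
    ultimately have E0: "measure_pmf.expectation Q (\<lambda>x. real_of_int x - \<mu>) = 0"
      by (simp only: Bochner_Integration.integral_minus)
    have Ix: "integrable Q real_of_int"
    proof -
      have "integrable Q (\<lambda>x. (real_of_int x - \<mu>) + \<mu>)"
        using IQ(2) by (intro Bochner_Integration.integrable_add) auto
      then show ?thesis by simp
    qed
    have E\<mu>: "measure_pmf.expectation Q real_of_int = \<mu>" using E0 Ix by simp
    define v where "v = measure_pmf.expectation Q (\<lambda>x. (real_of_int x - \<mu>)\<^sup>2)"
    have var: "measure_pmf.variance Q real_of_int = v" unfolding v_def E\<mu> ..
    have "ennreal v \<le> ennreal (B * r\<^sup>2)"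
      using sqQ nn_integral_eq_integral[OF IQ(1)] by (simp add: v_def)
    then have v_up: "v \<le> B * r\<^sup>2" using Br by simp
    define g where "g s x = exp (- (s / r) * (real_of_int x - \<mu>))" for s and x :: int
    have g2: "(g 1 x)\<^sup>2 = g 2 x" for x
      unfolding g_def exp_double[symmetric] by (intro arg_cong[of _ _ exp]) simp
    have gB: "(\<integral>\<^sup>+x. ennreal (g s x) \<partial>P p) \<le> ennreal B" if "1 \<le> p" "s \<in> {1, 2, 3}" for s p
      using exps[OF that] by (simp add: g_def)
    have g1: "1 + c \<le> measure_pmf.expectation (P p) (g 1)" if p: "1 \<le> p" for p
    proof -
      have I: "integrable (P p) (g 1)"
        using gB[OF p, of 1] by (intro integrableI_nonneg) (auto simp: g_def intro: le_less_trans)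
      have "ennreal (1 + c) \<le> ennreal (measure_pmf.expectation (P p) (g 1))"
        using low[OF p] nn_integral_eq_integral[OF I] by (simp add: g_def)
      then show ?thesis using c by (simp add: ennreal_le_iff2 del: ennreal_plus)
    qed
    have g1Q: "integrable Q (g 1)" "1 + c \<le> measure_pmf.expectation Q (g 1)"
      using pmf_expectation_lower_limit[of P Q B "g 1" "1 + c"] lim B gB[of _ 2] g1 by (auto simp: g2)
    have g3: "(\<integral>\<^sup>+x. ennreal (g 3 x) \<partial>Q) \<le> ennreal B"
      using lim gB[of _ 3] by (intro pmf_fatou[of P Q]) (auto simp: g_def)
    have I3: "integrable Q (g 3)" using g3 by (intro integrableI_nonneg) (auto simp: g_def intro: le_less_trans)
    have "ennreal (measure_pmf.expectation Q (g 3)) \<le> ennreal B"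
      using g3 nn_integral_eq_integral[OF I3] by (simp add: g_def)
    then have E3: "measure_pmf.expectation Q (g 3) \<le> B" using B by simp
    define A where "A = B / c"
    have A: "0 < A" using B c by (simp add: A_def)
    let ?lhs = "\<lambda>x. g 1 x - 1 + (real_of_int x - \<mu>) / r"
    let ?rhs = "\<lambda>x. (1/2 + A/4) / r\<^sup>2 * (real_of_int x - \<mu>)\<^sup>2 + g 3 x / (2 * A)"
    have "c \<le> measure_pmf.expectation Q (g 1) - 1" using g1Q by simp
    also have "\<dots> = measure_pmf.expectation Q ?lhs" using g1Q IQ E0 by simp
    also have "\<dots> \<le> measure_pmf.expectation Q ?rhs"
    proof (intro integral_mono)
      show "integrable Q ?lhs" using g1Q(1) IQ(2) by simp
      show "integrable Q ?rhs" using I3 IQ(1) by simp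
      fix x
      define z where "z = real_of_int x - \<mu>"
      have gz: "g s x = exp (- s * (z / r))" for s unfolding g_def z_def[symmetric] by simp
      show "?lhs x \<le> ?rhs x"
        using exp_second_order[OF A, of "z / r"] unfolding gz z_def[symmetric] by (simp add: power_divide)
    qed
    also have "\<dots> = (1/2 + A/4) / r\<^sup>2 * v + measure_pmf.expectation Q (g 3) / (2 * A)"
      using I3 IQ(1) by (simp add: v_def)
    also have "measure_pmf.expectation Q (g 3) / (2 * A) \<le> B / (2 * A)"
      using E3 A by (intro divide_right_mono) auto
    also have "B / (2 * A) = c / 2" using B c by (simp add: A_def)
    finally have "c / 2 \<le> (1/2 + A/4) / r\<^sup>2 * v" by simp
    then have "c / 2 * r\<^sup>2 \<le> (1/2 + A/4) / r\<^sup>2 * v * r\<^sup>2" by (intro mult_right_mono) auto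
    then have "c / 2 * r\<^sup>2 \<le> (1/2 + A/4) * v" using tr(1) by simp
    moreover have "c / 2 = (1/2 + A/4) * d"
    proof -
      have "0 < 1/2 + B / c / 4" using B c by (intro add_pos_pos) auto
      then have "1/2 + B / c / 4 \<noteq> 0" by (rule less_imp_neq[symmetric])
      then show ?thesis unfolding d_def A_def by (metis nonzero_mult_div_cancel_left times_divide_eq_right)
    qed
    ultimately have "(1/2 + A/4) * (d * r\<^sup>2) \<le> (1/2 + A/4) * v" by (simp only: mult.assoc)
    then have v_low: "d * r\<^sup>2 \<le> v" using A by (subst (asm) mult_le_cancel_left_pos) auto
    have "integrable Q (\<lambda>x. (real_of_int x)\<^sup>2)"
    proof -
      have "integrable Q (\<lambda>x. (real_of_int x - \<mu>)\<^sup>2 + 2 * \<mu> * (real_of_int x - \<mu>) + \<mu>\<^sup>2)"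
        using IQ by auto
      then show ?thesis by (simp add: power2_eq_square algebra_simps)
    qed
    moreover have "inverse D * r\<^sup>2 \<le> v"
      using mult_right_mono[OF D(3), of "r\<^sup>2"] v_low by simp
    moreover have "v \<le> D * r\<^sup>2"
      using mult_right_mono[OF D(2), of "r\<^sup>2"] v_up by simp
    ultimately show "integrable Q (\<lambda>x. (real_of_int x)\<^sup>2) \<and>
      inverse D * t powr (2/3) \<le> measure_pmf.variance Q real_of_int \<and>
      measure_pmf.variance Q real_of_int \<le> D * t powr (2/3)"
      unfolding var tr(2) by blast
  qed
qed

subsection \<open>The order of the rings of finitely many Poisson clocks\<close>

definition waiting_time :: "real measure" where
  "waiting_time = density lborel (\<lambda>x. ennreal (exponential_density 1 x))"

lemma prob_space_waiting_time: "prob_space waiting_time"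
  unfolding waiting_time_def by (rule prob_space_exponential_density) simp

lemma sets_waiting_time [measurable_cong]: "sets waiting_time = sets borel"
  by (simp add: waiting_time_def)

lemma space_waiting_time [simp]: "space waiting_time = UNIV"
  by (simp add: waiting_time_def)

lemma waiting_time_memoryless:
  assumes s: "0 \<le> s" and X [measurable]: "X \<in> sets borel"
  shows "emeasure waiting_time {z. s < z \<and> z - s \<in> X} = ennreal (exp (- s)) * emeasure waiting_time X"
proof -
  have "emeasure waiting_time {z. s < z \<and> z - s \<in> X} =
      (\<integral>\<^sup>+z. ennreal (exponential_density 1 z) * indicator {z. s < z \<and> z - s \<in> X} z \<partial>lborel)"
    unfolding waiting_time_def by (rule emeasure_density) auto
  also have "\<dots> = (\<integral>\<^sup>+z. ennreal (exponential_density 1 (s + 1 * z)) * indicator {z. s < z \<and> z - s \<in> X} (s + 1 * z) \<partial>lborel)"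
    by (subst nn_integral_real_affine[where c = 1 and t = s]) auto
  also have "\<dots> = (\<integral>\<^sup>+z. ennreal (exp (- s)) * (ennreal (exponential_density 1 z) * indicator X z) \<partial>lborel)"
  proof (rule nn_integral_cong_AE)
    show "AE z in lborel. ennreal (exponential_density 1 (s + 1 * z)) * indicator {z. s < z \<and> z - s \<in> X} (s + 1 * z) =
        ennreal (exp (- s)) * (ennreal (exponential_density 1 z) * indicator X z)"
      using AE_lborel_singleton[of 0]
    proof eventually_elim
      case (elim z)
      then show ?case
        using s by (cases "0 < z"; cases "z \<in> X")
          (auto simp: exponential_density_def mult_exp_exp algebra_simps simp flip: ennreal_mult)
    qed
  qed
  also have "\<dots> = ennreal (exp (- s)) * emeasure waiting_time X"
    by (simp add: nn_integral_cmult waiting_time_def emeasure_density)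
  finally show ?thesis .
qed

lemma waiting_time_greater:
  assumes "0 \<le> s"
  shows "emeasure waiting_time {s<..} = ennreal (exp (- s))"
proof -
  interpret prob_space waiting_time by (rule prob_space_waiting_time)
  show ?thesis
    using waiting_time_memoryless[OF assms, of UNIV] emeasure_space_1 by (simp add: greaterThan_def)
qed

definition clock_space :: "('i \<times> nat \<Rightarrow> real) measure" where
  "clock_space = Pi\<^sub>M UNIV (\<lambda>_. waiting_time)"

lemma sets_clock_space [measurable_cong]: "sets clock_space = sets (Pi\<^sub>M UNIV (\<lambda>_. borel))"
  unfolding clock_space_def by (intro sets_PiM_cong refl sets_waiting_time)

lemma space_clock_space [simp]: "space clock_space = UNIV"
  by (simp add: clock_space_def space_PiM)

text \<open>The clocks seen after time \<open>s\<close>, at which the clock of \<open>i\<close> is the first one to ring.\<close>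

definition residual :: "'i set \<Rightarrow> 'i \<Rightarrow> real \<Rightarrow> ('i \<times> nat \<Rightarrow> real) \<Rightarrow> 'i \<times> nat \<Rightarrow> real" where
  "residual S i s x q = (if fst q = i then x (i, Suc (snd q))
     else if snd q = 0 \<and> fst q \<in> S then x q - s else x q)"

text \<open>The recursion follows the first ring, so that the memoryless property applies:
  afterwards the residual clocks start afresh. The strict inequality excludes simultaneous first
  rings.\<close>

primrec rings_in_order :: "'i set \<Rightarrow> real \<Rightarrow> 'i list \<Rightarrow> ('i \<times> nat \<Rightarrow> real) \<Rightarrow> bool" where
  "rings_in_order S t [] x \<longleftrightarrow> (\<forall>j\<in>S. t < x (j, 0))"
| "rings_in_order S t (i # w) x \<longleftrightarrow> x (i, 0) \<le> t \<and> (\<forall>j\<in>S - {i}. x (i, 0) < x (j, 0)) \<and>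
     rings_in_order S (t - x (i, 0)) w (residual S i (x (i, 0)) x)"

lemma residual_fun_upd [simp]: "residual S i s (y((i, 0) := u)) = residual S i s y"
  by (auto simp: residual_def fun_eq_iff)

lemma measurable_residual [measurable]:
  "(\<lambda>z. residual S i (fst z) (snd z)) \<in> borel \<Otimes>\<^sub>M clock_space \<rightarrow>\<^sub>M clock_space"
proof -
  have "(\<lambda>z. residual S i (fst z) (snd z) q) \<in> borel_measurable (borel \<Otimes>\<^sub>M Pi\<^sub>M UNIV (\<lambda>_. borel))" for q
    unfolding residual_def by (cases "fst q = i"; cases "snd q = 0 \<and> fst q \<in> S") auto
  then have "(\<lambda>z. residual S i (fst z) (snd z)) \<in> borel \<Otimes>\<^sub>M Pi\<^sub>M UNIV (\<lambda>_. borel) \<rightarrow>\<^sub>M Pi\<^sub>M UNIV (\<lambda>_. borel)"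
    by (intro measurable_PiM_single') auto
  then show ?thesis by (simp cong: measurable_cong_sets add: sets_clock_space sets_pair_measure_cong[OF refl sets_clock_space])
qed

lemma measurable_clock [measurable]: "(\<lambda>x. x q) \<in> borel_measurable clock_space"
proof -
  have "(\<lambda>x. x q) \<in> borel_measurable (Pi\<^sub>M UNIV (\<lambda>_. borel))" by simp
  then show ?thesis by (simp cong: measurable_cong_sets add: sets_clock_space)
qed

text \<open>Measurability is joint in horizon and clocks because the recursion continues with the
  random horizon \<open>t - x (i, 0)\<close>.\<close>

lemma measurable_rings_in_order:
  assumes "finite S"
  shows "Measurable.pred (borel \<Otimes>\<^sub>M clock_space) (\<lambda>z. rings_in_order S (fst z) w (snd z))"
proof (induction w)
  case Nil
  show ?case using assms by simp
next
  case (Cons i w)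
  have m: "(\<lambda>z :: real \<times> _. (fst z - snd z (i, 0), residual S i (snd z (i, 0)) (snd z))) \<in> borel \<Otimes>\<^sub>M clock_space \<rightarrow>\<^sub>M borel \<Otimes>\<^sub>M clock_space"
  proof (intro measurable_Pair)
    have "(\<lambda>z. (snd z (i, 0), snd z)) \<in> (borel :: real measure) \<Otimes>\<^sub>M clock_space \<rightarrow>\<^sub>M borel \<Otimes>\<^sub>M clock_space" by measurable
    from measurable_compose[OF this measurable_residual[of S i]]
    show "(\<lambda>z. residual S i (snd z (i, 0)) (snd z)) \<in> (borel :: real measure) \<Otimes>\<^sub>M clock_space \<rightarrow>\<^sub>M clock_space" by simp
  qed measurable
  have [measurable]: "Measurable.pred (borel \<Otimes>\<^sub>M clock_space)
      (\<lambda>z. rings_in_order S (fst z - snd z (i, 0)) w (residual S i (snd z (i, 0)) (snd z)))"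
    using measurable_compose[OF m Cons.IH] by simp
  have [measurable]: "Measurable.pred (borel \<Otimes>\<^sub>M clock_space) (\<lambda>z :: real \<times> _. \<forall>j\<in>S - {i}. snd z (i, 0) < snd z (j, 0))"
    using assms by (intro pred_intros_finite) auto
  show ?case by simp
qed

lemma measurable_rings_in_order' [measurable]:
  assumes "finite S"
  shows "Measurable.pred clock_space (rings_in_order S t w)"
proof -
  have "(\<lambda>x. (t, x)) \<in> clock_space \<rightarrow>\<^sub>M borel \<Otimes>\<^sub>M clock_space" by simp
  from measurable_compose[OF this measurable_rings_in_order[OF assms, of w]] show ?thesis by simp
qed

text \<open>Memorylessness of all clocks at once: if \<open>i\<close> rings first, at time
  \<open>s\<close>, the residual clocks are fresh on the event that the other
  \<open>card S - 1\<close> clocks are silent up to \<open>s\<close>. The two measures are compared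
  on cylinder sets.\<close>

lemma distr_residual:
  fixes S :: "'i set"
  assumes S: "finite S" "i \<in> S" and s: "0 \<le> s" and B: "B \<in> sets clock_space"
  defines "P0 \<equiv> Pi\<^sub>M (UNIV - {(i, 0)}) (\<lambda>_. waiting_time)"
  shows "emeasure P0 {y\<in>space P0. (\<forall>j\<in>S - {i}. s < y (j, 0)) \<and> residual S i s y \<in> B} =
    ennreal (exp (- (real (card S) - 1) * s)) * emeasure clock_space B"
proof -
  interpret W: prob_space waiting_time by (rule prob_space_waiting_time)
  interpret PP: product_prob_space "\<lambda>_ :: 'i \<times> nat. waiting_time" UNIV by standard
  interpret PP0: product_prob_space "\<lambda>_ :: 'i \<times> nat. waiting_time" "UNIV - {(i, 0)}" by standard
  interpret CS: prob_space clock_space unfolding clock_space_def by (intro prob_space_PiM prob_space_waiting_time)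
  let ?c = "ennreal (exp (- (real (card S) - 1) * s))"
  define T where "T = (S - {i}) \<times> {0::nat}"
  define D where "D = {y\<in>space P0. \<forall>q\<in>T. s < y q}"
  have finT: "finite T" using S by (simp add: T_def)
  have comp: "(\<lambda>y. y q) \<in> borel_measurable P0" if "q \<noteq> (i, 0)" for q
  proof -
    have "(\<lambda>y. y q) \<in> P0 \<rightarrow>\<^sub>M waiting_time"
      unfolding P0_def using that by (intro measurable_component_singleton) auto
    then show ?thesis by (simp cong: measurable_cong_sets add: sets_waiting_time)
  qed
  have D: "D \<in> sets P0"
  proof -
    have "Measurable.pred P0 (\<lambda>y. \<forall>q\<in>T. s < y q)"
      using finT by (intro pred_intros_finite borel_measurable_pred_less comp) (auto simp: T_def)
    then show ?thesis unfolding D_def by simp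
  qed
  have res: "residual S i s \<in> P0 \<rightarrow>\<^sub>M clock_space"
  proof -
    have "(\<lambda>y. residual S i s y q) \<in> borel_measurable P0" for q
      by (cases "fst q = i"; cases "snd q = 0 \<and> fst q \<in> S")
        (auto simp: residual_def[abs_def] intro!: borel_measurable_diff comp)
    then have "residual S i s \<in> P0 \<rightarrow>\<^sub>M Pi\<^sub>M UNIV (\<lambda>_. borel)"
      by (intro measurable_PiM_single') auto
    then show ?thesis by (simp cong: measurable_cong_sets add: sets_clock_space)
  qed
  define N where "N = distr (density P0 (indicator D)) clock_space (residual S i s)"
  have N: "emeasure N B = emeasure P0 {y\<in>space P0. (\<forall>q\<in>T. s < y q) \<and> residual S i s y \<in> B}"
    if B: "B \<in> sets clock_space" for B
  proof -
    have m: "residual S i s -` B \<inter> space P0 \<in> sets P0" using res B by (rule measurable_sets)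
    have "emeasure N B = emeasure (density P0 (indicator D)) (residual S i s -` B \<inter> space P0)"
      unfolding N_def using res B by (subst emeasure_distr) auto
    also have "\<dots> = (\<integral>\<^sup>+y. indicator D y * indicator (residual S i s -` B \<inter> space P0) y \<partial>P0)"
      using m D by (intro emeasure_density) auto
    also have "\<dots> = (\<integral>\<^sup>+y. indicator (D \<inter> (residual S i s -` B \<inter> space P0)) y \<partial>P0)"
      by (simp only: indicator_inter_arith)
    also have "\<dots> = emeasure P0 (D \<inter> (residual S i s -` B \<inter> space P0))"
      using m D by (intro nn_integral_indicator) auto
    also have "D \<inter> (residual S i s -` B \<inter> space P0) = {y\<in>space P0. (\<forall>q\<in>T. s < y q) \<and> residual S i s y \<in> B}"
      by (auto simp: D_def)
    finally show ?thesis .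
  qed
  have "scale_measure ?c clock_space = N"
  proof (rule measure_eqI_PiM_infinite[where I = UNIV and M = "\<lambda>_. waiting_time"])
    show "sets (scale_measure ?c clock_space) = sets (Pi\<^sub>M UNIV (\<lambda>_. waiting_time))" by (simp add: clock_space_def)
    show "sets N = sets (Pi\<^sub>M UNIV (\<lambda>_. waiting_time))" by (simp add: clock_space_def N_def)
    show "finite_measure (scale_measure ?c clock_space)"
      using CS.emeasure_space_1 by (intro finite_measureI) (simp add: space_scale_measure ennreal_mult_eq_top_iff)
    fix A :: "'i \<times> nat \<Rightarrow> real set" and J :: "('i \<times> nat) set"
    assume J: "finite J" and A: "\<And>q. q \<in> J \<Longrightarrow> A q \<in> sets waiting_time"
    define A' where "A' q = (if q \<in> J then A q else UNIV)" for q
    have A': "A' q \<in> sets borel" for q using A[of q] by (auto simp: A'_def sets_waiting_time)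
    let ?E = "prod_emb UNIV (\<lambda>_. waiting_time) J (Pi\<^sub>E J A)"
    have E: "?E = {x. \<forall>q\<in>J. x q \<in> A q}"
      by (auto simp: prod_emb_def PiE_iff)
    have E': "?E \<in> sets clock_space"
      unfolding clock_space_def using J A by (intro sets_PiM_I) auto
    \<comment> \<open>\<open>\<sigma> q\<close> is the clock from which entry \<open>q\<close> of
      the residual clocks is read; it is never (i, 0), the coordinate missing in \<open>P0\<close>.
      The sets \<open>X\<close> are the preimages of the sides of the cylinder, together with
      survival up to \<open>s\<close>.\<close>
    define \<sigma> where "\<sigma> q = (if fst q = i then (i, Suc (snd q)) else q)" for q :: "'i \<times> nat"
    define X where "X q = (if fst q = i then A' (i, snd q - 1)
        else if q \<in> T then {z. s < z \<and> z - s \<in> A' q} else A' q)" for q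
    define J' where "J' = J \<union> T"
    have J': "finite J'" using J finT by (simp add: J'_def)
    have inj: "inj_on \<sigma> J'" by (auto simp: \<sigma>_def inj_on_def split: if_splits)
    have \<sigma>: "\<sigma> q \<noteq> (i, 0)" for q by (cases q) (auto simp: \<sigma>_def)
    have Xs: "X q \<in> sets borel" for q
    proof -
      have [measurable]: "A' q \<in> sets borel" by (rule A')
      have "{z. s < z \<and> z - s \<in> A' q} \<in> sets borel" by measurable
      then show ?thesis using A' by (auto simp: X_def)
    qed
    have ev: "{y\<in>space P0. (\<forall>q\<in>T. s < y q) \<and> residual S i s y \<in> ?E} = {y\<in>space P0. \<forall>k\<in>\<sigma> ` J'. y k \<in> X k}"
    proof (intro Collect_cong conj_cong refl)
      fix y
      have T: "q \<in> T \<longleftrightarrow> fst q \<noteq> i \<and> snd q = 0 \<and> fst q \<in> S" for q by (cases q) (auto simp: T_def)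
      have "((\<forall>q\<in>T. s < y q) \<and> residual S i s y \<in> ?E) \<longleftrightarrow> (\<forall>q\<in>J'. (q \<in> T \<longrightarrow> s < y q) \<and> residual S i s y q \<in> A' q)"
        unfolding E J'_def A'_def by auto
      also have "\<dots> \<longleftrightarrow> (\<forall>q\<in>J'. y (\<sigma> q) \<in> X (\<sigma> q))"
      proof (intro ball_cong refl)
        fix q :: "'i \<times> nat"
        show "((q \<in> T \<longrightarrow> s < y q) \<and> residual S i s y q \<in> A' q) = (y (\<sigma> q) \<in> X (\<sigma> q))"
          by (cases q) (auto simp: T residual_def \<sigma>_def X_def)
      qed
      finally show "((\<forall>q\<in>T. s < y q) \<and> residual S i s y \<in> ?E) \<longleftrightarrow> (\<forall>k\<in>\<sigma> ` J'. y k \<in> X k)" by simp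
    qed
    have "emeasure N ?E = emeasure P0 {y\<in>space P0. \<forall>k\<in>\<sigma> ` J'. y k \<in> X k}"
      by (simp add: N[OF E'] ev)
    also have "\<dots> = (\<Prod>k\<in>\<sigma> ` J'. emeasure waiting_time (X k))"
    proof -
      have "\<sigma> ` J' \<subseteq> UNIV - {(i, 0)}"
      proof
        fix k assume "k \<in> \<sigma> ` J'"
        then obtain q where "k = \<sigma> q" by blast
        then show "k \<in> UNIV - {(i, 0)}" using \<sigma>[of q] by simp
      qed
      then show ?thesis
        unfolding P0_def using J' Xs by (intro PP0.emeasure_PiM_Collect) (auto simp: sets_waiting_time)
    qed
    also have "\<dots> = (\<Prod>q\<in>J'. emeasure waiting_time (X (\<sigma> q)))"
      using inj by (rule prod.reindex_cong) auto
    also have "\<dots> = (\<Prod>q\<in>J'. (if q \<in> T then ennreal (exp (- s)) else 1) * emeasure waiting_time (A' q))"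
    proof (intro prod.cong refl)
      fix q :: "'i \<times> nat"
      show "emeasure waiting_time (X (\<sigma> q)) = (if q \<in> T then ennreal (exp (- s)) else 1) * emeasure waiting_time (A' q)"
        using waiting_time_memoryless[OF s A', of q] by (cases q) (auto simp: X_def \<sigma>_def T_def)
    qed
    also have "\<dots> = (\<Prod>q\<in>J'. if q \<in> T then ennreal (exp (- s)) else 1) * (\<Prod>q\<in>J'. emeasure waiting_time (A' q))"
      by (rule prod.distrib)
    also have "(\<Prod>q\<in>J'. if q \<in> T then ennreal (exp (- s)) else 1) = (\<Prod>q\<in>T. ennreal (exp (- s)))"
      using J' by (intro prod.mono_neutral_cong_right) (auto simp: J'_def)
    also have "\<dots> = ?c"
    proof -
      have "card T = card S - 1" "1 \<le> card S" using S by (auto simp: T_def card_Diff_singleton card_gt_0_iff Suc_le_eq)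
      then have "real (card S) - 1 = real (card T)" by simp
      then show ?thesis by (simp only: prod_constant) (simp add: ennreal_power exp_of_nat_mult[symmetric])
    qed
    also have "(\<Prod>q\<in>J'. emeasure waiting_time (A' q)) = (\<Prod>q\<in>J. emeasure waiting_time (A q))"
      using J' W.emeasure_space_1 by (intro prod.mono_neutral_cong_right) (auto simp: J'_def A'_def)
    also have "\<dots> = emeasure clock_space ?E"
      unfolding clock_space_def using J A by (intro PP.emeasure_PiM_emb[symmetric]) auto
    finally show "emeasure (scale_measure ?c clock_space) ?E = emeasure N ?E" by simp
  qed
  then have "emeasure N B = ?c * emeasure clock_space B" by (metis emeasure_scale_measure)
  moreover have "(\<forall>q\<in>T. s < y q) \<longleftrightarrow> (\<forall>j\<in>S - {i}. s < y (j, 0))" for y by (auto simp: T_def)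
  ultimately show ?thesis using N[OF B] by simp
qed

text \<open>Integrate over the time s of the first ring. With L = card S the exponential factors
  combine to exp (- L t) and leave (t - s)^k / k!, so the result is the volume of a simplex. In
  particular all words of a given length are equally likely.\<close>

theorem prob_rings_in_order:
  fixes S :: "'i set"
  assumes S: "finite S" and w: "set w \<subseteq> S" and t: "0 \<le> t"
  shows "emeasure clock_space {x. rings_in_order S t w x} =
    ennreal (exp (- real (card S) * t) * t ^ length w / fact (length w))"
  using w t
proof (induction w arbitrary: t)
  case Nil
  interpret W: prob_space waiting_time by (rule prob_space_waiting_time)
  interpret PP: product_prob_space "\<lambda>_ :: 'i \<times> nat. waiting_time" UNIV by standard
  have "{x. rings_in_order S t [] x} = {x\<in>space (Pi\<^sub>M UNIV (\<lambda>_. waiting_time)). \<forall>q\<in>S \<times> {0}. x q \<in> {t<..}}"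
    by (auto simp: space_PiM)
  also have "emeasure clock_space \<dots> = (\<Prod>q\<in>S \<times> {0::nat}. emeasure waiting_time {t<..})"
    unfolding clock_space_def using S by (intro PP.emeasure_PiM_Collect) (auto simp: sets_waiting_time)
  also have "\<dots> = ennreal (exp (- real (card S) * t))"
    using Nil by (simp add: waiting_time_greater card_cartesian_product ennreal_power exp_of_nat_mult[symmetric])
  finally show ?case by simp
next
  case (Cons i w)
  let ?L = "real (card S)" and ?k = "length w"
  define P0 where "P0 = Pi\<^sub>M (UNIV - {(i, 0 :: nat)}) (\<lambda>_. waiting_time)"
  interpret P0: prob_space P0 unfolding P0_def by (intro prob_space_PiM prob_space_waiting_time)
  have i: "i \<in> S" using Cons.prems by simp
  have ins: "insert (i, 0) (UNIV - {(i, 0)}) = (UNIV :: ('i \<times> nat) set)" by auto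
  have CS: "clock_space = distr (waiting_time \<Otimes>\<^sub>M P0) clock_space (\<lambda>(s, y). y((i, 0) := s))"
    using distr_pair_PiM_eq_PiM[of "UNIV - {(i, 0 :: nat)}" "\<lambda>_. waiting_time" "(i, 0)"] prob_space_waiting_time
    unfolding ins clock_space_def P0_def by simp
  have upd: "(\<lambda>(s, y). y((i, 0) := s)) \<in> waiting_time \<Otimes>\<^sub>M P0 \<rightarrow>\<^sub>M clock_space"
  proof -
    have "(\<lambda>z. (snd z)((i, 0) := fst z)) \<in> waiting_time \<Otimes>\<^sub>M P0 \<rightarrow>\<^sub>M Pi\<^sub>M UNIV (\<lambda>_. waiting_time)"
      unfolding P0_def by (rule measurable_fun_upd[where J = "UNIV - {(i, 0)}"]) auto
    then show ?thesis by (simp add: clock_space_def case_prod_unfold)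
  qed
  define G where "G = {x. rings_in_order S t (i # w) x}"
  have G: "G \<in> sets clock_space"
    using measurable_rings_in_order'[OF S, of t "i # w"] unfolding G_def by (simp add: pred_def del: rings_in_order.simps)
  have sec: "emeasure P0 {y\<in>space P0. y((i, 0) := s) \<in> G} =
      ennreal (exp (- (?L - 1) * s) * (exp (- ?L * (t - s)) * (t - s) ^ ?k / fact ?k)) * indicator {0..t} s"
    if s: "0 \<le> s" for s
  proof (cases "s \<le> t")
    case True
    have "{y\<in>space P0. y((i, 0) := s) \<in> G} =
        {y\<in>space P0. (\<forall>j\<in>S - {i}. s < y (j, 0)) \<and> residual S i s y \<in> {x. rings_in_order S (t - s) w x}}"
      using True by (auto simp: G_def)
    also have "emeasure P0 \<dots> = ennreal (exp (- (?L - 1) * s)) * emeasure clock_space {x. rings_in_order S (t - s) w x}"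
      unfolding P0_def using measurable_rings_in_order'[OF S, of "t - s" w]
      by (intro distr_residual S i s) (simp add: pred_def)
    also have "emeasure clock_space {x. rings_in_order S (t - s) w x} = ennreal (exp (- ?L * (t - s)) * (t - s) ^ ?k / fact ?k)"
      using Cons.prems True by (intro Cons.IH) auto
    also have "ennreal (exp (- (?L - 1) * s)) * ennreal (exp (- ?L * (t - s)) * (t - s) ^ ?k / fact ?k) =
        ennreal (exp (- (?L - 1) * s) * (exp (- ?L * (t - s)) * (t - s) ^ ?k / fact ?k)) * indicator {0..t} s"
      using s True by (simp add: ennreal_mult[symmetric])
    finally show ?thesis .
  next
    case False
    then have e: "{y\<in>space P0. y((i, 0) := s) \<in> G} = {}" by (auto simp: G_def)
    show ?thesis unfolding e using False by simp
  qed
  have "emeasure clock_space G = emeasure (waiting_time \<Otimes>\<^sub>M P0) ((\<lambda>(s, y). y((i, 0) := s)) -` G \<inter> space (waiting_time \<Otimes>\<^sub>M P0))"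
    using upd G by (subst CS) (rule emeasure_distr)
  also have "\<dots> = (\<integral>\<^sup>+s. emeasure P0 (Pair s -` ((\<lambda>(s, y). y((i, 0) := s)) -` G \<inter> space (waiting_time \<Otimes>\<^sub>M P0))) \<partial>waiting_time)"
    using upd G by (intro P0.emeasure_pair_measure_alt measurable_sets)
  also have "\<dots> = (\<integral>\<^sup>+s. emeasure P0 {y\<in>space P0. y((i, 0) := s) \<in> G} \<partial>waiting_time)"
    by (intro nn_integral_cong arg_cong[where f = "emeasure P0"]) (auto simp: space_pair_measure)
  also have "\<dots> = (\<integral>\<^sup>+s. ennreal (exponential_density 1 s) * emeasure P0 {y\<in>space P0. y((i, 0) := s) \<in> G} \<partial>lborel)"
    unfolding waiting_time_def
  proof (rule nn_integral_density)
    have "(\<lambda>s. emeasure P0 (Pair s -` ((\<lambda>(s, y). y((i, 0) := s)) -` G \<inter> space (waiting_time \<Otimes>\<^sub>M P0)))) \<in> borel_measurable waiting_time"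
      using upd G by (intro P0.measurable_emeasure_Pair measurable_sets)
    also have "(\<lambda>s. emeasure P0 (Pair s -` ((\<lambda>(s, y). y((i, 0) := s)) -` G \<inter> space (waiting_time \<Otimes>\<^sub>M P0)))) =
        (\<lambda>s. emeasure P0 {y\<in>space P0. y((i, 0) := s) \<in> G})"
      by (intro ext arg_cong[where f = "emeasure P0"]) (auto simp: space_pair_measure)
    finally show "(\<lambda>s. emeasure P0 {y\<in>space P0. y((i, 0) := s) \<in> G}) \<in> borel_measurable lborel"
      by (simp cong: measurable_cong_sets add: sets_waiting_time)
  qed simp
  also have "\<dots> = (\<integral>\<^sup>+s. ennreal (exp (- ?L * t) * ((t - s) ^ ?k / fact ?k)) * indicator {0..t} s \<partial>lborel)"
  proof (intro nn_integral_cong)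
    fix s :: real
    show "ennreal (exponential_density 1 s) * emeasure P0 {y\<in>space P0. y((i, 0) := s) \<in> G} =
        ennreal (exp (- ?L * t) * ((t - s) ^ ?k / fact ?k)) * indicator {0..t} s"
    proof (cases "0 \<le> s \<and> s \<le> t")
      case True
      have "exp (- s) * (exp (- (?L - 1) * s) * (exp (- ?L * (t - s)) * (t - s) ^ ?k / fact ?k)) =
          exp (- ?L * t) * ((t - s) ^ ?k / fact ?k)"
      proof -
        have "exp (- s) * (exp (- (?L - 1) * s) * exp (- ?L * (t - s))) = exp (- ?L * t)"
          unfolding exp_add[symmetric] by (simp add: algebra_simps)
        then show ?thesis by (simp add: mult.assoc[symmetric])
      qed
      then show ?thesis using True sec[of s] by (simp add: exponential_density_def flip: ennreal_mult)
    next
      case False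
      then show ?thesis using sec[of s] by (auto simp: exponential_density_def)
    qed
  qed
  also have "\<dots> = ennreal ((- (exp (- ?L * t) * ((t - t) ^ Suc ?k / fact (Suc ?k)))) - (- (exp (- ?L * t) * ((t - 0) ^ Suc ?k / fact (Suc ?k)))))"
  proof (rule nn_integral_FTC_Icc)
    fix s assume s: "s \<in> {0..t}"
    show "((\<lambda>s. - (exp (- ?L * t) * ((t - s) ^ Suc ?k / fact (Suc ?k)))) has_real_derivative
        exp (- ?L * t) * ((t - s) ^ ?k / fact ?k)) (at s)"
      by (auto intro!: derivative_eq_intros simp del: power_Suc fact_Suc) (simp add: divide_simps)
    show "0 \<le> exp (- ?L * t) * ((t - s) ^ ?k / fact ?k)" using s by simp
  qed (use Cons.prems in auto)
  finally show ?case unfolding G_def by (simp del: rings_in_order.simps)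
qed

subsection \<open>Graphical construction\<close>

lemma ex_nat_cases: "(\<exists>n. P n) \<longleftrightarrow> P 0 \<or> (\<exists>n. P (Suc n))"
  by (metis not0_implies_Suc)

text \<open>Converts the recursive order into increasing times that carry the letters of
  \<open>w\<close>, the form in which a trajectory can be followed. Time \<open>s 0 = 0\<close> is
  the start and not a ring.\<close>

lemma ring_times_in_order:
  fixes c :: "'i \<times> nat \<Rightarrow> real"
  assumes "rings_in_order S t w c" "set w \<subseteq> S" "\<And>i n. i \<in> S \<Longrightarrow> 0 < c (i, n)" "0 \<le> t"
  shows "\<exists>s :: nat \<Rightarrow> real. s 0 = 0 \<and> (\<forall>l<length w. s l < s (Suc l)) \<and> (\<forall>l\<le>length w. s l \<le> t) \<and>
    (\<forall>i\<in>S. {r. r \<le> t \<and> (\<exists>n. r = (\<Sum>k\<le>n. c (i, k)))} = {s (Suc l) |l. l < length w \<and> w ! l = i})"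
  using assms
proof (induction w arbitrary: t c)
  case Nil
  have "t < (\<Sum>k\<le>n. c (i, k))" if "i \<in> S" for i n
  proof -
    have "c (i, 0) \<le> (\<Sum>k\<le>n. c (i, k))"
      using Nil.prems(3)[OF that] by (intro member_le_sum) (auto intro: less_imp_le)
    then show ?thesis using Nil.prems(1) that by fastforce
  qed
  then have "{r. r \<le> t \<and> (\<exists>n. r = (\<Sum>k\<le>n. c (i, k)))} = {}" if "i \<in> S" for i
    using that by (auto simp: not_le)
  then show ?case using Nil.prems(4) by (intro exI[of _ "\<lambda>_. 0"]) auto
next
  case (Cons i w)
  define u where "u = c (i, 0)"
  define c' where "c' = residual S i u c"
  have i: "i \<in> S" and u: "0 < u" "u \<le> t" and first: "\<And>j. j \<in> S \<Longrightarrow> j \<noteq> i \<Longrightarrow> u < c (j, 0)"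
    using Cons.prems by (auto simp: u_def)
  have "rings_in_order S (t - u) w c'" using Cons.prems(1) by (simp add: u_def c'_def)
  moreover have "set w \<subseteq> S" using Cons.prems by simp
  moreover have c'_pos: "0 < c' (j, n)" if "j \<in> S" for j n
    using Cons.prems(3)[OF that, of n] Cons.prems(3)[OF i, of "Suc n"] first[OF that]
    by (auto simp: c'_def residual_def)
  ultimately have "\<exists>s. s 0 = 0 \<and> (\<forall>l<length w. s l < s (Suc l)) \<and> (\<forall>l\<le>length w. s l \<le> t - u) \<and>
    (\<forall>i\<in>S. {r. r \<le> t - u \<and> (\<exists>n. r = (\<Sum>k\<le>n. c' (i, k)))} = {s (Suc l) |l. l < length w \<and> w ! l = i})"
    using u by (intro Cons.IH) auto
  then obtain s where s': "s 0 = 0" "\<forall>l<length w. s l < s (Suc l)" "\<forall>l\<le>length w. s l \<le> t - u"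
    "\<forall>i\<in>S. {r. r \<le> t - u \<and> (\<exists>n. r = (\<Sum>k\<le>n. c' (i, k)))} = {s (Suc l) |l. l < length w \<and> w ! l = i}"
    by (elim exE conjE)
  note s = s'(1) s'(2-4)[rule_format]
  \<comment> \<open>The times of the residual clocks count from \<open>u\<close>; they are shifted
    back, and the first ring appears at index 1 because \<open>s 0 = 0\<close>.\<close>
  define s' where "s' l = (case l of 0 \<Rightarrow> 0 | Suc l \<Rightarrow> u + s l)" for l
  have sum_other: "(\<Sum>k\<le>n. c (j, k)) = u + (\<Sum>k\<le>n. c' (j, k))" if "j \<in> S" "j \<noteq> i" for j n
  proof (induction n)
    case 0
    then show ?case using that by (simp add: c'_def residual_def)
  next
    case (Suc n)
    then show ?case using that by (simp add: c'_def residual_def)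
  qed
  have sum_same: "(\<Sum>k\<le>Suc n. c (i, k)) = u + (\<Sum>k\<le>n. c' (i, k))" for n
    by (induction n) (simp_all add: c'_def residual_def u_def)
  have "{r. r \<le> t \<and> (\<exists>n. r = (\<Sum>k\<le>n. c (j, k)))} = {s' (Suc l) |l. l < length (i # w) \<and> (i # w) ! l = j}"
    if j: "j \<in> S" for j
  proof -
    have img: "{s' (Suc l) |l. l < length (i # w) \<and> (i # w) ! l = j} =
        (if j = i then {u} else {}) \<union> (\<lambda>r. u + r) ` {s (Suc l) |l. l < length w \<and> w ! l = j}"
    proof -
      have "(\<exists>l. r = s' (Suc l) \<and> l < length (i # w) \<and> (i # w) ! l = j) \<longleftrightarrow>
          (j = i \<and> r = u) \<or> (\<exists>l. r = u + s (Suc l) \<and> l < length w \<and> w ! l = j)" for r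
        using s(1) by (subst ex_nat_cases) (auto simp: s'_def)
      then show ?thesis by auto
    qed
    show ?thesis
    proof (cases "j = i")
      case True
      have "(r \<le> t \<and> (\<exists>n. r = (\<Sum>k\<le>n. c (i, k)))) \<longleftrightarrow> r = u \<or> (r - u \<le> t - u \<and> (\<exists>n. r - u = (\<Sum>k\<le>n. c' (i, k))))" for r
      proof -
        have "(\<exists>n. r = (\<Sum>k\<le>n. c (i, k))) \<longleftrightarrow> r = u \<or> (\<exists>n. r = (\<Sum>k\<le>Suc n. c (i, k)))"
          unfolding ex_nat_cases[of "\<lambda>n. r = (\<Sum>k\<le>n. c (i, k))"] by (simp add: u_def)
        then show ?thesis unfolding sum_same using u by (auto simp: algebra_simps)
      qed
      moreover have "r \<in> (\<lambda>r. u + r) ` Z \<longleftrightarrow> r - u \<in> Z" for r Z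
        by (auto simp: image_iff intro!: bexI[of _ "r - u"])
      ultimately have "{r. r \<le> t \<and> (\<exists>n. r = (\<Sum>k\<le>n. c (i, k)))} = {u} \<union> (\<lambda>r. u + r) ` {r. r \<le> t - u \<and> (\<exists>n. r = (\<Sum>k\<le>n. c' (i, k)))}"
        by (intro set_eqI) (simp only: Un_iff mem_Collect_eq singleton_iff)
      then show ?thesis unfolding img using True s(4)[OF j] by simp
    next
      case False
      then have "{r. r \<le> t \<and> (\<exists>n. r = (\<Sum>k\<le>n. c (j, k)))} = (\<lambda>r. u + r) ` {r. r \<le> t - u \<and> (\<exists>n. r = (\<Sum>k\<le>n. c' (j, k)))}"
        by (auto simp: image_iff sum_other[OF j])
      then show ?thesis unfolding img using False s(4)[OF j] by simp
    qed
  qed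
  moreover have "s' l < s' (Suc l)" if "l < length (i # w)" for l
    using that s(1,2) u by (cases l) (auto simp: s'_def)
  moreover have "s' l \<le> t" if "l \<le> length (i # w)" for l
    using that s(3)[of "l - 1"] u by (cases l) (auto simp: s'_def)
  ultimately show ?case by (intro exI[of _ s']) (auto simp: s'_def)
qed

lemma jumps_eq_card_times:
  assumes "\<And>n. 0 < \<tau> i n x"
  shows "jumps \<tau> \<omega> i u x =
    card {r. r \<le> u \<and> (\<exists>n. r = ring \<tau> i n x) \<and> (\<forall>\<^sub>F s in at_left r. 0 < \<omega> i s x)}"
proof -
  have mono: "strict_mono (\<lambda>n. ring \<tau> i n x)"
    using assms by (simp add: strict_mono_Suc_iff ring_def)
  have "inj_on (\<lambda>n. ring \<tau> i n x) A" for A using strict_mono_eq[OF mono] by (auto simp: inj_on_def)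
  then have "jumps \<tau> \<omega> i u x = card ((\<lambda>n. ring \<tau> i n x) ` {n. ring \<tau> i n x \<le> u \<and> (\<forall>\<^sub>F s in at_left (ring \<tau> i n x). 0 < \<omega> i s x)})"
    unfolding jumps_def by (rule card_image[symmetric])
  also have "(\<lambda>n. ring \<tau> i n x) ` {n. ring \<tau> i n x \<le> u \<and> (\<forall>\<^sub>F s in at_left (ring \<tau> i n x). 0 < \<omega> i s x)} =
      {r. r \<le> u \<and> (\<exists>n. r = ring \<tau> i n x) \<and> (\<forall>\<^sub>F s in at_left r. 0 < \<omega> i s x)}" by auto
  finally show ?thesis .
qed

text \<open>Sites are indexed by \<open>i - p\<close>.  A site whose clock is silent up to time \<open>t\<close> screens off
  everything to its left.\<close>

theorem height_eq_run:
  fixes \<tau> :: "int \<Rightarrow> nat \<Rightarrow> 'a \<Rightarrow> real" and \<omega> :: "int \<Rightarrow> real \<Rightarrow> 'a \<Rightarrow> nat" and h :: "int \<Rightarrow> real \<Rightarrow> 'a \<Rightarrow> int"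
  defines "site \<equiv> \<lambda>p i :: nat. int i - int p"
  assumes pos: "\<And>i n. 0 < \<tau> i n x"
    and occ: "\<And>i u. 0 \<le> u \<Longrightarrow> int (\<omega> i u x) = int (\<omega> i 0 x) + int (jumps \<tau> \<omega> (i - 1) u x) - int (jumps \<tau> \<omega> i u x)"
    and ini: "\<And>i. h (i - 1) 0 x - h i 0 x = int (\<omega> i 0 x)"
    and hev: "\<And>i u. 0 \<le> u \<Longrightarrow> h i u x = h i 0 x + int (jumps \<tau> \<omega> i u x)"
    and t: "0 \<le> t"
    and ord: "rings_in_order {0..n} t (map fst ls) (\<lambda>q. \<tau> (site p (fst q)) (snd q) x)"
    and letters: "\<And>l. l \<in> set ls \<Longrightarrow> fst l \<le> n"
    and m: "1 \<le> m" "m \<le> n" "m \<notin> fst ` set ls"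
  shows "h (site p n) t x = run ls (\<lambda>i. h (site p i) 0 x) n"
proof -
  let ?w = "map fst ls"
  define R where "R i = {r. \<exists>k. r = ring \<tau> (site p i) k x}" for i
  define Jset where "Jset i u = {r. r \<le> u \<and> r \<in> R i \<and> (\<forall>\<^sub>F s in at_left r. 0 < \<omega> (site p i) s x)}" for i u
  define H where "H l = run (take l ls) (\<lambda>i. h (site p i) 0 x)" for l
  have "set ?w \<subseteq> {0..n}" using letters by auto
  from ring_times_in_order[OF ord this _ t] pos obtain s where s: "s 0 = 0"
    "\<And>l. l < length ls \<Longrightarrow> s l < s (Suc l)" "\<And>l. l \<le> length ls \<Longrightarrow> s l \<le> t"
    and R_raw: "\<And>i. i \<in> {0..n} \<Longrightarrow> {r. r \<le> t \<and> (\<exists>k. r = (\<Sum>j\<le>k. \<tau> (site p i) j x))} = {s (Suc l) |l. l < length ls \<and> ?w ! l = i}"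
    by auto
  have R: "r \<in> R i \<longleftrightarrow> (\<exists>l<length ls. r = s (Suc l) \<and> fst (ls ! l) = i)" if "i \<le> n" "r \<le> t" for i r
  proof -
    have "(r \<le> t \<and> (\<exists>k. r = (\<Sum>j\<le>k. \<tau> (site p i) j x))) \<longleftrightarrow> (\<exists>l. r = s (Suc l) \<and> l < length ls \<and> ?w ! l = i)"
      using eqset_imp_iff[OF R_raw, of i r] that(1) by (simp only: mem_Collect_eq atLeastAtMost_iff zero_le simp_thms)
    also have "\<dots> \<longleftrightarrow> (\<exists>l<length ls. r = s (Suc l) \<and> fst (ls ! l) = i)"
      by (intro iff_exI) (auto simp: conj_ac)
    finally show ?thesis using that(2) by (simp add: R_def ring_def)
  qed
  have jumps: "jumps \<tau> \<omega> (site p i) u x = card (Jset i u)" for i u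
    unfolding Jset_def R_def by (subst jumps_eq_card_times) (auto simp: pos)
  have mono: "s l < s l'" if "l < l'" "l' \<le> length ls" for l l'
    using that
  proof (induction l')
    case (Suc k)
    have "s k < s (Suc k)" using Suc.prems by (intro s(2)) simp
    moreover have "s l \<le> s k" using Suc by (cases "l = k") auto
    ultimately show ?case by simp
  qed simp
  have s_le_iff: "s l \<le> s l' \<longleftrightarrow> l \<le> l'" if "l \<le> length ls" "l' \<le> length ls" for l l'
    using mono[of l l'] mono[of l' l] that by (metis less_le_not_le linorder_not_less order_refl le_eq_less_or_eq)
  have gap: "int (\<omega> (site p (Suc i)) u x) = h (site p i) u x - h (site p (Suc i)) u x" if "0 \<le> u" for i u
    using occ[OF that, of "site p (Suc i)"] ini[of "site p (Suc i)"] hev[OF that, of "site p i"] hev[OF that, of "site p (Suc i)"]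
    by (simp add: site_def algebra_simps)
  have finite_J: "finite (Jset i u)" if "i \<le> n" "u \<le> t" for i u
  proof (rule finite_subset)
    show "Jset i u \<subseteq> (\<lambda>l. s (Suc l)) ` {..<length ls}"
      using that R by (fastforce simp: Jset_def)
  qed simp
  \<comment> \<open>From the \<open>l\<close>-th ring until the next one, the heights are those
    after \<open>l\<close> letters. The claim covers the indices from \<open>m\<close> on:
    \<open>m\<close> itself never rings, and every other such index has its left neighbour in the
    range.\<close>
  have main: "\<forall>i u. m \<le> i \<longrightarrow> i \<le> n \<longrightarrow> s l \<le> u \<longrightarrow> u \<le> t \<longrightarrow> (l < length ls \<longrightarrow> u < s (Suc l)) \<longrightarrow> h (site p i) u x = H l i"
    if "l \<le> length ls" for l
    using that
  proof (induction l)
    case 0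
    show ?case
    proof (intro allI impI)
      fix i u
      assume a: "m \<le> i" "i \<le> n" "s 0 \<le> u" "u \<le> t" "0 < length ls \<longrightarrow> u < s (Suc 0)"
      have "Jset i u = {}"
      proof -
        have False if "l < length ls" "s (Suc l) \<le> u" for l
          using that a(5) s_le_iff[of "Suc 0" "Suc l"] by force
        then show ?thesis using R[OF a(2)] a(4) by (fastforce simp: Jset_def)
      qed
      then show "h (site p i) u x = H 0 i"
        using hev[of u "site p i"] a(3) s(1) by (simp add: jumps H_def)
    qed
  next
    case (Suc l)
    then have l: "l < length ls" by simp
    have IH: "h (site p i) u x = H l i" if "m \<le> i" "i \<le> n" "s l \<le> u" "u < s (Suc l)" for i u
      using Suc.IH l that s(3)[of "Suc l"] by auto
    obtain k c where k: "ls ! l = (k, c)" by (cases "ls ! l")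
    have HS: "H (Suc l) = step (k, c) (H l)"
      unfolding H_def take_Suc_conv_app_nth[OF l] k by (simp add: run_def)
    have km: "k \<noteq> m" "k \<le> n" using m(3) letters l k nth_mem[OF l] by force+
    have s0: "0 \<le> s l" using s_le_iff[of 0 l] s(1) l by simp
    show ?case
    proof (intro allI impI)
      fix i u
      assume a: "m \<le> i" "i \<le> n" "s (Suc l) \<le> u" "u \<le> t" "Suc l < length ls \<longrightarrow> u < s (Suc (Suc l))"
      have sl: "s l < s (Suc l)" by (rule s(2)[OF l])
      have hv: "h (site p i) (s l) x = H l i" using IH[of i "s l"] a sl by simp
      have split: "r \<le> u \<and> r \<in> R i \<longleftrightarrow> (r \<le> s l \<and> r \<in> R i) \<or> (r = s (Suc l) \<and> k = i)" for r
      proof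
        assume r: "r \<le> u \<and> r \<in> R i"
        then obtain l' where l': "l' < length ls" "r = s (Suc l')" "fst (ls ! l') = i"
          using R[OF a(2), of r] a(4) by auto
        have "l' \<le> l"
        proof (rule ccontr)
          assume "\<not> l' \<le> l"
          then have "s (Suc (Suc l)) \<le> s (Suc l')" "Suc l < length ls" using s_le_iff[of "Suc (Suc l)" "Suc l'"] l'(1) by auto
          then show False using a(5) r l'(2) by auto
        qed
        then show "(r \<le> s l \<and> r \<in> R i) \<or> (r = s (Suc l) \<and> k = i)"
          using s_le_iff[of "Suc l'" l] l' l r k by (cases "l' = l") auto
      next
        assume "(r \<le> s l \<and> r \<in> R i) \<or> (r = s (Suc l) \<and> k = i)"
        then show "r \<le> u \<and> r \<in> R i"
        proof
          assume "r = s (Suc l) \<and> k = i"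
          moreover from this have "\<exists>l'<length ls. r = s (Suc l') \<and> fst (ls ! l') = i" using l k by auto
          ultimately show ?thesis using R[OF a(2), of r] a by simp
        qed (use sl a in auto)
      qed
      have notin: "s (Suc l) \<notin> Jset i (s l)" using sl by (auto simp: Jset_def)
      have hu: "h (site p i) u x = h (site p i) (s l) x + int (card (Jset i u)) - int (card (Jset i (s l)))"
        using hev[of u "site p i"] hev[of "s l" "site p i"] s0 sl a by (simp add: jumps)
      have fin: "finite (Jset i (s l))" using finite_J[OF a(2), of "s l"] sl a by simp
      show "h (site p i) u x = H (Suc l) i"
      proof (cases "k = i")
        case False
        then have "Jset i u = Jset i (s l)" unfolding Jset_def using split by blast
        then show ?thesis using hu hv False by (auto simp: HS step_def)
      next
        case True
        then obtain i' where i': "i = Suc i'" "m \<le> i'" using km a(1) m(1) by (cases i) auto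
        \<comment> \<open>Between consecutive rings the occupation is constant, so its left limit at
          the ring, which \<open>jumps\<close> tests, is decided by the heights after
          \<open>l\<close> letters.\<close>
        have const: "0 < \<omega> (site p i) v x \<longleftrightarrow> H l i < H l i'" if "s l \<le> v" "v < s (Suc l)" for v
          using gap[of v i'] IH[of i v] IH[of i' v] that s0 a i' by auto
        have ge: "H l i \<le> H l i'"
          using gap[of "s l" i'] IH[of i "s l"] IH[of i' "s l"] s0 sl a i' by auto
        have ev: "(\<forall>\<^sub>F v in at_left (s (Suc l)). 0 < \<omega> (site p i) v x) \<longleftrightarrow> H l i < H l i'"
        proof -
          have "\<forall>\<^sub>F v in at_left (s (Suc l)). (0 < \<omega> (site p i) v x) = (H l i < H l i')"
            using sl const by (intro eventually_at_leftI[of "s l"]) auto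
          then have "(\<forall>\<^sub>F v in at_left (s (Suc l)). 0 < \<omega> (site p i) v x) \<longleftrightarrow> (\<forall>\<^sub>F v in at_left (s (Suc l)). H l i < H l i')"
            by (rule eventually_subst)
          then show ?thesis by simp
        qed
        have "Jset i u = (if H l i < H l i' then insert (s (Suc l)) (Jset i (s l)) else Jset i (s l))"
          using split ev True unfolding Jset_def by auto
        then have "int (card (Jset i u)) = int (card (Jset i (s l))) + of_bool (H l i < H l i')"
          using fin notin by auto
        then show ?thesis using hu hv ge True i' by (auto simp: HS step_def)
      qed
    qed
  qed
  have "h (site p n) t x = H (length ls) n"
    using main[OF order_refl] m s(3)[of "length ls"] by auto
  then show ?thesis by (simp add: H_def)
qed

subsection \<open>The law of the current\<close>

lemma rings_in_order_unique:
  assumes "rings_in_order S t w x" "rings_in_order S t w' x" "set w \<subseteq> S" "set w' \<subseteq> S"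
  shows "w = w'"
  using assms
proof (induction w arbitrary: w' t x)
  case Nil
  then show ?case by (cases w') auto
next
  case (Cons i w)
  have i: "x (i, 0) \<le> t" "\<And>j. j \<in> S - {i} \<Longrightarrow> x (i, 0) < x (j, 0)" "i \<in> S"
    using Cons.prems(1,3) by simp_all
  have "w' \<noteq> []"
  proof
    assume "w' = []"
    then have "t < x (i, 0)" using Cons.prems(2) i(3) by simp
    then show False using i(1) by simp
  qed
  then obtain i' v where w': "w' = i' # v" by (meson neq_Nil_conv)
  have i': "\<And>j. j \<in> S - {i'} \<Longrightarrow> x (i', 0) < x (j, 0)" "i' \<in> S"
    using Cons.prems(2,4) w' by simp_all
  have "i = i'"
  proof (rule ccontr)
    assume "i \<noteq> i'"
    then have "x (i, 0) < x (i', 0)" "x (i', 0) < x (i, 0)" using i i' by blast+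
    then show False by simp
  qed
  then show ?case using Cons.IH[of "t - x (i, 0)" "residual S i (x (i, 0)) x" v] Cons.prems w' by simp
qed

lemma rings_in_order_clock_le:
  assumes "rings_in_order S t w x" "m \<in> set w" "m \<in> S"
  shows "x (m, 0) \<le> t"
  using assms
proof (induction w arbitrary: t x)
  case (Cons i w)
  show ?case
  proof (cases "m = i")
    case False
    then have "residual S i (x (i, 0)) x (m, 0) \<le> t - x (i, 0)"
      using Cons.prems by (intro Cons.IH) auto
    then show ?thesis using False Cons.prems(3) by (simp add: residual_def)
  qed (use Cons.prems in simp)
qed simp

text \<open>An update at an index beyond \<open>m\<close> reads only indices from \<open>m\<close>
  on, and \<open>m\<close> itself never moves. Marks act only at index 0, which
  \<open>1 \<le> m\<close> puts out of reach.\<close>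

lemma run_screened:
  assumes "map fst ls = map fst ls'" "m \<notin> fst ` set ls" "\<And>i. m \<le> i \<Longrightarrow> g i = g' i" "1 \<le> m" "m \<le> i"
  shows "run ls g i = run ls' g' i"
proof -
  have "length ls = length ls'" using assms(1) map_eq_imp_length_eq by blast
  then show ?thesis using assms(1-3)
  proof (induction ls ls' arbitrary: g g' rule: list_induct2)
    case Nil
    then show ?case using assms(5) by simp
  next
    case (Cons l ls l' ls')
    obtain k c c' where l: "l = (k, c)" "l' = (k, c')" using Cons.prems(1) by (cases l; cases l') auto
    have k: "k \<noteq> m" using Cons.prems(2) l by auto
    have "step l g j = step l' g' j" if "m \<le> j" for j
      using Cons.prems(3)[OF that] Cons.prems(3)[of "j - 1"] k that assms(4) unfolding l step_def by auto
    moreover have "map fst ls = map fst ls'" "m \<notin> fst ` set ls" using Cons.prems(1,2) by auto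
    ultimately show ?case unfolding run_simps by (intro Cons.IH)
  qed
qed

section \<open>Probabilities of words and of ring orders\<close>

lemma pmf_replicate_pmf:
  "pmf (replicate_pmf k Q) w = (if length w = k then \<Prod>i\<leftarrow>w. pmf Q i else 0)"
proof (induction k arbitrary: w)
  case 0
  then show ?case by (simp add: indicator_def)
next
  case (Suc k)
  have eq: "replicate_pmf (Suc k) Q = map_pmf (\<lambda>z. fst z # snd z) (pair_pmf Q (replicate_pmf k Q))"
    by (simp add: pair_pmf_def map_pmf_def bind_assoc_pmf bind_return_pmf)
  show ?case
  proof (cases w)
    case Nil
    then show ?thesis unfolding eq by (simp add: pmf_map vimage_def)
  next
    case (Cons x xs)
    have "pmf (map_pmf (\<lambda>z. fst z # snd z) (pair_pmf Q (replicate_pmf k Q))) (fst (x, xs) # snd (x, xs)) =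
        pmf (pair_pmf Q (replicate_pmf k Q)) (x, xs)"
      by (rule pmf_map_inj') (auto simp: inj_def)
    then show ?thesis unfolding eq Cons by (simp add: pmf_pair Suc.IH)
  qed
qed

definition site_word_pmf :: "nat \<Rightarrow> real \<Rightarrow> nat list pmf" where
  "site_word_pmf n t = joint_word_pmf n t (pmf_of_set {0..n})"

lemma map_fst_word_pmf: "map_pmf (map fst) (word_pmf n t a) = site_word_pmf n t"
proof -
  have "map_pmf fst (letter_pmf n a) = pmf_of_set {0..n}" by (simp add: letter_pmf_def map_fst_pair_pmf)
  then show ?thesis
    by (simp add: site_word_pmf_def joint_word_pmf_def word_pmf_def map_bind_pmf map_replicate_pmf)
qed

lemma set_site_word_pmf: "w \<in> set_pmf (site_word_pmf n t) \<Longrightarrow> set w \<subseteq> {0..n}"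
  by (auto simp: site_word_pmf_def joint_word_pmf_def set_replicate_pmf lists_eq_set)

text \<open>The factor (n + 1)^k of the Poisson weight cancels the uniform weight of a word of
  length k. What remains is the probability in \<open>prob_rings_in_order\<close> for n + 1
  clocks.\<close>

lemma pmf_site_word_pmf:
  assumes "0 < t" "set w \<subseteq> {0..n}"
  shows "pmf (site_word_pmf n t) w = exp (- real (Suc n) * t) * t ^ length w / fact (length w)"
proof -
  let ?L = "real (Suc n) * t"
  have pr: "(\<Prod>i\<leftarrow>w. pmf (pmf_of_set {0..n}) i) = (1 / real (Suc n)) ^ length w"
    using assms(2) by (induction w) (auto simp: indicator_def)
  have "pmf (site_word_pmf n t) w =
      measure_pmf.expectation (poisson_pmf ?L) (\<lambda>k. if length w = k then (1 / real (Suc n)) ^ length w else 0)"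
    unfolding site_word_pmf_def joint_word_pmf_def pmf_bind pmf_replicate_pmf pr ..
  also have "\<dots> = (1 / real (Suc n)) ^ length w * pmf (poisson_pmf ?L) (length w)"
    by (subst integral_measure_pmf_real[where A = "{length w}"]) (auto split: if_splits)
  also have "\<dots> = exp (- ?L) * t ^ length w / fact (length w)"
    using assms(1) by (simp add: power_mult_distrib power_divide del: of_nat_Suc)
  finally show ?thesis by (simp only: mult_minus_left)
qed

text \<open>The discrete model and the process live on different spaces. Disjoint events that carry
  the weights of \<open>R\<close> transfer probabilities between them without a joint
  construction.\<close>

lemma (in prob_space) pmf_prob_le:
  assumes E: "\<And>z. z \<in> set_pmf R \<Longrightarrow> E z \<in> events" "\<And>z. z \<in> set_pmf R \<Longrightarrow> prob (E z) = pmf R z"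
    and disj: "disjoint_family_on E (set_pmf R)" and A: "A \<in> events"
    and sub: "\<And>z. z \<in> set_pmf R \<Longrightarrow> z \<in> B \<Longrightarrow> AE x in M. x \<in> E z \<longrightarrow> x \<in> A"
  shows "measure_pmf.prob R B \<le> prob A"
proof -
  let ?I = "set_pmf R \<inter> B"
  have I: "countable ?I" by auto
  have "emeasure R B = emeasure R ?I" by (simp add: emeasure_Int_set_pmf Int_commute)
  also have "\<dots> = (\<integral>\<^sup>+z. ennreal (pmf R z) \<partial>count_space ?I)" by (rule nn_integral_pmf[symmetric])
  also have "\<dots> = (\<integral>\<^sup>+z. emeasure M (E z) \<partial>count_space ?I)"
    using E by (intro nn_integral_cong) (auto simp: emeasure_eq_measure)
  also have "\<dots> = emeasure M (\<Union>z\<in>?I. E z)"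
    using E I disj by (intro emeasure_UN_countable[symmetric]) (auto intro: disjoint_family_on_mono)
  also have "\<dots> \<le> emeasure M A"
  proof (rule emeasure_mono_AE)
    have "AE x in M. \<forall>z\<in>?I. x \<in> E z \<longrightarrow> x \<in> A" using I sub by (subst AE_ball_countable) auto
    then show "AE x in M. x \<in> (\<Union>z\<in>?I. E z) \<longrightarrow> x \<in> A" by eventually_elim auto
  qed (rule A)
  finally show ?thesis by (simp add: measure_pmf.emeasure_eq_measure emeasure_eq_measure)
qed

lemma (in prob_space) integer_variable_law:
  assumes J: "random_variable (count_space UNIV) (J :: 'a \<Rightarrow> int)"
  obtains Q where "distr M (count_space UNIV) J = measure_pmf Q"
    "\<And>k. pmf Q k = prob {x\<in>space M. J x = k}"
proof -
  interpret D: prob_space "distr M (count_space UNIV) J" by (rule prob_space_distr[OF J])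
  have vi: "J -` {k} \<inter> space M = {x\<in>space M. J x = k}" for k by auto
  have em: "emeasure (distr M (count_space UNIV) J) {k} = ennreal (prob {x\<in>space M. J x = k})" for k
    using J by (simp add: emeasure_distr vi emeasure_eq_measure)
  have "(\<integral>\<^sup>+k. ennreal (prob {x\<in>space M. J x = k}) \<partial>count_space UNIV) =
      emeasure (distr M (count_space UNIV) J) (\<Union>k\<in>UNIV. {k})"
    unfolding em[symmetric] by (subst emeasure_UN_countable) (auto simp: disjoint_family_on_def)
  also have "\<dots> = 1" using D.emeasure_space_1 by simp
  finally have one: "(\<integral>\<^sup>+k. ennreal (prob {x\<in>space M. J x = k}) \<partial>count_space UNIV) = 1" .
  define Q where "Q = embed_pmf (\<lambda>k. prob {x\<in>space M. J x = k})"
  have Q: "pmf Q k = prob {x\<in>space M. J x = k}" for k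
    unfolding Q_def by (rule pmf_embed_pmf[OF _ one]) simp
  have "distr M (count_space UNIV) J = measure_pmf Q"
    by (rule measure_eqI_countable[of _ UNIV]) (auto simp: em Q emeasure_pmf_single)
  then show thesis using Q by (rule that)
qed

section \<open>Clocks and initial state of the given process\<close>

context tazrp begin

lemma waiting_time_distr: "distr M borel (\<tau> i n) = waiting_time"
  using waiting_times_exponential[of i n] unfolding distributed_def waiting_time_def
  by (metis distr_cong sets_lborel)

lemma random_waiting_time [measurable]: "\<tau> i n \<in> borel_measurable M"
  using waiting_times_exponential[of i n] by (simp add: distributed_def)

lemma AE_waiting_times_pos: "AE x in M. \<forall>i n. 0 < \<tau> i n x"
proof -
  have "AE x in M. 0 < \<tau> i n x" for i n
  proof -
    have "emeasure M {x\<in>space M. 0 < \<tau> i n x} = emeasure (distr M borel (\<tau> i n)) {0<..}"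
      by (subst emeasure_distr) (auto intro!: arg_cong[where f = "emeasure M"])
    also have "\<dots> = 1" by (simp add: waiting_time_distr waiting_time_greater)
    finally have "prob {x\<in>space M. 0 < \<tau> i n x} = 1" by (simp add: emeasure_eq_measure)
    then show ?thesis using prob_Collect_eq_1[of "\<lambda>x. 0 < \<tau> i n x"] by simp
  qed
  then show ?thesis by (simp add: AE_all_countable)
qed

text \<open>Sites are shifted so that the origin has index \<open>p\<close>, as in
  \<open>profile\<close>.\<close>

definition clocks :: "nat \<Rightarrow> 'a \<Rightarrow> nat \<times> nat \<Rightarrow> real" where
  "clocks p x q = \<tau> (int (fst q) - int p) (snd q) x"

definition reindex :: "nat \<Rightarrow> (int \<times> nat \<Rightarrow> real) \<Rightarrow> nat \<times> nat \<Rightarrow> real" where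
  "reindex p y q = y (int (fst q) - int p, snd q)"

lemma measurable_reindex: "reindex p \<in> clock_space \<rightarrow>\<^sub>M clock_space"
proof -
  have "reindex p \<in> clock_space \<rightarrow>\<^sub>M Pi\<^sub>M UNIV (\<lambda>_. borel)"
    by (intro measurable_PiM_single') (auto simp: reindex_def[abs_def])
  then show ?thesis by (simp cong: measurable_cong_sets add: sets_clock_space)
qed

lemma all_clocks_distr: "distr M clock_space (\<lambda>x (i, n). \<tau> i n x) = clock_space"
proof -
  have "distr M (Pi\<^sub>M UNIV (\<lambda>_. borel)) (\<lambda>x. \<lambda>q\<in>UNIV. (\<lambda>(i, n). \<tau> i n) q x) =
      Pi\<^sub>M UNIV (\<lambda>q. distr M borel ((\<lambda>(i, n). \<tau> i n) q))"
    using waiting_times_indep by (subst (asm) indep_vars_iff_distr_eq_PiM') auto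
  also have "(\<lambda>q. distr M borel ((\<lambda>(i, n). \<tau> i n) q)) = (\<lambda>_. waiting_time)"
    by (auto simp: waiting_time_distr fun_eq_iff)
  also have "(\<lambda>x. \<lambda>q\<in>UNIV. (\<lambda>(i, n). \<tau> i n) q x) = (\<lambda>x (i, n). \<tau> i n x)" by (auto simp: fun_eq_iff)
  finally show ?thesis
    unfolding clock_space_def[symmetric]
    by (subst distr_cong[OF refl sets_clock_space refl])
qed

lemma all_clocks_measurable: "(\<lambda>x (i, n). \<tau> i n x) \<in> M \<rightarrow>\<^sub>M clock_space"
proof -
  have "(\<lambda>x (i, n). \<tau> i n x) \<in> M \<rightarrow>\<^sub>M Pi\<^sub>M UNIV (\<lambda>_. borel)"
    by (intro measurable_PiM_single') (auto simp: case_prod_unfold)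
  then show ?thesis by (simp cong: measurable_cong_sets add: sets_clock_space)
qed

lemma clocks_eq: "clocks p = reindex p \<circ> (\<lambda>x (i, n). \<tau> i n x)"
  by (auto simp: clocks_def reindex_def fun_eq_iff)

lemma measurable_clocks: "clocks p \<in> M \<rightarrow>\<^sub>M clock_space"
  unfolding clocks_eq by (rule measurable_comp[OF all_clocks_measurable measurable_reindex])

lemma clocks_distr: "distr M clock_space (clocks p) = clock_space"
proof -
  have "distr M clock_space (clocks p) = distr (distr M clock_space (\<lambda>x (i, n). \<tau> i n x)) clock_space (reindex p)"
    unfolding clocks_eq by (rule distr_distr[OF measurable_reindex all_clocks_measurable, symmetric])
  also have "\<dots> = distr (Pi\<^sub>M UNIV (\<lambda>_. waiting_time)) (Pi\<^sub>M UNIV (\<lambda>_. waiting_time))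
      (\<lambda>y. \<lambda>q\<in>UNIV. y (int (fst q) - int p, snd q))"
    unfolding all_clocks_distr by (simp add: clock_space_def reindex_def[abs_def] restrict_def)
  also have "\<dots> = clock_space"
    unfolding clock_space_def
    by (rule distr_PiM_reindex) (auto simp: prob_space_waiting_time inj_on_def)
  finally show ?thesis .
qed

lemma prob_clocks:
  assumes "B \<in> sets clock_space"
  shows "{x\<in>space M. clocks p x \<in> B} \<in> events" "prob {x\<in>space M. clocks p x \<in> B} = measure clock_space B"
proof -
  have v: "{x\<in>space M. clocks p x \<in> B} = clocks p -` B \<inter> space M" by auto
  show "{x\<in>space M. clocks p x \<in> B} \<in> events" unfolding v using measurable_clocks assms by (rule measurable_sets)
  show "prob {x\<in>space M. clocks p x \<in> B} = measure clock_space B"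
    unfolding v using measure_distr[OF measurable_clocks assms, of p] by (simp add: clocks_distr)
qed

lemma prob_independent:
  assumes B: "B \<in> sets clock_space" and C: "C \<in> sets (Pi\<^sub>M UNIV (\<lambda>_. count_space UNIV))"
  shows "prob ({x\<in>space M. (\<lambda>i. \<omega> i 0 x) \<in> C} \<inter> {x\<in>space M. clocks p x \<in> B}) =
    prob {x\<in>space M. (\<lambda>i. \<omega> i 0 x) \<in> C} * prob {x\<in>space M. clocks p x \<in> B}"
proof -
  let ?T = "\<lambda>x (i, n). \<tau> i n x"
  define B' where "B' = reindex p -` B"
  have B': "B' \<in> sets (Pi\<^sub>M UNIV (\<lambda>_. borel))"
    using measurable_sets[OF measurable_reindex B, of p] by (simp add: B'_def sets_clock_space)
  have "{x\<in>space M. clocks p x \<in> B} = ?T -` B' \<inter> space M"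
    by (auto simp: clocks_eq B'_def)
  then have 1: "{x\<in>space M. clocks p x \<in> B} \<in> sets (vimage_algebra (space M) ?T (Pi\<^sub>M UNIV (\<lambda>_. borel)))"
    using in_vimage_algebra[OF B'] by simp
  have "{x\<in>space M. (\<lambda>i. \<omega> i 0 x) \<in> C} = (\<lambda>x i. \<omega> i 0 x) -` C \<inter> space M" by auto
  then have 2: "{x\<in>space M. (\<lambda>i. \<omega> i 0 x) \<in> C} \<in> sets (vimage_algebra (space M) (\<lambda>x i. \<omega> i 0 x) (Pi\<^sub>M UNIV (\<lambda>_. count_space UNIV)))"
    using in_vimage_algebra[OF C] by simp
  show ?thesis by (rule indep_setD[OF initial_state_indep_clocks 2 1])
qed

end

lemma emeasure_waiting_time_atMost:
  assumes "0 \<le> t"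
  shows "emeasure waiting_time {..t} = ennreal (1 - exp (- t))"
proof -
  interpret prob_space waiting_time by (rule prob_space_waiting_time)
  have "{..t} = space waiting_time - {t<..}" by auto
  then have "prob {..t} = 1 - prob {t<..}"
    by (simp only:) (intro prob_compl, simp add: sets_waiting_time)
  moreover have "prob {t<..} = exp (- t)"
    using waiting_time_greater[OF assms] by (simp add: measure_def)
  ultimately show ?thesis by (simp add: emeasure_eq_measure)
qed

context stationary_tazrp begin

lemma measurable_initial: "(\<lambda>x i. \<omega> i 0 x) \<in> M \<rightarrow>\<^sub>M Pi\<^sub>M UNIV (\<lambda>_. count_space UNIV)"
  using occupation_measurable[of 0] by (intro measurable_PiM_single') auto

lemma prob_initial:
  fixes n p :: nat and \<eta> :: "nat \<Rightarrow> nat"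
  assumes \<rho>: "0 < \<rho>" and \<eta>: "\<And>i. i \<notin> {1..n} \<Longrightarrow> \<eta> i = 0"
  defines "C \<equiv> {y :: int \<Rightarrow> nat. \<forall>i\<in>{1..n}. y (int i - int p) = \<eta> i}" and "a \<equiv> \<rho> / (1 + \<rho>)"
  shows "C \<in> sets (Pi\<^sub>M UNIV (\<lambda>_. count_space UNIV))"
    and "prob {x\<in>space M. (\<lambda>i. \<omega> i 0 x) \<in> C} = pmf (initial_pmf n p a a) \<eta>"
proof -
  let ?G = "stationary_marginal \<rho>"
  let ?P = "Pi\<^sub>M (UNIV :: int set) (\<lambda>_. measure_pmf ?G)"
  let ?f = "\<lambda>i :: nat. int i - int p"
  interpret PP: product_prob_space "\<lambda>_ :: int. measure_pmf ?G" UNIV by standard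
  have Ceq: "C = {y\<in>space ?P. \<forall>j\<in>?f ` {1..n}. y j \<in> {\<eta> (nat (j + int p))}}"
    by (auto simp: C_def space_PiM)
  have sets: "sets ?P = sets (Pi\<^sub>M UNIV (\<lambda>_. count_space UNIV))" by (intro sets_PiM_cong) auto
  have "emeasure ?P C = (\<Prod>j\<in>?f ` {1..n}. emeasure (measure_pmf ?G) {\<eta> (nat (j + int p))})"
    unfolding Ceq by (intro PP.emeasure_PiM_Collect) auto
  also have "\<dots> = (\<Prod>i\<in>{1..n}. emeasure (measure_pmf ?G) {\<eta> i})"
    by (subst prod.reindex) (auto simp: inj_on_def)
  also have "\<dots> = ennreal (\<Prod>i\<in>{1..n}. pmf ?G (\<eta> i))"
    by (simp add: emeasure_pmf_single prod_ennreal)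
  finally have em: "emeasure ?P C = ennreal (\<Prod>i\<in>{1..n}. pmf ?G (\<eta> i))" .
  show C: "C \<in> sets (Pi\<^sub>M UNIV (\<lambda>_. count_space UNIV))"
  proof -
    have "Measurable.pred (Pi\<^sub>M UNIV (\<lambda>_. count_space UNIV)) (\<lambda>y. \<forall>i\<in>{1..n}. y (?f i) = \<eta> i)"
      by (intro pred_intros_finite) auto
    then show ?thesis by (simp add: C_def pred_def space_PiM)
  qed
  have "1 - a = 1 / (1 + \<rho>)" using \<rho> by (simp add: a_def field_simps)
  then have G: "geo a = ?G" by (simp add: geo_def stationary_marginal_def)
  have "{x\<in>space M. (\<lambda>i. \<omega> i 0 x) \<in> C} = (\<lambda>x i. \<omega> i 0 x) -` C \<inter> space M" by auto
  then have "emeasure M {x\<in>space M. (\<lambda>i. \<omega> i 0 x) \<in> C} = emeasure ?P C"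
    unfolding initial_distribution[symmetric] using measurable_initial C by (simp add: emeasure_distr)
  then have "prob {x\<in>space M. (\<lambda>i. \<omega> i 0 x) \<in> C} = (\<Prod>i\<in>{1..n}. pmf ?G (\<eta> i))"
    unfolding em by (simp add: emeasure_eq_measure prod_nonneg)
  also have "\<dots> = pmf (initial_pmf n p a a) \<eta>"
    unfolding initial_pmf_def if_cancel G using \<eta> by (subst pmf_Pi') auto
  finally show "prob {x\<in>space M. (\<lambda>i. \<omega> i 0 x) \<in> C} = pmf (initial_pmf n p a a) \<eta>" .
qed

text \<open>If one of the sites with index 1 to \<open>p\<close> is silent up to \<open>t\<close>,
  the height is the same function of initial state and ring order in the process and in the finite
  system. The error is the probability that all of them ring, which they do independently with
  probability 1 - exp (- t) each.\<close>

theorem current_law_error: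
  fixes N p :: nat
  assumes \<rho>: "0 < \<rho>" and t: "0 < t" and p: "1 \<le> p"
  defines "a \<equiv> \<rho> / (1 + \<rho>)" and "n \<equiv> p + N"
  shows "\<bar>pmf (current_pmf n p t a a) k - prob {x\<in>space M. h (int N) t x = k}\<bar> \<le> (1 - exp (- t)) ^ p"
proof -
  let ?init = "initial_pmf n p a a" and ?S = "{0..n}"
  define R where "R = pair_pmf ?init (site_word_pmf n t)"
  define I where "I \<eta> = {x\<in>space M. (\<lambda>i. \<omega> i 0 x) \<in> {y. \<forall>i\<in>{1..n}. y (int i - int p) = \<eta> i}}" for \<eta> :: "nat \<Rightarrow> nat"
  define W where "W w = {x\<in>space M. clocks p x \<in> {y. rings_in_order ?S t w y}}" for w
  define E where "E z = I (fst z) \<inter> W (snd z)" for z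
  \<comment> \<open>Marks exist in the finite system only. On \<open>G\<close>, where some site is
    silent, they have no influence on the height, so they are all set to
    \<open>False\<close>.\<close>
  define f where "f z = run (map (\<lambda>i. (i, False)) (snd z)) (profile p (fst z)) n" for z :: "(nat \<Rightarrow> nat) \<times> nat list"
  define G where "G = {z :: (nat \<Rightarrow> nat) \<times> nat list. \<exists>m\<in>{1..p}. m \<notin> set (snd z)}"
  have n: "1 \<le> n" "p \<le> n" using p by (auto simp: n_def)
  have init0: "\<eta> i = 0" if "\<eta> \<in> set_pmf ?init" "i \<notin> {1..n}" for \<eta> i
    using set_Pi_pmfD[OF that(1)[unfolded initial_pmf_def], of i] that(2) by auto
  have ord_sets: "{y. rings_in_order ?S t w y} \<in> sets clock_space" for w
    using measurable_rings_in_order'[of ?S t w] by (simp add: pred_def)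
  have ord_prob: "measure clock_space {y :: nat \<times> nat \<Rightarrow> real. rings_in_order ?S t w y} = pmf (site_word_pmf n t) w"
    if "set w \<subseteq> ?S" for w
    using prob_rings_in_order[of ?S w t] that t by (simp add: measure_def pmf_site_word_pmf)
  have Rset: "fst z \<in> set_pmf ?init" "set (snd z) \<subseteq> ?S" if "z \<in> set_pmf R" for z
  proof -
    have "snd z \<in> set_pmf (site_word_pmf n t)" using that by (auto simp: R_def)
    then show "set (snd z) \<subseteq> ?S" by (rule set_site_word_pmf)
    show "fst z \<in> set_pmf ?init" using that by (auto simp: R_def)
  qed
  have E_events: "E z \<in> events" if "z \<in> set_pmf R" for z
  proof -
    have \<eta>: "fst z \<in> set_pmf ?init" using that by (auto simp: R_def)
    let ?C = "{y. \<forall>i\<in>{1..n}. y (int i - int p) = fst z i}"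
    have "?C \<in> sets (Pi\<^sub>M UNIV (\<lambda>_. count_space UNIV))"
      by (rule prob_initial(1)[OF \<rho> init0[OF \<eta>]])
    from measurable_sets[OF measurable_initial this] have "I (fst z) \<in> events"
      unfolding I_def by (simp add: vimage_def Int_def conj_commute)
    moreover have "W (snd z) \<in> events" unfolding W_def by (rule prob_clocks(1)[OF ord_sets])
    ultimately show ?thesis unfolding E_def by (rule sets.Int)
  qed
  have E_prob: "prob (E z) = pmf R z" if "z \<in> set_pmf R" for z
  proof -
    obtain \<eta> w where z: "z = (\<eta>, w)" by (cases z)
    have \<eta>: "\<eta> \<in> set_pmf ?init" and w: "set w \<subseteq> ?S" using that set_site_word_pmf by (auto simp: R_def z)
    note PI = prob_initial[where p = p and n = n and \<eta> = \<eta>, OF \<rho> init0[OF \<eta>]]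
    have "prob (E z) = prob (I \<eta>) * prob (W w)"
      unfolding E_def I_def W_def z fst_conv snd_conv by (rule prob_independent[OF ord_sets PI(1)])
    also have "prob (I \<eta>) = pmf ?init \<eta>" unfolding I_def a_def by (rule PI(2))
    also have "prob (W w) = pmf (site_word_pmf n t) w"
      unfolding W_def by (simp only: prob_clocks(2)[OF ord_sets] ord_prob[OF w])
    finally show ?thesis by (simp add: R_def z pmf_pair)
  qed
  have disj: "disjoint_family_on E (set_pmf R)"
    unfolding disjoint_family_on_def
  proof (intro ballI impI equals0I)
    fix z z' x assume z: "z \<in> set_pmf R" "z' \<in> set_pmf R" "z \<noteq> z'" and x: "x \<in> E z \<inter> E z'"
    have "rings_in_order ?S t (snd z) (clocks p x)" "rings_in_order ?S t (snd z') (clocks p x)"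
      using x by (auto simp: E_def W_def)
    then have "snd z = snd z'" using Rset(2)[OF z(1)] Rset(2)[OF z(2)] by (rule rings_in_order_unique)
    moreover have "fst z i = fst z' i" for i
    proof (cases "i \<in> {1..n}")
      case True
      have "\<omega> (int i - int p) 0 x = fst z i" "\<omega> (int i - int p) 0 x = fst z' i"
        using x True by (auto simp: E_def I_def)
      then show ?thesis by simp
    next
      case False
      then show ?thesis using init0[OF Rset(1)[OF z(1)] False] init0[OF Rset(1)[OF z(2)] False] by simp
    qed
    ultimately show False using z(3) by (auto simp: prod_eq_iff)
  qed
  have height: "random_variable (count_space UNIV) (h (int N) t)" using height_measurable t by simp
  have good: "AE x in M. x \<in> E z \<longrightarrow> h (int N) t x = f z" if z: "z \<in> set_pmf R" "z \<in> G" for z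
    using AE_waiting_times_pos occupation_evolution height_initial height_evolution
  proof eventually_elim
    case (elim x)
    obtain m where m: "1 \<le> m" "m \<le> p" "m \<notin> set (snd z)" using z(2) by (auto simp: G_def)
    have w: "set (snd z) \<subseteq> ?S" by (rule Rset(2)[OF z(1)])
    show ?case
    proof
      assume x: "x \<in> E z"
      let ?w = "\<lambda>i. \<omega> (int i - int p) 0 x"
      have d: "h (int (Suc i) - int p) 0 x - profile p ?w (Suc i) = h (int i - int p) 0 x - profile p ?w i" for i
      proof -
        have "h (int (Suc i) - int p - 1) 0 x - h (int (Suc i) - int p) 0 x = int (?w (Suc i))" using elim(3) by blast
        then show ?thesis by (simp add: profile_Suc)
      qed
      have const: "h (int i - int p) 0 x - profile p ?w i = h (int 0 - int p) 0 x - profile p ?w 0" for i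
        by (induction i) (simp_all only: d)
      have "h (int p - int p) 0 x - profile p ?w p = 0" using elim(3) by (simp add: profile_def)
      then have prof: "h (int i - int p) 0 x = profile p ?w i" for i using const[of i] const[of p] by simp
      have "h (int n - int p) t x = run (map (\<lambda>i. (i, False)) (snd z)) (\<lambda>i. h (int i - int p) 0 x) n"
      proof (rule height_eq_run[where m = m and \<tau> = \<tau> and \<omega> = \<omega>])
        show "rings_in_order {0..n} t (map fst (map (\<lambda>i. (i, False)) (snd z))) (\<lambda>q. \<tau> (int (fst q) - int p) (snd q) x)"
        proof -
          have "(\<lambda>q. \<tau> (int (fst q) - int p) (snd q) x) = clocks p x" by (simp add: clocks_def fun_eq_iff)
          then show ?thesis using x by (simp add: E_def W_def comp_def)
        qed
        show "0 < \<tau> i k x" for i k using elim(1) by blast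
        show "h (i - 1) 0 x - h i 0 x = int (\<omega> i 0 x)" for i using elim(3) by blast
      next
        fix i and u :: real assume "0 \<le> u"
        then show "int (\<omega> i u x) = int (\<omega> i 0 x) + int (jumps \<tau> \<omega> (i - 1) u x) - int (jumps \<tau> \<omega> i u x)"
          "h i u x = h i 0 x + int (jumps \<tau> \<omega> i u x)" using elim(2,4) by blast+
      qed (use t w m n in auto)
      also have "\<dots> = run (map (\<lambda>i. (i, False)) (snd z)) (profile p (fst z)) n"
      proof (rule run_cong)
        fix i assume "i \<le> n"
        then have "profile p ?w i = profile p (fst z) i"
          using x n by (intro profile_eqI) (auto simp: E_def I_def)
        then show "h (int i - int p) 0 x = profile p (fst z) i" by (simp add: prof)
      qed (use w in auto)
      finally show "h (int N) t x = f z" by (simp add: f_def n_def)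
    qed
  qed
  let ?P = "prob {x\<in>space M. h (int N) t x = k}"
  have ev: "{x\<in>space M. h (int N) t x = k} \<in> events" using height by measurable
  \<comment> \<open>One-sided bounds for the value \<open>k\<close> and for its complement give the
    two-sided estimate, since the probabilities add up to 1 on both spaces; each bound costs the
    weight of \<open>- G\<close>.\<close>
  have le1: "measure_pmf.prob R (G \<inter> {z. f z = k}) \<le> ?P"
  proof (rule pmf_prob_le[where E = E])
    fix z assume z: "z \<in> set_pmf R" "z \<in> G \<inter> {z. f z = k}"
    then have "AE x in M. x \<in> E z \<longrightarrow> h (int N) t x = f z" by (intro good) auto
    then show "AE x in M. x \<in> E z \<longrightarrow> x \<in> {x\<in>space M. h (int N) t x = k}"
      using z by (auto simp: E_def I_def)
  qed (use E_events E_prob disj ev in auto)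
  have le2: "measure_pmf.prob R (G \<inter> {z. f z \<noteq> k}) \<le> prob (space M - {x\<in>space M. h (int N) t x = k})"
  proof (rule pmf_prob_le[where E = E])
    fix z assume z: "z \<in> set_pmf R" "z \<in> G \<inter> {z. f z \<noteq> k}"
    then have "AE x in M. x \<in> E z \<longrightarrow> h (int N) t x = f z" by (intro good) auto
    then show "AE x in M. x \<in> E z \<longrightarrow> x \<in> space M - {x\<in>space M. h (int N) t x = k}"
      using z by (auto simp: E_def I_def)
  qed (use E_events E_prob disj ev in auto)
  have le3: "measure_pmf.prob R (- G) \<le> (1 - exp (- t)) ^ p"
  proof -
    define B where "B = {y\<in>space (Pi\<^sub>M UNIV (\<lambda>_. waiting_time)). \<forall>q\<in>{1..p} \<times> {0 :: nat}. y q \<in> {..t}}"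
    interpret W: prob_space waiting_time by (rule prob_space_waiting_time)
    interpret PP: product_prob_space "\<lambda>_ :: nat \<times> nat. waiting_time" UNIV by standard
    have "emeasure clock_space B = (\<Prod>q\<in>{1..p} \<times> {0 :: nat}. emeasure waiting_time {..t})"
      unfolding clock_space_def B_def by (intro PP.emeasure_PiM_Collect) (auto simp: sets_waiting_time)
    also have "\<dots> = ennreal ((1 - exp (- t)) ^ p)"
      using t by (simp add: emeasure_waiting_time_atMost ennreal_power card_cartesian_product)
    finally have mB: "measure clock_space B = (1 - exp (- t)) ^ p" using t by (simp add: measure_def)
    have "Measurable.pred clock_space (\<lambda>y. \<forall>q\<in>{1..p} \<times> {0 :: nat}. y q \<le> t)"
      by (intro pred_intros_finite) auto
    then have B: "B \<in> sets clock_space" by (simp add: B_def pred_def space_PiM)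
    have "measure_pmf.prob R (- G) \<le> prob {x\<in>space M. clocks p x \<in> B}"
    proof (rule pmf_prob_le[where E = E])
      fix z assume z: "z \<in> set_pmf R" "z \<in> - G"
      have "x \<in> {x\<in>space M. clocks p x \<in> B}" if x: "x \<in> E z" for x
      proof -
        have "clocks p x (m, 0) \<le> t" if "m \<in> {1..p}" for m
          using x z(2) that n by (intro rings_in_order_clock_le[of ?S t "snd z"]) (auto simp: E_def W_def G_def)
        then show ?thesis using x by (auto simp: B_def E_def I_def space_PiM)
      qed
      then show "AE x in M. x \<in> E z \<longrightarrow> x \<in> {x\<in>space M. clocks p x \<in> B}" by auto
    qed (use E_events E_prob disj prob_clocks(1)[OF B] in auto)
    then show ?thesis by (simp add: prob_clocks(2)[OF B] mB)
  qed
  define R' where "R' = pair_pmf ?init (word_pmf n t a)"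
  define F where "F z = run (snd z) (profile p (fst z)) n" for z :: "(nat \<Rightarrow> nat) \<times> letter list"
  define \<pi> where "\<pi> z = (fst z, map fst (snd z))" for z :: "(nat \<Rightarrow> nat) \<times> letter list"
  have \<pi>: "map_pmf \<pi> R' = R"
    using map_pair[of "\<lambda>x. x" "map fst" ?init "word_pmf n t a"]
    by (simp add: R'_def R_def \<pi>_def[abs_def] map_fst_word_pmf case_prod_unfold)
  have cur: "current_pmf n p t a a = map_pmf F R'"
    by (simp add: current_pmf_def F_def[abs_def] R'_def case_prod_unfold)
  have FG: "F z = f (\<pi> z)" if "\<pi> z \<in> G" for z
  proof -
    have "\<exists>m\<in>{1..p}. m \<notin> fst ` set (snd z)" using that by (simp add: G_def \<pi>_def)
    then obtain m where m: "m \<in> {1..p}" "m \<notin> fst ` set (snd z)" by blast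
    show ?thesis unfolding F_def f_def \<pi>_def
      using m n by (intro run_screened[of _ _ m]) auto
  qed
  have split: "measure_pmf.prob R' {z. Q (F z)} \<le> measure_pmf.prob R (G \<inter> {z. Q (f z)}) + measure_pmf.prob R (- G)" for Q
  proof -
    have "{z. Q (F z)} \<subseteq> \<pi> -` (G \<inter> {z. Q (f z)}) \<union> \<pi> -` (- G)" using FG by auto
    then have "measure_pmf.prob R' {z. Q (F z)} \<le> measure_pmf.prob R' (\<pi> -` (G \<inter> {z. Q (f z)}) \<union> \<pi> -` (- G))"
      by (intro measure_pmf.finite_measure_mono) auto
    also have "\<dots> \<le> measure_pmf.prob R' (\<pi> -` (G \<inter> {z. Q (f z)})) + measure_pmf.prob R' (\<pi> -` (- G))"
      by (intro measure_Un_le) auto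
    finally show ?thesis unfolding \<pi>[symmetric] by simp
  qed
  have pk: "pmf (current_pmf n p t a a) k = measure_pmf.prob R' {z. F z = k}"
    unfolding cur by (simp add: pmf_map vimage_def)
  have pk': "1 - pmf (current_pmf n p t a a) k = measure_pmf.prob R' {z. F z \<noteq> k}"
    unfolding pk using measure_pmf.prob_compl[of "{z. F z = k}" R'] by (simp add: Compl_eq_Diff_UNIV[symmetric] Collect_neg_eq)
  have "pmf (current_pmf n p t a a) k \<le> ?P + (1 - exp (- t)) ^ p"
    unfolding pk using split[of "\<lambda>j. j = k"] le1 le3 by simp
  moreover have "1 - pmf (current_pmf n p t a a) k \<le> (1 - ?P) + (1 - exp (- t)) ^ p"
    unfolding pk' using split[of "\<lambda>j. j \<noteq> k"] le2 le3 prob_compl[OF ev] by simp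
  ultimately show ?thesis by (simp add: abs_le_iff)
qed

end

theorem corollary2p3:
  fixes \<rho> :: real
  assumes "0 < \<rho>"
  shows "\<exists>t\<^sub>0 C :: real. 0 < t\<^sub>0 \<and> 0 < C \<and>
    (\<forall>(M :: 'a measure) \<tau> \<omega> h. stationary_tazrp \<rho> M \<tau> \<omega> h \<longrightarrow>
      (\<forall>t\<ge>t\<^sub>0.
        inverse C * t powr (2 / 3)
          \<le> prob_space.variance M (\<lambda>x. real_of_int (char_current \<rho> h t x)) \<and>
        prob_space.variance M (\<lambda>x. real_of_int (char_current \<rho> h t x))
          \<le> C * t powr (2 / 3)))"
proof -
  \<comment> \<open>The ratio of the geometric weights. The constants are obtained from it before
    the process is fixed, so they depend on \<rho> only.\<close>
  define a where "a = \<rho> / (1 + \<rho>)"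
  have a: "0 < a" "a < 1" using assms by (auto simp: a_def)
  obtain t0 D where t0: "0 < t0" "0 < D"
    and bounds: "\<And>t Q. t0 \<le> t \<Longrightarrow> (\<And>k. (\<lambda>p. pmf (current_pmf (p + sites a t) p t a a) k) \<longlonglongrightarrow> pmf Q k) \<Longrightarrow>
      integrable Q (\<lambda>x. (real_of_int x)\<^sup>2) \<and>
      inverse D * t powr (2/3) \<le> measure_pmf.variance Q real_of_int \<and>
      measure_pmf.variance Q real_of_int \<le> D * t powr (2/3)"
    using limit_variance_bounds[OF a] by blast
  show ?thesis
  proof (rule exI[of _ t0], rule exI[of _ D], intro conjI allI impI t0)
    fix M :: "'a measure" and \<tau> \<omega> h t
    assume st: "stationary_tazrp \<rho> M \<tau> \<omega> h" and t: "t0 \<le> t"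
    interpret stationary_tazrp \<rho> M \<tau> \<omega> h by (rule st)
    have "1 - a = 1 / (1 + \<rho>)" using assms by (simp add: a_def field_simps)
    then have speed: "char_speed \<rho> * t = (1 - a)\<^sup>2 * t" by (simp add: char_speed_def power_divide)
    \<comment> \<open>The speed is positive, so rounding towards the origin is rounding down, as in
      \<open>sites\<close>.\<close>
    have "0 \<le> (1 - a)\<^sup>2 * t" using t t0 by simp
    then have J: "char_current \<rho> h t = h (int (sites a t)) t"
      by (simp add: char_current_def round_to_origin_def speed sites_def fun_eq_iff)
    have rv: "random_variable (count_space UNIV) (h (int (sites a t)) t)"
      using height_measurable t t0 by simp
    obtain Q where Q: "distr M (count_space UNIV) (h (int (sites a t)) t) = measure_pmf Q"
      "\<And>k. pmf Q k = prob {x\<in>space M. h (int (sites a t)) t x = k}"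
      using integer_variable_law[OF rv] by blast
    have "(\<lambda>p. pmf (current_pmf (p + sites a t) p t a a) k) \<longlonglongrightarrow> pmf Q k" for k
    proof (rule LIM_zero_cancel, rule tendsto_rabs_zero_cancel,
        rule tendsto_sandwich[of "\<lambda>_. 0" _ _ "\<lambda>p. (1 - exp (- t)) ^ p"])
      show "eventually (\<lambda>p. \<bar>pmf (current_pmf (p + sites a t) p t a a) k - pmf Q k\<bar> \<le> (1 - exp (- t)) ^ p) sequentially"
        using current_law_error[OF assms, of t] t t0
        unfolding eventually_sequentially Q(2) a_def by (intro exI[of _ 1]) auto
      show "(\<lambda>p. (1 - exp (- t)) ^ p) \<longlonglongrightarrow> 0" using t t0 by (intro LIMSEQ_realpow_zero) auto
    qed auto
    note b = bounds[OF t this]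
    have ex: "expectation (\<lambda>x. g (h (int (sites a t)) t x)) = measure_pmf.expectation Q g" for g :: "int \<Rightarrow> real"
      unfolding Q(1)[symmetric] using rv by (subst integral_distr) auto
    have var: "variance (\<lambda>x. real_of_int (char_current \<rho> h t x)) = measure_pmf.variance Q real_of_int"
      unfolding J using ex[of real_of_int] ex[of "\<lambda>j. (real_of_int j - measure_pmf.expectation Q real_of_int)\<^sup>2"] by simp
    show "inverse D * t powr (2 / 3) \<le> variance (\<lambda>x. real_of_int (char_current \<rho> h t x))"
      "variance (\<lambda>x. real_of_int (char_current \<rho> h t x)) \<le> D * t powr (2 / 3)"
      unfolding var using b by auto
  qed
qed

end
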